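(* Consider the dynamics on $\mathbb{R}^{2d}$ $$\mathrm{d}q_t=M^{-1}p_t\,\mathrm{d}t-\mu J_1\nabla V(q_t)\,\mathrm{d}t,$$ $$\mathrm{d}p_t=-\nabla V(q_t)\,\mathrm{d}t-\mu J_2M^{-1}p_t\,\mathrm{d}t-\Gamma M^{-1}p_t\,\mathrm{d}t+\sqrt{2\Gamma}\,\mathrm{d}W_t,$$ with $V(q)=\frac12q\cdot Sq$. Assume that $M=S$, $\Gamma=\gamma S$ with $\gamma>\sqrt2$, and $SJ_1S=J_2$. Let $f(q)=q\cdot Kq+l\cdot q+C$ with $K\in\mathbb{R}^{d\times d}$ symmetric, $l\in\mathbb{R}^d$, $C\in\mathbb{R}$. If at least one of the conditions $KJ_1S\ne SJ_1K$ and $l\notin\ker J_1$ is satisfied, then the asymptotic variance $\sigma_f^2=\sigma_f^2(\mu)$ is at a local maximum for the unperturbed sampler, i.e. $$\partial_\mu\sigma_f^2\big|_{\mu=0}=0\qquad\text{and}\qquad\partial_\mu^2\sigma_f^2\big|_{\mu=0}<0 .$$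
   Context: $S\in\mathbb{R}^{d\times d}$ is symmetric positive definite, $J_1,J_2\in\mathbb{R}^{d\times d}$ are skew-symmetric, $\mu\in\mathbb{R}$, $W$ is a standard $d$-dimensional Brownian motion. The dynamics is ergodic with invariant measure $\widehat\pi=\pi\otimes\mathcal{N}(0,M)$, where $\pi=\mathcal{N}(0,S^{-1})$. Let $\mathcal{L}$ be the generator of its Markov semigroup on $L^2(\widehat\pi)$. For $f\in L^2(\pi)$, regarded as a function of $(q,p)$ depending on $q$ only, the asymptotic variance is $\sigma_f^2=\langle\chi,f-\pi(f)\rangle_{L^2(\widehat\pi)}$, where $\chi\in\mathcal{D}(\mathcal{L})$ is the unique solution of $-\mathcal{L}\chi=f-\pi(f)$, $\widehat\pi(\chi)=0$. *)

theory Defs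
  imports "HOL-Probability.Probability"
begin

definition symmetric_matrix :: "real ^ 'n ^ 'n \<Rightarrow> bool" where
  "symmetric_matrix A \<longleftrightarrow> transpose A = A"

definition skew_symmetric_matrix :: "real ^ 'n ^ 'n \<Rightarrow> bool" where
  "skew_symmetric_matrix A \<longleftrightarrow> transpose A = - A"

definition positive_definite_matrix :: "real ^ 'n ^ 'n \<Rightarrow> bool" where
  "positive_definite_matrix A \<longleftrightarrow> symmetric_matrix A \<and> (\<forall>x. x \<noteq> 0 \<longrightarrow> x \<bullet> (A *v x) > 0)"

text \<open>\<open>R\<close> is the (unique) positive semidefinite square root of \<open>A\<close>.\<close>

definition is_matrix_sqrt :: "real ^ 'n ^ 'n \<Rightarrow> real ^ 'n ^ 'n \<Rightarrow> bool" where
  "is_matrix_sqrt R A \<longleftrightarrow> symmetric_matrix R \<and> (\<forall>x. x \<bullet> (R *v x) \<ge> 0) \<and> R ** R = A"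

definition gradient :: "('a::real_inner \<Rightarrow> real) \<Rightarrow> 'a \<Rightarrow> 'a" where
  "gradient f x = (THE D. GDERIV f x :> D)"

text \<open>The Gaussian law on \<open>\<real>\<^sup>n\<close> with mean zero and positive definite covariance matrix \<open>C\<close>.\<close>

definition centered_gaussian :: "real ^ 'n ^ 'n \<Rightarrow> (real ^ 'n) measure" where
  "centered_gaussian C = density lborel
     (\<lambda>x. ennreal (exp (- (x \<bullet> (matrix_inv C *v x)) / 2) / sqrt ((2 * pi) ^ CARD('n) * det C)))"

definition standard_brownian_motion :: "'w measure \<Rightarrow> (real \<Rightarrow> 'w \<Rightarrow> real ^ 'n) \<Rightarrow> bool" where
  "standard_brownian_motion \<Omega> W \<longleftrightarrow>
     prob_space \<Omega> \<and>
     (\<forall>t\<ge>0. W t \<in> borel_measurable \<Omega>) \<and>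
     (AE \<omega> in \<Omega>. W 0 \<omega> = 0) \<and>
     (AE \<omega> in \<Omega>. continuous_on {0..} (\<lambda>t. W t \<omega>)) \<and>
     (\<forall>s t. 0 \<le> s \<and> s < t \<longrightarrow>
        distr \<Omega> borel (\<lambda>\<omega>. W t \<omega> - W s \<omega>) = centered_gaussian ((t - s) *\<^sub>R mat 1)) \<and>
     (\<forall>(n::nat) (\<tau> :: nat \<Rightarrow> real). 0 \<le> \<tau> 0 \<and> (\<forall>i<n. \<tau> i < \<tau> (Suc i)) \<longrightarrow>
        prob_space.indep_vars \<Omega> (\<lambda>_. borel) (\<lambda>i \<omega>. W (\<tau> (Suc i)) \<omega> - W (\<tau> i) \<omega>) {..<n})"

text \<open>
  \<open>X x t\<close> is the state \<open>(q\<^sub>t, p\<^sub>t)\<close> at time \<open>t\<close> of the solution started at \<open>x\<close>. The matrix \<open>R\<close>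
  stands for the noise coefficient \<open>(2\<Gamma>)\<^sup>1\<^sup>/\<^sup>2\<close>. As this coefficient is constant, the stochastic
  integral \<open>\<integral>R dW\<close> up to time \<open>t\<close> is \<open>R W\<^sub>t\<close>, so the equation in integral form only involves
  pathwise time integrals.
\<close>

definition perturbed_langevin_dynamics ::
  "'w measure \<Rightarrow> (real \<Rightarrow> 'w \<Rightarrow> real ^ 'n) \<Rightarrow> (real ^ 'n \<Rightarrow> real) \<Rightarrow> real ^ 'n ^ 'n \<Rightarrow> real ^ 'n ^ 'n \<Rightarrow>
   real ^ 'n ^ 'n \<Rightarrow> real ^ 'n ^ 'n \<Rightarrow> real ^ 'n ^ 'n \<Rightarrow> real \<Rightarrow>
   ((real ^ 'n) \<times> (real ^ 'n) \<Rightarrow> real \<Rightarrow> 'w \<Rightarrow> (real ^ 'n) \<times> (real ^ 'n)) \<Rightarrow> bool" where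
  "perturbed_langevin_dynamics \<Omega> W V M \<Gamma> R J1 J2 \<mu> X \<longleftrightarrow>
     (\<forall>x. (\<forall>t\<ge>0. X x t \<in> borel_measurable \<Omega>) \<and>
       (AE \<omega> in \<Omega>. continuous_on {0..} (\<lambda>t. X x t \<omega>) \<and>
         (\<forall>t\<ge>0.
            fst (X x t \<omega>) = fst x
              + integral {0..t} (\<lambda>s. matrix_inv M *v snd (X x s \<omega>)
                                   - \<mu> *\<^sub>R (J1 *v gradient V (fst (X x s \<omega>)))) \<and>
            snd (X x t \<omega>) = snd x
              + integral {0..t} (\<lambda>s. - gradient V (fst (X x s \<omega>))
                                   - \<mu> *\<^sub>R (J2 *v (matrix_inv M *v snd (X x s \<omega>)))
                                   - \<Gamma> *v (matrix_inv M *v snd (X x s \<omega>)))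
              + R *v W t \<omega>)))"

definition square_integrable :: "'a measure \<Rightarrow> ('a \<Rightarrow> real) \<Rightarrow> bool" where
  "square_integrable \<nu> g \<longleftrightarrow> g \<in> borel_measurable \<nu> \<and> integrable \<nu> (\<lambda>x. (g x)\<^sup>2)"

definition markov_semigroup ::
  "'w measure \<Rightarrow> ('x \<Rightarrow> real \<Rightarrow> 'w \<Rightarrow> 'x) \<Rightarrow> real \<Rightarrow> ('x \<Rightarrow> real) \<Rightarrow> 'x \<Rightarrow> real" where
  "markov_semigroup \<Omega> X t g x = (\<integral>\<omega>. g (X x t \<omega>) \<partial>\<Omega>)"

text \<open>
  The graph of the generator \<open>\<L>\<close> on \<open>L\<^sup>2(\<nu>)\<close>: \<open>g\<close> represents an element of the domain, and \<open>h\<close>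
  represents \<open>\<L> g\<close>. Elements of \<open>L\<^sup>2(\<nu>)\<close> are represented by functions, so \<open>h\<close> is determined
  up to equality \<open>\<nu>\<close>-almost everywhere. The squared \<open>L\<^sup>2\<close> distance is an \<open>ennreal\<close>-valued integral,
  which is infinite (and not \<open>0\<close>) when the difference is not square integrable.
\<close>

definition generator ::
  "'w measure \<Rightarrow> ('x \<Rightarrow> real \<Rightarrow> 'w \<Rightarrow> 'x) \<Rightarrow> 'x measure \<Rightarrow> ('x \<Rightarrow> real) \<Rightarrow> ('x \<Rightarrow> real) \<Rightarrow> bool" where
  "generator \<Omega> X \<nu> g h \<longleftrightarrow> square_integrable \<nu> g \<and> square_integrable \<nu> h \<and>
     ((\<lambda>t. \<integral>\<^sup>+x. ennreal (((markov_semigroup \<Omega> X t g x - g x) / t - h x)\<^sup>2) \<partial>\<nu>) \<longlongrightarrow> 0) (at_right 0)"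

text \<open>\<open>u\<close> is the mean-zero solution in the domain of the generator of the Poisson equation
  \<open>- \<L> u = \<phi>\<close>.\<close>

definition poisson_solution ::
  "'w measure \<Rightarrow> ('x \<Rightarrow> real \<Rightarrow> 'w \<Rightarrow> 'x) \<Rightarrow> 'x measure \<Rightarrow> ('x \<Rightarrow> real) \<Rightarrow> ('x \<Rightarrow> real) \<Rightarrow> bool" where
  "poisson_solution \<Omega> X \<nu> \<phi> u \<longleftrightarrow> generator \<Omega> X \<nu> u (\<lambda>x. - \<phi> x) \<and> (\<integral>x. u x \<partial>\<nu>) = 0"

text \<open>
  Here \<open>\<pi>\<close> is the law of positions, \<open>\<kappa>\<close> that of momenta, and \<open>f\<close> an observable of the position.
  The definite description ranges over the values of the inner product because \<open>u\<close> is unique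
  only up to \<open>\<pi> \<otimes> \<kappa>\<close>-null sets.
\<close>

definition asymptotic_variance ::
  "'w measure \<Rightarrow> ('q \<times> 'p \<Rightarrow> real \<Rightarrow> 'w \<Rightarrow> 'q \<times> 'p) \<Rightarrow> 'q measure \<Rightarrow> 'p measure \<Rightarrow> ('q \<Rightarrow> real) \<Rightarrow> real" where
  "asymptotic_variance \<Omega> X \<pi> \<kappa> f =
     (let \<phi> = (\<lambda>x. f (fst x) - (\<integral>q. f q \<partial>\<pi>)) in
      THE v. \<exists>u. poisson_solution \<Omega> X (\<pi> \<Otimes>\<^sub>M \<kappa>) \<phi> u \<and>
                 v = (\<integral>x. u x * \<phi> x \<partial>(\<pi> \<Otimes>\<^sub>M \<kappa>)))"

end

theory Submission
  imports Defs
begin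

text \<open>
  Let \<open>H\<close> be the square root of \<open>S\<close>. In the variables \<open>(H q, H\<^sup>-\<^sup>1 p)\<close> the invariant law is the
  standard Gaussian, and the drift is \<open>(q, p) \<mapsto> (p - \<mu> J q, - q - \<mu> J p - \<gamma> p)\<close> with the
  skew-symmetric matrix \<open>J = H J1 H\<close>. The Poisson equation has a quadratic solution. Its coefficients
  solve a linear system that is affine in \<open>\<mu>\<close>, so a Neumann series expands the asymptotic variance at
  \<open>\<mu> = 0\<close>. Since \<open>J\<close> and the commutator with \<open>J\<close> are skew, the first order term vanishes, and the second
  derivative is
  \<open>- (\<gamma>\<^sup>6 - \<gamma>\<^sup>4 + \<gamma>\<^sup>2 + 4) / (2 \<gamma>\<^sup>3) |[K, J]|\<^sup>2 - 2 \<gamma> (\<gamma>\<^sup>2 - 2) |J l|\<^sup>2\<close>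
  for the transformed \<open>K\<close> and \<open>l\<close>.

  The variance is defined through an arbitrary square integrable solution of the Poisson equation. The
  noise accumulated up to time \<open>t\<close> is Gaussian, which gives the joint law of the stationary process at
  the times \<open>0\<close> and \<open>t\<close>: reversing time and flipping the momenta turns \<open>\<mu>\<close> into \<open>- \<mu>\<close>. By this duality,
  the pairing of any solution with the observable equals the pairing of the explicit solution for
  \<open>- \<mu>\<close>, so neither ergodicity nor a spectral gap is needed.
\<close>

subsection \<open>Characteristic functions on Euclidean spaces\<close>

text \<open>The definite description in the asymptotic variance demands an explicit solution, and
  also that every other solution, of which only square integrability is known, gives the same
  pairing. Uniqueness of the solution itself is never shown. The observable depends on positions
  only, hence is unchanged by the momentum flip; this is what lets the adjointness of the generators
  for \<mu> and -\<mu> compare pairings with one and the same observable. In particular the variance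
  is even in \<mu> near 0.

  In the normalised variables the stationary covariance is the identity, so the law at two times is
  determined by its cross-covariance, the linear flow \<open>exp (t B)\<close>, and reversal
  replaces the flow by its adjoint. Identities between such laws are read off from characteristic
  functions.

  The bound \<gamma> > sqrt 2 decides the sign of the linear contribution: at second order in \<mu>
  the position part of the linear term in the solution is \<gamma> (\<gamma>^2 - 2) times
  \<open>J (J l)\<close>.\<close>

definition cf :: "'a::euclidean_space measure \<Rightarrow> 'a \<Rightarrow> complex" where
  "cf M \<theta> = (CLINT x|M. iexp (\<theta> \<bullet> x))"

text \<open>The value of the characteristic function at 0 is the total mass, so both measures can be
  normalised and compared by \<open>Levy_uniqueness\<close>. Masses other than one occur below
  because measures are multiplied by weights such as 1 + cos.\<close>

lemma finite_Levy_uniqueness: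
  fixes M1 M2 :: "real measure"
  assumes fin: "finite_measure M1" "finite_measure M2"
    and sets: "sets M1 = sets borel" "sets M2 = sets borel"
    and eq: "\<And>t. char M1 t = char M2 t"
  shows "M1 = M2"
proof -
  interpret M1: finite_measure M1 by fact
  interpret M2: finite_measure M2 by fact
  have sp: "space M1 = UNIV" "space M2 = UNIV"
    using sets_eq_imp_space_eq[OF sets(1)] sets_eq_imp_space_eq[OF sets(2)] by simp_all
  have "measure M1 UNIV = measure M2 UNIV"
    using eq[of 0] sp by (simp add: char_def)
  then have m: "measure M2 UNIV = measure M1 UNIV" by simp
  define m where "m = measure M1 UNIV"
  show ?thesis
  proof (cases "m = 0")
    case True
    have z: "emeasure M1 A = 0" "emeasure M2 A = 0" for A
    proof -
      have "emeasure M1 UNIV = 0" "emeasure M2 UNIV = 0"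
        using True m unfolding m_def by (simp_all add: M1.emeasure_eq_measure M2.emeasure_eq_measure)
      then show "emeasure M1 A = 0" "emeasure M2 A = 0"
        using emeasure_space[of M1 A] emeasure_space[of M2 A] sp by auto
    qed
    show ?thesis by (rule measure_eqI) (simp_all add: sets z)
  next
    case False
    then have mpos: "m > 0" unfolding m_def by (simp add: zero_less_measure_iff)
    define N where "N M = scale_measure (ennreal (1 / m)) (M :: real measure)" for M
    have emN: "emeasure (N M) A = ennreal (1 / m) * emeasure M A" for M A
      by (simp add: N_def)
    have Nd: "N M = density M (\<lambda>_. ennreal (1 / m))" for M
      unfolding N_def by (rule measure_eqI) (auto simp: emeasure_density nn_integral_cmult_indicator)
    have "real_distribution (N M)" if "sets M = sets borel" "emeasure M UNIV = ennreal m" for M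
    proof -
      have "emeasure (N M) (space (N M)) = 1"
      proof -
        have "space (N M) = UNIV" using that(1) unfolding N_def
          by (metis sets_eq_imp_space_eq space_borel space_scale_measure)
        then show ?thesis using that(2) mpos
          by (simp add: emN ennreal_mult[symmetric] flip: ennreal_mult)
      qed
      then show ?thesis
        using that(1) sets_eq_imp_space_eq[OF that(1)]
        by (auto simp: real_distribution_def real_distribution_axioms_def N_def intro!: prob_spaceI)
    qed
    then have rd: "real_distribution (N M1)" "real_distribution (N M2)"
      using sets m by (auto simp: m_def M1.emeasure_eq_measure M2.emeasure_eq_measure)
    have "char (N M) t = (1/m) * char M t" if "sets M = sets borel" for M t
    proof -
      have [measurable]: "iexp \<in> borel_measurable borel" 
        by (intro borel_measurable_continuous_onI continuous_intros)
      have "char (N M) t = (CLINT x|M. (1/m) *\<^sub>R iexp (t * x))"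
        unfolding char_def Nd using mpos that
        by (subst integral_density) auto
      then show ?thesis unfolding char_def by (simp add: scaleR_conv_of_real)
    qed
    then have "N M1 = N M2"
      using eq sets by (intro Levy_uniqueness rd ext) simp
    then have "emeasure (N M1) A = emeasure (N M2) A" for A by simp
    then have *: "ennreal (1/m) * emeasure M1 A = ennreal (1/m) * emeasure M2 A" for A
      by (simp add: emN)
    have "emeasure M1 A = emeasure M2 A" for A
    proof -
      have "ennreal m * (ennreal (1/m) * emeasure M1 A) = ennreal m * (ennreal (1/m) * emeasure M2 A)"
        by (simp add: *)
      moreover have "ennreal m * ennreal (1/m) = 1"
        using mpos by (simp flip: ennreal_mult)
      ultimately show ?thesis by (simp add: mult.assoc[symmetric])
    qed
    then show ?thesis using sets by (intro measure_eqI) auto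
  qed
qed

text \<open>Coordinates are resolved one at a time: multiplied by the nonnegative weight \<open>1 + cos (\<theta> \<bullet> x + \<alpha>)\<close>
  and projected to the next coordinate, both measures have the same characteristic function on the line.\<close>

lemma cf_uniqueness:
  fixes M1 M2 :: "'a::euclidean_space measure"
  assumes fin: "finite_measure M1" "finite_measure M2"
    and sets: "sets M1 = sets borel" "sets M2 = sets borel"
    and eq: "\<And>\<theta>. cf M1 \<theta> = cf M2 \<theta>"
  shows "M1 = M2"
proof -
  interpret M1: finite_measure M1 by fact
  interpret M2: finite_measure M2 by fact
  have [measurable_cong]: "sets M1 = sets borel" "sets M2 = sets borel" by fact+
  \<comment> \<open>\<open>I A S\<close> is the indicator of the cylinder set that prescribes the
    coordinates in \<open>A\<close>; the coordinates outside \<open>A\<close> are still tested by a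
    cosine only.\<close>
  define I :: "'a set \<Rightarrow> ('a \<Rightarrow> real set) \<Rightarrow> 'a \<Rightarrow> real" where
    "I A S = (\<lambda>x. \<Prod>b\<in>A. indicator (S b) (x \<bullet> b))" for A S
  have Imeas: "I A S \<in> borel_measurable borel" if "\<And>b. S b \<in> sets borel" for A S
  proof -
    have [measurable]: "S b \<in> sets borel" for b by (rule that)
    show ?thesis unfolding I_def by measurable
  qed
  have I01: "0 \<le> I A S x" "I A S x \<le> 1" for A S x
    unfolding I_def by (auto intro!: prod_nonneg prod_le_1 simp: indicator_def)
  have int: "integrable M (\<lambda>x. I A S x * h x)"
    if "finite_measure M" "sets M = sets borel" "\<And>b. S b \<in> sets borel" "h \<in> borel_measurable borel"
      "\<And>x. \<bar>h x\<bar> \<le> 2" for M A S and h :: "'a \<Rightarrow> real"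
  proof -
    interpret finite_measure M by fact
    have [measurable_cong]: "sets M = sets borel" by fact
    have [measurable]: "I A S \<in> borel_measurable borel" "h \<in> borel_measurable borel"
      using Imeas[OF that(3)] that(4) by auto
    show ?thesis
    proof (rule integrable_const_bound[where B=2])
      show "AE x in M. norm (I A S x * h x) \<le> 2"
      proof (rule AE_I2)
        fix x
        have "\<bar>I A S x\<bar> * \<bar>h x\<bar> \<le> 1 * 2"
          using I01[of A S x] that(5)[of x] by (intro mult_mono) auto
        then show "norm (I A S x * h x) \<le> 2" by (simp add: abs_mult)
      qed
    qed measurable
  qed
  \<comment> \<open>Frequency and phase stay general: the product of two cosines yields the
    frequencies \<theta> + t b and \<theta> - t b with the phases \<alpha> + \<beta> and \<alpha> -
    \<beta>, and the induction hypothesis is applied to these.\<close>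
  have key: "(\<integral>x. I A S x * cos (\<theta> \<bullet> x + \<alpha>) \<partial>M1) = (\<integral>x. I A S x * cos (\<theta> \<bullet> x + \<alpha>) \<partial>M2)"
    if "finite A" "\<And>b. S b \<in> sets borel" for A S \<theta> \<alpha>
    using that
  proof (induction A arbitrary: \<theta> \<alpha> rule: finite_induct)
    case empty
    have "(\<integral>x. cos (\<theta> \<bullet> x + \<alpha>) \<partial>M) = Re (cis \<alpha> * cf M \<theta>)"
      if "finite_measure M" "sets M = sets borel" for M
    proof -
      interpret finite_measure M by fact
      have [measurable_cong]: "sets M = sets borel" by fact
      have i: "integrable M (\<lambda>x. iexp (\<theta> \<bullet> x))"
        by (rule integrable_const_bound[where B=1]) auto
      have "Re (cis \<alpha> * cf M \<theta>) = Re (CLINT x|M. cis \<alpha> * iexp (\<theta> \<bullet> x))"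
        unfolding cf_def by (subst integral_mult_right_zero) simp
      also have "\<dots> = (\<integral>x. Re (cis \<alpha> * iexp (\<theta> \<bullet> x)) \<partial>M)"
        using i by (intro integral_Re[symmetric]) auto
      also have "\<dots> = (\<integral>x. cos (\<theta> \<bullet> x + \<alpha>) \<partial>M)"
        by (intro Bochner_Integration.integral_cong refl) (simp add: cis_conv_exp[symmetric] cos_add)
      finally show ?thesis by simp
    qed
    from this[OF fin(1) sets(1)] this[OF fin(2) sets(2)] show ?case by (simp add: I_def eq)
  next
    case (insert b A)
    note S = \<open>\<And>b. S b \<in> sets borel\<close>
    have main: "(\<integral>x. I (insert b A) S x * 1 \<partial>M1) + (\<integral>x. I (insert b A) S x * cos (\<theta> \<bullet> x + \<alpha>) \<partial>M1)
      = (\<integral>x. I (insert b A) S x * 1 \<partial>M2) + (\<integral>x. I (insert b A) S x * cos (\<theta> \<bullet> x + \<alpha>) \<partial>M2)" for \<theta> \<alpha>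
    proof -
      define w where "w x = I A S x * (1 + cos (\<theta> \<bullet> x + \<alpha>))" for x
      have [measurable]: "I A S \<in> borel_measurable borel" using Imeas[OF S] by auto
      have [measurable]: "w \<in> borel_measurable borel" unfolding w_def by measurable
      have w0: "0 \<le> w x" for x
      proof -
        have "0 \<le> 1 + cos (\<theta> \<bullet> x + \<alpha>)" using cos_ge_minus_one[of "\<theta> \<bullet> x + \<alpha>"] by linarith
        then show ?thesis unfolding w_def using I01 by (intro mult_nonneg_nonneg) auto
      qed
      have c2: "\<bar>1 + cos y\<bar> \<le> 2" for y :: real
        using cos_ge_minus_one[of y] cos_le_one[of y] unfolding abs_le_iff by linarith
      have c1: "\<bar>cos y\<bar> \<le> 2" for y :: real
        using abs_cos_le_one[of y] by linarith
      have inte: "integrable M w" if "finite_measure M" "sets M = sets borel" for M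
        unfolding w_def by (intro int that S) (auto intro: c2)
      define D where "D M = distr (density M (\<lambda>x. ennreal (w x))) borel (\<lambda>x. x \<bullet> b)" for M
      have D: "finite_measure (D M)" "sets (D M) = sets borel"
        if "finite_measure M" "sets M = sets borel" for M
      proof -
        have [measurable_cong]: "sets M = sets borel" by fact
        have "finite_measure (density M (\<lambda>x. ennreal (w x)))"
          using inte[OF that] integrable_iff_bounded[of M w] w0
          by (intro finite_measureI) (auto simp: emeasure_density)
        then show "finite_measure (D M)" unfolding D_def
          by (intro finite_measure.finite_measure_distr) auto
      qed (simp add: D_def)
      have Dint: "(\<integral>y. h y \<partial>D M) = (\<integral>x. w x * h (x \<bullet> b) \<partial>M)"
        if "sets M = sets borel" and h: "h \<in> borel_measurable borel" for M and h :: "real \<Rightarrow> real"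
      proof -
        have [measurable_cong]: "sets M = sets borel" by fact
        have [measurable]: "h \<in> borel_measurable borel" by fact
        show ?thesis unfolding D_def using w0
          by (subst integral_distr) (auto simp: integral_density)
      qed
      have ch: "(\<integral>x. w x * cos (t * (x \<bullet> b) + \<beta>) \<partial>M1) = (\<integral>x. w x * cos (t * (x \<bullet> b) + \<beta>) \<partial>M2)" for t \<beta>
      proof -
        have "(\<integral>x. w x * cos (t * (x \<bullet> b) + \<beta>) \<partial>M) =
              (\<integral>x. I A S x * cos ((t *\<^sub>R b) \<bullet> x + \<beta>) \<partial>M)
            + 1/2 * (\<integral>x. I A S x * cos ((\<theta> + t *\<^sub>R b) \<bullet> x + (\<alpha> + \<beta>)) \<partial>M)
            + 1/2 * (\<integral>x. I A S x * cos ((\<theta> - t *\<^sub>R b) \<bullet> x + (\<alpha> - \<beta>)) \<partial>M)"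
          if M: "finite_measure M" "sets M = sets borel" for M
        proof -
          have i: "integrable M (\<lambda>x. I A S x * cos (\<eta> \<bullet> x + \<delta>))" for \<eta> \<delta>
            by (intro int M S) (auto intro: c1)
          have "(\<integral>x. w x * cos (t * (x \<bullet> b) + \<beta>) \<partial>M) =
            (\<integral>x. I A S x * cos ((t *\<^sub>R b) \<bullet> x + \<beta>) + 1/2 * (I A S x * cos ((\<theta> + t *\<^sub>R b) \<bullet> x + (\<alpha> + \<beta>)))
             + 1/2 * (I A S x * cos ((\<theta> - t *\<^sub>R b) \<bullet> x + (\<alpha> - \<beta>))) \<partial>M)"
          proof (intro Bochner_Integration.integral_cong refl)
            fix x
            have 1: "cos u * cos v = 1/2 * cos (u + v) + 1/2 * cos (u - v)" for u v :: real
              by (simp add: cos_times_cos add_divide_distrib)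
            have "w x * cos (t * (x \<bullet> b) + \<beta>) = I A S x * cos ((t *\<^sub>R b) \<bullet> x + \<beta>)
               + I A S x * (cos (\<theta> \<bullet> x + \<alpha>) * cos ((t *\<^sub>R b) \<bullet> x + \<beta>))"
              unfolding w_def by (simp add: algebra_simps inner_commute)
            also have "\<dots> = I A S x * cos ((t *\<^sub>R b) \<bullet> x + \<beta>) + 1/2 * (I A S x * cos ((\<theta> + t *\<^sub>R b) \<bullet> x + (\<alpha> + \<beta>)))
             + 1/2 * (I A S x * cos ((\<theta> - t *\<^sub>R b) \<bullet> x + (\<alpha> - \<beta>)))"
              unfolding 1 by (simp add: algebra_simps)
            finally show "w x * cos (t * (x \<bullet> b) + \<beta>) = \<dots>" .
          qed
          also have "\<dots> = (\<integral>x. I A S x * cos ((t *\<^sub>R b) \<bullet> x + \<beta>) \<partial>M)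
            + 1/2 * (\<integral>x. I A S x * cos ((\<theta> + t *\<^sub>R b) \<bullet> x + (\<alpha> + \<beta>)) \<partial>M)
            + 1/2 * (\<integral>x. I A S x * cos ((\<theta> - t *\<^sub>R b) \<bullet> x + (\<alpha> - \<beta>)) \<partial>M)"
            using i by (simp del: inner_scaleR_left)
          finally show ?thesis .
        qed
        from this[OF fin(1) sets(1)] this[OF fin(2) sets(2)] show ?thesis
          by (simp only: insert.IH[OF S])
      qed
      \<comment> \<open>The phase - pi / 2 turns the cosine into the sine, so \<open>ch\<close>
        covers the real and the imaginary part.\<close>
      have chD: "char (D M) t = Complex (\<integral>x. w x * cos (t * (x \<bullet> b) + 0) \<partial>M) (\<integral>x. w x * cos (t * (x \<bullet> b) + (- pi/2)) \<partial>M)"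
        if M: "finite_measure M" "sets M = sets borel" for M t
      proof -
        interpret D: finite_measure "D M" by (rule D[OF M])
        have [measurable_cong]: "sets (D M) = sets borel" by (rule D[OF M])
        have i: "integrable (D M) (\<lambda>x. iexp (t * x))"
          by (rule D.integrable_const_bound[where B=1]) auto
        have "char (D M) t = Complex (\<integral>y. cos (t * y + 0) \<partial>D M) (\<integral>y. cos (t * y + (- pi/2)) \<partial>D M)"
        proof (rule complex_eqI)
          have "Re (char (D M) t) = (\<integral>y. Re (iexp (t * y)) \<partial>D M)"
            unfolding char_def by (rule integral_Re[OF i, symmetric])
          then show "Re (char (D M) t) = Re (Complex (\<integral>y. cos (t * y + 0) \<partial>D M) (\<integral>y. cos (t * y + (- pi/2)) \<partial>D M))"
            by (simp add: Re_exp)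
          have "Im (char (D M) t) = (\<integral>y. Im (iexp (t * y)) \<partial>D M)"
            unfolding char_def by (rule integral_Im[OF i, symmetric])
          then show "Im (char (D M) t) = Im (Complex (\<integral>y. cos (t * y + 0) \<partial>D M) (\<integral>y. cos (t * y + (- pi/2)) \<partial>D M))"
            by (simp add: Im_exp cos_diff)
        qed
        then show ?thesis
          using Dint[OF M(2), of "\<lambda>y. cos (t * y + 0)"] Dint[OF M(2), of "\<lambda>y. cos (t * y + (- pi / 2))"] by simp
      qed
      have "D M1 = D M2"
        using D[OF fin(1) sets(1)] D[OF fin(2) sets(2)]
        by (intro finite_Levy_uniqueness) (auto simp only: chD fin sets ch)
      then have 1: "(\<integral>x. w x * indicator (S b) (x \<bullet> b) \<partial>M1) = (\<integral>x. w x * indicator (S b) (x \<bullet> b) \<partial>M2)"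
        using Dint[OF sets(1) borel_measurable_indicator[OF S[of b]]]
          Dint[OF sets(2) borel_measurable_indicator[OF S[of b]]] by metis
      have II: "I (insert b A) S x = I A S x * indicator (S b) (x \<bullet> b)" for x
        unfolding I_def using insert.hyps by simp
      have 2: "(\<integral>x. w x * indicator (S b) (x \<bullet> b) \<partial>M) =
           (\<integral>x. I (insert b A) S x * 1 \<partial>M) + (\<integral>x. I (insert b A) S x * cos (\<theta> \<bullet> x + \<alpha>) \<partial>M)"
        if M: "finite_measure M" "sets M = sets borel" for M
      proof -
        have "(\<integral>x. w x * indicator (S b) (x \<bullet> b) \<partial>M) =
           (\<integral>x. I (insert b A) S x * 1 + I (insert b A) S x * cos (\<theta> \<bullet> x + \<alpha>) \<partial>M)"
          by (intro Bochner_Integration.integral_cong refl) (simp add: II w_def algebra_simps)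
        also have "\<dots> = (\<integral>x. I (insert b A) S x * 1 \<partial>M) + (\<integral>x. I (insert b A) S x * cos (\<theta> \<bullet> x + \<alpha>) \<partial>M)"
          by (intro Bochner_Integration.integral_add int M S) (auto intro: c1)
        finally show ?thesis .
      qed
      show ?thesis using 1 unfolding 2[OF fin(1) sets(1)] 2[OF fin(2) sets(2)] .
    qed
    \<comment> \<open>For \<theta> = 0 and \<alpha> = 0 the two summands of \<open>main\<close>
      coincide. This gives equality of the plain integrals, which are then subtracted in the general
      case.\<close>
    from main[of 0 0] main[of \<theta> \<alpha>] show ?case by simp
  qed
  show ?thesis
  proof (rule measure_eqI_generator_eq)
    let ?E = "range (\<lambda>(a, b). box a b :: 'a set)"
    show "Int_stable ?E" by (auto simp: Int_stable_def box_Int_box)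
    show "?E \<subseteq> Pow UNIV" "sets M1 = sigma_sets UNIV ?E" "sets M2 = sigma_sets UNIV ?E"
      using sets by (simp_all add: borel_eq_box)
    let ?A = "\<lambda>n::nat. box (- (real n *\<^sub>R One)) (real n *\<^sub>R One) :: 'a set"
    show "range ?A \<subseteq> ?E" "(\<Union>i. ?A i) = UNIV"
      unfolding UN_box_eq_UNIV by auto
    show "emeasure M1 (?A i) \<noteq> \<infinity>" for i by simp
    fix X assume "X \<in> ?E"
    then obtain a b where X: "X = box a b" by auto
    have "measure M X = (\<integral>x. I Basis (\<lambda>i. {a \<bullet> i <..< b \<bullet> i}) x * cos (0 \<bullet> x + 0) \<partial>M)"
      if "finite_measure M" "sets M = sets borel" for M
    proof -
      have sp: "space M = UNIV" using sets_eq_imp_space_eq[OF that(2)] by simp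
      have "I Basis (\<lambda>i. {a \<bullet> i <..< b \<bullet> i}) x = indicator X x" for x
        unfolding I_def X by (auto simp: indicator_def mem_box prod_zero_iff intro!: prod.neutral)
      then show ?thesis using that(2) by (simp add: X sp)
    qed
    from this[OF fin(1) sets(1)] this[OF fin(2) sets(2)]
    have "measure M1 X = measure M2 X" by (simp only: key[OF finite_Basis borel_open[OF open_greaterThanLessThan]])
    then show "emeasure M1 X = emeasure M2 X"
      by (simp add: M1.emeasure_eq_measure M2.emeasure_eq_measure)
  qed
qed

subsection \<open>Gaussian measures\<close>

text \<open>Stated for every Euclidean space, so that it serves for positions, for momenta and for
  the phase space, which is a product type.\<close>

definition std_gaussian :: "'a::euclidean_space measure" where
  "std_gaussian = density lborel (\<lambda>x. ennreal (exp (- (x \<bullet> x) / 2) / sqrt ((2 * pi) ^ DIM('a))))"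

lemma std_gaussian_density_prod:
  fixes x :: "'a::euclidean_space"
  shows "exp (- (x \<bullet> x) / 2) / sqrt ((2 * pi) ^ DIM('a)) = (\<Prod>b\<in>Basis. std_normal_density (x \<bullet> b))"
proof -
  have "exp (- (x \<bullet> x) / 2) = (\<Prod>b\<in>Basis. exp (- (x \<bullet> b)\<^sup>2 / 2))"
    by (subst euclidean_inner)
       (simp add: exp_sum[symmetric] sum_negf sum_divide_distrib power2_eq_square)
  moreover have "sqrt ((2 * pi) ^ DIM('a)) = (\<Prod>b\<in>(Basis::'a set). sqrt (2 * pi))"
    by (simp add: real_sqrt_power real_sqrt_mult power_mult_distrib)
  ultimately show ?thesis
    by (simp add: std_normal_density_def prod_dividef)
qed

lemma sets_std_gaussian [simp, measurable_cong]: "sets std_gaussian = sets borel"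
  by (simp add: std_gaussian_def)

lemma space_std_gaussian [simp]: "space std_gaussian = UNIV"
  by (simp add: std_gaussian_def)

lemma prob_space_std_gaussian: "prob_space (std_gaussian :: 'a::euclidean_space measure)"
proof (rule prob_spaceI)
  have "emeasure (std_gaussian :: 'a measure) (space std_gaussian)
     = (\<integral>\<^sup>+x. (\<Prod>b\<in>Basis. ennreal (std_normal_density ((x::'a) \<bullet> b))) \<partial>lborel)"
    unfolding std_gaussian_def std_gaussian_density_prod
    by (subst emeasure_density) (auto simp: prod_ennreal)
  also have "\<dots> = (\<Prod>b\<in>(Basis::'a set). \<integral>\<^sup>+x. ennreal (std_normal_density x) \<partial>lborel)"
    by (rule nn_integral_lborel_prod) auto
  also have "(\<integral>\<^sup>+x. ennreal (std_normal_density x) \<partial>lborel) = 1"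
  proof -
    interpret prob_space std_normal_distribution by (rule prob_space_normal_density) simp
    show ?thesis using emeasure_space_1 by (simp add: emeasure_density)
  qed
  finally show "emeasure (std_gaussian :: 'a measure) (space std_gaussian) = 1" by simp
qed

lemma integral_lborel_prod:
  fixes f :: "'a::euclidean_space \<Rightarrow> real \<Rightarrow> complex"
  assumes f: "\<And>b. b \<in> Basis \<Longrightarrow> integrable lborel (f b)"
  shows "(\<integral>x. (\<Prod>b\<in>Basis. f b (x \<bullet> b)) \<partial>lborel) = (\<Prod>b\<in>(Basis::'a set). \<integral>y. f b y \<partial>lborel)"
proof -
  interpret product_sigma_finite "\<lambda>_::'a. lborel :: real measure" by standard
  have [measurable]: "f b \<in> borel_measurable borel" if "b \<in> Basis" for b
    using f[OF that] by simp
  have "(\<integral>x. (\<Prod>b\<in>Basis. f b (x \<bullet> b)) \<partial>lborel)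
      = (\<integral>g. (\<Prod>b\<in>(Basis::'a set). f b (g b)) \<partial>(\<Pi>\<^sub>M b\<in>Basis. lborel))"
    unfolding lborel_eq[where 'a='a]
    by (subst integral_distr) (auto intro!: Bochner_Integration.integral_cong prod.cong)
  also have "\<dots> = (\<Prod>b\<in>(Basis::'a set). \<integral>y. f b y \<partial>lborel)"
    by (rule product_integral_prod) (auto intro: f)
  finally show ?thesis .
qed

lemma cf_std_gaussian: "cf (std_gaussian :: 'a::euclidean_space measure) \<theta> = exp (- (\<theta> \<bullet> \<theta>) / 2)"
proof -
  interpret N: prob_space std_normal_distribution by (rule prob_space_normal_density) simp
  have i: "integrable lborel (\<lambda>y. std_normal_density y *\<^sub>R iexp ((\<theta> \<bullet> b) * y))" for b
  proof -
    have "integrable std_normal_distribution (\<lambda>y. iexp ((\<theta> \<bullet> b) * y))"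
      by (rule N.integrable_const_bound[where B=1]) auto
    then show ?thesis by (subst (asm) integrable_density) auto
  qed
  have "cf (std_gaussian :: 'a measure) \<theta>
    = (\<integral>x. (\<Prod>b\<in>Basis. std_normal_density (x \<bullet> b)) *\<^sub>R iexp (\<theta> \<bullet> x) \<partial>lborel)"
    unfolding cf_def std_gaussian_def std_gaussian_density_prod
    by (subst integral_density) (auto intro!: prod_nonneg)
  also have "\<dots> = (\<integral>x. (\<Prod>b\<in>Basis. std_normal_density (x \<bullet> b) *\<^sub>R iexp ((\<theta> \<bullet> b) * (x \<bullet> b))) \<partial>lborel)"
  proof (rule Bochner_Integration.integral_cong[OF refl])
    fix x :: 'a
    have "iexp (\<theta> \<bullet> x) = (\<Prod>b\<in>Basis. iexp ((\<theta> \<bullet> b) * (x \<bullet> b)))"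
      by (subst euclidean_inner) (simp add: exp_sum sum_distrib_left)
    then show "(\<Prod>b\<in>Basis. std_normal_density (x \<bullet> b)) *\<^sub>R iexp (\<theta> \<bullet> x) =
       (\<Prod>b\<in>Basis. std_normal_density (x \<bullet> b) *\<^sub>R iexp ((\<theta> \<bullet> b) * (x \<bullet> b)))"
      by (simp add: scaleR_conv_of_real prod.distrib)
  qed
  also have "\<dots> = (\<Prod>b\<in>(Basis::'a set). \<integral>y. std_normal_density y *\<^sub>R iexp ((\<theta> \<bullet> b) * y) \<partial>lborel)"
    by (rule integral_lborel_prod) (rule i)
  also have "\<dots> = (\<Prod>b\<in>(Basis::'a set). char std_normal_distribution (\<theta> \<bullet> b))"
    unfolding char_def by (intro prod.cong refl) (subst integral_density, auto)
  also have "\<dots> = exp (- (\<theta> \<bullet> \<theta>) / 2)"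
    unfolding char_std_normal_distribution
    by (subst euclidean_inner[of \<theta> \<theta>]) (simp add: exp_sum[symmetric] sum_negf sum_divide_distrib power2_eq_square of_real_prod[symmetric])
  finally show ?thesis .
qed

text \<open>The characteristic function depends on \<theta> through its norm only. All moments of
  \<open>\<theta> \<bullet> x\<close> thereby reduce to moments of the normal law on the
  line.\<close>

lemma distr_std_gaussian_inner:
  fixes \<theta> :: "'a::euclidean_space"
  shows "distr std_gaussian borel (\<lambda>x. \<theta> \<bullet> x) = distr std_normal_distribution borel (\<lambda>y. norm \<theta> * y)"
proof (rule Levy_uniqueness)
  interpret G: prob_space "std_gaussian :: 'a measure" by (rule prob_space_std_gaussian)
  interpret N: prob_space std_normal_distribution by (rule prob_space_normal_density) simp
  show "real_distribution (distr std_gaussian borel (\<lambda>x. \<theta> \<bullet> x))"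
    by (intro G.real_distribution_distr) simp
  show "real_distribution (distr std_normal_distribution borel (\<lambda>y. norm \<theta> * y))"
    by (intro N.real_distribution_distr) simp
  show "char (distr std_gaussian borel (\<lambda>x. \<theta> \<bullet> x)) = char (distr std_normal_distribution borel (\<lambda>y. norm \<theta> * y))"
  proof
    fix t
    have "char (distr std_gaussian borel (\<lambda>x. \<theta> \<bullet> x)) t = cf std_gaussian (t *\<^sub>R \<theta>)"
      unfolding char_def cf_def by (subst integral_distr) auto
    also have "\<dots> = char std_normal_distribution (t * norm \<theta>)"
      unfolding cf_std_gaussian char_std_normal_distribution
      by (simp add: power_mult_distrib power2_norm_eq_inner) (simp add: power2_eq_square)
    also have "\<dots> = char (distr std_normal_distribution borel (\<lambda>y. norm \<theta> * y)) t"
      unfolding char_def by (subst integral_distr) (auto simp: mult.assoc)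
    finally show "char (distr std_gaussian borel (\<lambda>x. \<theta> \<bullet> x)) t = \<dots>" .
  qed
qed

lemma std_gaussian_power_moment:
  fixes \<theta> :: "'a::euclidean_space"
  shows "has_bochner_integral std_gaussian (\<lambda>x. (\<theta> \<bullet> x) ^ k)
    (norm \<theta> ^ k * (LINT y|std_normal_distribution. y ^ k))"
proof -
  have 1: "has_bochner_integral std_normal_distribution (\<lambda>y. norm \<theta> ^ k * y ^ k)
    (norm \<theta> ^ k * (LINT y|std_normal_distribution. y ^ k))"
    using integrable_std_normal_distribution_moment[of k]
    by (intro has_bochner_integral_mult_right) (auto simp: has_bochner_integral_iff)
  then have "has_bochner_integral (distr std_normal_distribution borel (\<lambda>y. norm \<theta> * y)) (\<lambda>y. y ^ k)
    (norm \<theta> ^ k * (LINT y|std_normal_distribution. y ^ k))"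
    by (subst has_bochner_integral_distr) (auto simp: power_mult_distrib)
  then have "has_bochner_integral (distr std_gaussian borel (\<lambda>x. \<theta> \<bullet> x)) (\<lambda>y. y ^ k)
    (norm \<theta> ^ k * (LINT y|std_normal_distribution. y ^ k))"
    unfolding distr_std_gaussian_inner .
  then show ?thesis
    by (simp add: has_bochner_integral_iff integrable_distr_eq integral_distr)
qed

text \<open>Wick's formula up to order four, the highest order that occurs in a product of two
  quadratic polynomials; the fourth moment is the sum over the three pairings.\<close>

lemma std_gaussian_moments:
  fixes a b c d :: "'a::euclidean_space"
  shows std_gaussian_moment1: "has_bochner_integral std_gaussian (\<lambda>x. a \<bullet> x) 0"
    and std_gaussian_moment2: "has_bochner_integral std_gaussian (\<lambda>x. (a \<bullet> x) * (b \<bullet> x)) (a \<bullet> b)"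
    and std_gaussian_moment3: "has_bochner_integral std_gaussian (\<lambda>x. (a \<bullet> x) * (b \<bullet> x) * (c \<bullet> x)) 0"
    and std_gaussian_moment4: "has_bochner_integral std_gaussian (\<lambda>x. (a \<bullet> x) * (b \<bullet> x) * (c \<bullet> x) * (d \<bullet> x))
      ((a \<bullet> b) * (c \<bullet> d) + (a \<bullet> c) * (b \<bullet> d) + (a \<bullet> d) * (b \<bullet> c))"
proof -
  note even = std_normal_distribution_even_moments and odd = integral_std_normal_distribution_moment_odd
  have m1: "has_bochner_integral std_gaussian (\<lambda>x. \<theta> \<bullet> x) 0" for \<theta> :: 'a
    using std_gaussian_power_moment[of \<theta> 1] odd[of 1] by simp
  then show "has_bochner_integral std_gaussian (\<lambda>x. a \<bullet> x) 0" .
  have m2: "has_bochner_integral std_gaussian (\<lambda>x. (\<theta> \<bullet> x)\<^sup>2) (\<theta> \<bullet> \<theta>)" for \<theta> :: 'a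
    using std_gaussian_power_moment[of \<theta> 2] even(1)[of 1] by (simp add: power2_norm_eq_inner)
  have m3: "has_bochner_integral std_gaussian (\<lambda>x. (\<theta> \<bullet> x) ^ 3) 0" for \<theta> :: 'a
    using std_gaussian_power_moment[of \<theta> 3] odd[of 3] by simp
  have m4: "has_bochner_integral std_gaussian (\<lambda>x. (\<theta> \<bullet> x) ^ 4) (3 * (\<theta> \<bullet> \<theta>)\<^sup>2)" for \<theta> :: 'a
  proof -
    have "norm \<theta> ^ 4 = (\<theta> \<bullet> \<theta>)\<^sup>2"
      by (simp add: power2_norm_eq_inner[symmetric] power_mult[symmetric])
    then show ?thesis
      using std_gaussian_power_moment[of \<theta> 4] even(1)[of 2] by (simp add: fact_numeral ac_simps)
  qed
  text \<open>The mixed moments follow by polarization.\<close>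
  have "has_bochner_integral std_gaussian (\<lambda>x. ((a + b) \<bullet> x)\<^sup>2 / 4 - ((a - b) \<bullet> x)\<^sup>2 / 4)
     (((a + b) \<bullet> (a + b)) / 4 - ((a - b) \<bullet> (a - b)) / 4)"
    by (intro has_bochner_integral_diff has_bochner_integral_divide_zero m2)
  then show "has_bochner_integral std_gaussian (\<lambda>x. (a \<bullet> x) * (b \<bullet> x)) (a \<bullet> b)"
    by (rule has_bochner_integral_cong[THEN iffD1, OF refl _ _, rotated -1])
       (auto simp: algebra_simps inner_add_left inner_diff_left inner_add_right inner_diff_right power2_eq_square inner_commute field_simps)
  have "has_bochner_integral std_gaussian (\<lambda>x. (((a + b + c) \<bullet> x)^3 - ((a + b - c) \<bullet> x)^3
       - ((a - b + c) \<bullet> x)^3 + ((a - b - c) \<bullet> x)^3) / 24) ((0 - 0 - 0 + 0) / 24)"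
    by (intro has_bochner_integral_diff has_bochner_integral_add has_bochner_integral_divide_zero m3)
  moreover have "(((a + b + c) \<bullet> x)^3 - ((a + b - c) \<bullet> x)^3
       - ((a - b + c) \<bullet> x)^3 + ((a - b - c) \<bullet> x)^3) / 24 = (a \<bullet> x) * (b \<bullet> x) * (c \<bullet> x)" for x
    unfolding inner_add_left inner_diff_left by (simp add: power3_eq_cube algebra_simps)
  ultimately show "has_bochner_integral std_gaussian (\<lambda>x. (a \<bullet> x) * (b \<bullet> x) * (c \<bullet> x)) 0" by simp
  \<comment> \<open>The sign of \<open>a\<close> is fixed and the other three signs vary: 192 is 2^3
    times 4!, the number of sign patterns times the multiplicity of the mixed term.\<close>
  have pol4: "(a+b+c+d)^4 - (a-b+c+d)^4 - (a+b-c+d)^4 - (a+b+c-d)^4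
      + (a-b-c+d)^4 + (a-b+c-d)^4 + (a+b-c-d)^4 - (a-b-c-d)^4 = 192 * (a*b*c*d)" for a b c d :: real
    by algebra
  \<comment> \<open>The same alternating sum for squares of squared norms; \<open>ab\<close> stands
    for the inner product of \<open>a\<close> and \<open>b\<close>, and \<open>s\<close> for the sum
    of the squared norms. Since the fourth moment carries the factor 3, the total 3 * 64 = 192
    leaves each pairing with coefficient one.\<close>
  have pol2: "(s + 2 * (ab + ac + ad + bc + bd + cd))\<^sup>2 - (s + 2 * (- ab + ac + ad - bc - bd + cd))\<^sup>2
      - (s + 2 * (ab - ac + ad - bc + bd - cd))\<^sup>2 - (s + 2 * (ab + ac - ad + bc - bd - cd))\<^sup>2
      + (s + 2 * (- ab - ac + ad + bc - bd - cd))\<^sup>2 + (s + 2 * (- ab + ac - ad - bc + bd - cd))\<^sup>2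
      + (s + 2 * (ab - ac - ad - bc - bd + cd))\<^sup>2 - (s + 2 * (- ab - ac - ad + bc + bd + cd))\<^sup>2
      = 64 * (ab * cd + ac * bd + ad * bc)" for s ab ac ad bc bd cd :: real
    by algebra
  have scale: "(3 * u1 - 3 * u2 - 3 * u3 - 3 * u4 + 3 * u5 + 3 * u6 + 3 * u7 - 3 * u8) / 192 = X"
    if "u1 - u2 - u3 - u4 + u5 + u6 + u7 - u8 = 64 * X" for u1 u2 u3 u4 u5 u6 u7 u8 X :: real
  proof -
    have "3 * u1 - 3 * u2 - 3 * u3 - 3 * u4 + 3 * u5 + 3 * u6 + 3 * u7 - 3 * u8
      = 3 * (u1 - u2 - u3 - u4 + u5 + u6 + u7 - u8)" by (simp add: algebra_simps)
    then show ?thesis using that by simp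
  qed
  define s where "s = a \<bullet> a + b \<bullet> b + c \<bullet> c + d \<bullet> d"
  have sq:
    "(a+b+c+d) \<bullet> (a+b+c+d) = s + 2 * (a\<bullet>b + a\<bullet>c + a\<bullet>d + b\<bullet>c + b\<bullet>d + c\<bullet>d)"
    "(a-b+c+d) \<bullet> (a-b+c+d) = s + 2 * (- (a\<bullet>b) + a\<bullet>c + a\<bullet>d - b\<bullet>c - b\<bullet>d + c\<bullet>d)"
    "(a+b-c+d) \<bullet> (a+b-c+d) = s + 2 * (a\<bullet>b - a\<bullet>c + a\<bullet>d - b\<bullet>c + b\<bullet>d - c\<bullet>d)"
    "(a+b+c-d) \<bullet> (a+b+c-d) = s + 2 * (a\<bullet>b + a\<bullet>c - a\<bullet>d + b\<bullet>c - b\<bullet>d - c\<bullet>d)"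
    "(a-b-c+d) \<bullet> (a-b-c+d) = s + 2 * (- (a\<bullet>b) - a\<bullet>c + a\<bullet>d + b\<bullet>c - b\<bullet>d - c\<bullet>d)"
    "(a-b+c-d) \<bullet> (a-b+c-d) = s + 2 * (- (a\<bullet>b) + a\<bullet>c - a\<bullet>d - b\<bullet>c + b\<bullet>d - c\<bullet>d)"
    "(a+b-c-d) \<bullet> (a+b-c-d) = s + 2 * (a\<bullet>b - a\<bullet>c - a\<bullet>d - b\<bullet>c - b\<bullet>d + c\<bullet>d)"
    "(a-b-c-d) \<bullet> (a-b-c-d) = s + 2 * (- (a\<bullet>b) - a\<bullet>c - a\<bullet>d + b\<bullet>c + b\<bullet>d + c\<bullet>d)"
    unfolding s_def by (simp_all add: inner_add_left inner_add_right inner_diff_left inner_diff_right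
      inner_commute[of b a] inner_commute[of c a] inner_commute[of d a] inner_commute[of c b] inner_commute[of d b] inner_commute[of d c])
  have "has_bochner_integral std_gaussian
     (\<lambda>x. (((a+b+c+d) \<bullet> x)^4 - ((a-b+c+d) \<bullet> x)^4 - ((a+b-c+d) \<bullet> x)^4 - ((a+b+c-d) \<bullet> x)^4
       + ((a-b-c+d) \<bullet> x)^4 + ((a-b+c-d) \<bullet> x)^4 + ((a+b-c-d) \<bullet> x)^4 - ((a-b-c-d) \<bullet> x)^4) / 192)
     ((3 * ((a+b+c+d) \<bullet> (a+b+c+d))\<^sup>2 - 3 * ((a-b+c+d) \<bullet> (a-b+c+d))\<^sup>2
       - 3 * ((a+b-c+d) \<bullet> (a+b-c+d))\<^sup>2 - 3 * ((a+b+c-d) \<bullet> (a+b+c-d))\<^sup>2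
       + 3 * ((a-b-c+d) \<bullet> (a-b-c+d))\<^sup>2 + 3 * ((a-b+c-d) \<bullet> (a-b+c-d))\<^sup>2
       + 3 * ((a+b-c-d) \<bullet> (a+b-c-d))\<^sup>2 - 3 * ((a-b-c-d) \<bullet> (a-b-c-d))\<^sup>2) / 192)"
    by (intro has_bochner_integral_diff has_bochner_integral_add has_bochner_integral_divide_zero m4)
  moreover have "(((a+b+c+d) \<bullet> x)^4 - ((a-b+c+d) \<bullet> x)^4 - ((a+b-c+d) \<bullet> x)^4 - ((a+b+c-d) \<bullet> x)^4
       + ((a-b-c+d) \<bullet> x)^4 + ((a-b+c-d) \<bullet> x)^4 + ((a+b-c-d) \<bullet> x)^4 - ((a-b-c-d) \<bullet> x)^4) / 192
       = (a \<bullet> x) * (b \<bullet> x) * (c \<bullet> x) * (d \<bullet> x)" for x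
    unfolding inner_add_left inner_diff_left pol4 by simp
  moreover have "(3 * ((a+b+c+d) \<bullet> (a+b+c+d))\<^sup>2 - 3 * ((a-b+c+d) \<bullet> (a-b+c+d))\<^sup>2
       - 3 * ((a+b-c+d) \<bullet> (a+b-c+d))\<^sup>2 - 3 * ((a+b+c-d) \<bullet> (a+b+c-d))\<^sup>2
       + 3 * ((a-b-c+d) \<bullet> (a-b-c+d))\<^sup>2 + 3 * ((a-b+c-d) \<bullet> (a-b+c-d))\<^sup>2
       + 3 * ((a+b-c-d) \<bullet> (a+b-c-d))\<^sup>2 - 3 * ((a-b-c-d) \<bullet> (a-b-c-d))\<^sup>2) / 192
     = (a \<bullet> b) * (c \<bullet> d) + (a \<bullet> c) * (b \<bullet> d) + (a \<bullet> d) * (b \<bullet> c)"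
    unfolding sq by (rule scale) (rule pol2)
  ultimately show "has_bochner_integral std_gaussian (\<lambda>x. (a \<bullet> x) * (b \<bullet> x) * (c \<bullet> x) * (d \<bullet> x))
      ((a \<bullet> b) * (c \<bullet> d) + (a \<bullet> c) * (b \<bullet> d) + (a \<bullet> d) * (b \<bullet> c))" by simp
qed

text \<open>Dominates the squares of quadratic polynomials, and so provides the square integrability
  of the explicit solutions.\<close>

lemma integrable_std_gaussian_norm4: "integrable (std_gaussian :: 'a::euclidean_space measure) (\<lambda>x. norm x ^ 4)"
proof -
  have "norm x ^ 4 = (\<Sum>b\<in>Basis. \<Sum>c\<in>Basis. (b \<bullet> x) * (b \<bullet> x) * (c \<bullet> x) * (c \<bullet> x))" for x :: 'a
  proof -
    have "norm x ^ 4 = (x \<bullet> x) * (x \<bullet> x)"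
      by (simp add: power2_norm_eq_inner[symmetric] power_add[symmetric])
    also have "\<dots> = (\<Sum>b\<in>Basis. (b \<bullet> x) * (b \<bullet> x)) * (\<Sum>c\<in>Basis. (c \<bullet> x) * (c \<bullet> x))"
      by (subst (1 2) euclidean_inner) (simp add: inner_commute)
    finally show ?thesis by (simp add: sum_product mult.assoc)
  qed
  then show ?thesis
    using std_gaussian_moment4 unfolding has_bochner_integral_iff
    by (simp only:) (intro Bochner_Integration.integrable_sum, blast)
qed

text \<open>An orthogonal map preserves the standard Gaussian by its characteristic function, and Lebesgue measure
  has a rotation invariant density with respect to it.\<close>

lemma lborel_linear_orthogonal:
  fixes f :: "'a::euclidean_space \<Rightarrow> 'a"
  assumes f: "orthogonal_transformation f"
  shows "distr lborel borel f = lborel"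
proof -
  have lf: "linear f" and n: "\<And>x y. f x \<bullet> f y = x \<bullet> y"
    using f by (auto simp: orthogonal_transformation_def)
  interpret G: prob_space "std_gaussian :: 'a measure" by (rule prob_space_std_gaussian)
  have [measurable]: "f \<in> borel_measurable borel"
    using lf by (intro borel_measurable_continuous_onI linear_continuous_on linear_conv_bounded_linear[THEN iffD1])
  define g where "g x = exp (- (x \<bullet> x) / 2) / sqrt ((2 * pi) ^ DIM('a))" for x :: 'a
  have gpos: "g x > 0" for x by (simp add: g_def)
  have [measurable]: "g \<in> borel_measurable borel" unfolding g_def by measurable
  have gf: "g (f x) = g x" for x by (simp add: g_def n)
  have G: "std_gaussian = density lborel (\<lambda>x. ennreal (g x))" by (simp add: std_gaussian_def g_def)
  have "distr (std_gaussian :: 'a measure) borel f = std_gaussian"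
  proof (rule cf_uniqueness)
    have "finite_measure (distr std_gaussian borel f)" by (intro G.finite_measure_distr) simp
    then show "finite_measure (distr std_gaussian borel f)" .
    show "finite_measure (std_gaussian :: 'a measure)" by standard simp
    fix \<theta> :: 'a
    have "cf (distr std_gaussian borel f) \<theta> = (CLINT x|std_gaussian. iexp (adjoint f \<theta> \<bullet> x))"
      unfolding cf_def by (subst integral_distr) (auto simp: adjoint_works[OF lf] inner_commute)
    also have "\<dots> = cf std_gaussian (adjoint f \<theta>)" by (simp add: cf_def)
    also have "\<dots> = cf std_gaussian \<theta>"
    proof -
      have "adjoint f \<theta> \<bullet> adjoint f \<theta> = \<theta> \<bullet> \<theta>"
      proof -
        obtain z where z: "f z = \<theta>"
          using orthogonal_transformation_surj[OF f] by (metis surjD)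
        have "y \<bullet> adjoint f \<theta> = y \<bullet> z" for y
          by (simp add: adjoint_works[OF lf] n z[symmetric])
        then have "adjoint f \<theta> = z" using vector_eq_ldot by blast
        then show ?thesis using n[of z z] z by simp
      qed
      then show ?thesis by (simp add: cf_std_gaussian)
    qed
    finally show "cf (distr std_gaussian borel f) \<theta> = cf std_gaussian \<theta>" .
  qed simp_all
  then have *: "distr (density lborel (\<lambda>x. ennreal (g x))) borel f = density lborel (\<lambda>x. ennreal (g x))"
    unfolding G .
  have inv: "density (density lborel (\<lambda>x. ennreal (g x))) (\<lambda>x. ennreal (1 / g x)) = lborel"
  proof -
    have "ennreal (g x) * ennreal (1 / g x) = 1" for x
      using gpos[of x] by (simp flip: ennreal_mult)
    then show ?thesis by (subst density_density_eq) (auto simp: density_1)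
  qed
  have "lborel = density (distr (density lborel (\<lambda>x. ennreal (g x))) borel f) (\<lambda>x. ennreal (1 / g x))"
    unfolding * inv ..
  also have "\<dots> = distr (density (density lborel (\<lambda>x. ennreal (g x))) (\<lambda>x. ennreal (1 / g (f x)))) borel f"
    by (rule density_distr) simp_all
  also have "\<dots> = distr lborel borel f" unfolding gf inv ..
  finally show ?thesis ..
qed

text \<open>Fubini in the coordinate \<open>m\<close>: once the other coordinates are fixed, the
  shear is a translation along \<open>m\<close>, and its length is the coordinate along
  \<open>n\<close>, which is among the fixed ones.\<close>

lemma lborel_linear_shear:
  fixes m n :: "'a::euclidean_space"
  assumes m: "m \<in> Basis" and n: "n \<in> Basis" and mn: "m \<noteq> n"
  shows "distr lborel borel (\<lambda>x. x + (x \<bullet> n) *\<^sub>R m) = lborel"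
proof (rule measure_eqI)
  let ?f = "\<lambda>x. x + (x \<bullet> n) *\<^sub>R m"
  interpret product_sigma_finite "\<lambda>_::'a. lborel :: real measure" by standard
  define e where "e h = (\<Sum>b\<in>Basis. h b *\<^sub>R b)" for h :: "'a \<Rightarrow> real"
  have [measurable]: "e \<in> borel_measurable (\<Pi>\<^sub>M b\<in>Basis. lborel)" unfolding e_def by measurable
  have B: "insert m (Basis - {m}) = Basis" using m by auto
  have split: "(\<integral>\<^sup>+x. F x \<partial>lborel) = (\<integral>\<^sup>+h. (\<integral>\<^sup>+y. F (e (h(m := y))) \<partial>lborel) \<partial>(\<Pi>\<^sub>M b\<in>Basis - {m}. lborel))"
    if [measurable]: "F \<in> borel_measurable borel" for F :: "'a \<Rightarrow> ennreal"
  proof -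
    have "(\<integral>\<^sup>+x. F x \<partial>lborel) = (\<integral>\<^sup>+h. F (e h) \<partial>(\<Pi>\<^sub>M b\<in>insert m (Basis - {m}). lborel))"
      unfolding lborel_eq[where 'a='a] B
      by (subst nn_integral_distr) (auto simp: e_def)
    also have "\<dots> = (\<integral>\<^sup>+h. (\<integral>\<^sup>+y. F (e (h(m := y))) \<partial>lborel) \<partial>(\<Pi>\<^sub>M b\<in>Basis - {m}. lborel))"
    proof (rule product_nn_integral_insert)
      show "(\<lambda>h. F (e h)) \<in> borel_measurable (\<Pi>\<^sub>M b\<in>insert m (Basis - {m}). lborel)"
        unfolding B by measurable
    qed simp_all
    finally show ?thesis .
  qed
  show "sets (distr lborel borel ?f) = sets lborel" by simp
  fix A assume "A \<in> sets (distr lborel borel ?f)"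
  then have [measurable]: "A \<in> sets borel" by simp
  have fe: "?f (e (h(m := y))) = e (h(m := h n + y))" for h y
  proof (rule euclidean_eqI)
    fix b :: 'a assume b: "b \<in> Basis"
    show "?f (e (h(m := y))) \<bullet> b = e (h(m := h n + y)) \<bullet> b"
      using b m n mn by (simp add: e_def inner_add_left inner_Basis)
  qed
  have "emeasure (distr lborel borel ?f) A = (\<integral>\<^sup>+x. indicator A (?f x) \<partial>lborel)"
    by (subst nn_integral_indicator[symmetric]) (auto simp: nn_integral_distr simp del: nn_integral_indicator)
  also have "\<dots> = (\<integral>\<^sup>+h. (\<integral>\<^sup>+y. indicator A (e (h(m := h n + y))) \<partial>lborel) \<partial>(\<Pi>\<^sub>M b\<in>Basis - {m}. lborel))"
    by (subst split) (simp_all only: fe, measurable)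
  also have "\<dots> = (\<integral>\<^sup>+h. (\<integral>\<^sup>+y. indicator A (e (h(m := y))) \<partial>lborel) \<partial>(\<Pi>\<^sub>M b\<in>Basis - {m}. lborel))"
  proof (rule nn_integral_cong)
    fix h assume h: "h \<in> space (\<Pi>\<^sub>M b\<in>Basis - {m}. lborel :: real measure)"
    have [measurable]: "(\<lambda>y. e (h(m := y))) \<in> borel_measurable borel"
      unfolding e_def by (intro borel_measurable_sum borel_measurable_scaleR) (auto simp: fun_upd_def)
    have "(\<integral>\<^sup>+y. indicator A (e (h(m := y))) \<partial>lborel) = (\<integral>\<^sup>+y. indicator A (e (h(m := y))) \<partial>distr lborel borel ((+) (h n)))"
      by (simp add: lborel_distr_plus)
    also have "\<dots> = (\<integral>\<^sup>+y. indicator A (e (h(m := h n + y))) \<partial>lborel)"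
      by (subst nn_integral_distr) auto
    finally show "(\<integral>\<^sup>+y. indicator A (e (h(m := h n + y))) \<partial>lborel) = (\<integral>\<^sup>+y. indicator A (e (h(m := y))) \<partial>lborel)" by simp
  qed
  also have "\<dots> = emeasure lborel A"
    by (subst split[symmetric]) auto
  finally show "emeasure (distr lborel borel ?f) A = emeasure lborel A" .
qed

text \<open>The library's \<open>measure_linear_image\<close> needs a well-ordered index type.\<close>

lemma lborel_linear_image:
  fixes f :: "real ^ 'n \<Rightarrow> real ^ 'n"
  assumes "linear f" "det (matrix f) \<noteq> 0"
  shows "distr lborel borel f = density lborel (\<lambda>_. ennreal (1 / \<bar>det (matrix f)\<bar>))"
proof -
  let ?P = "\<lambda>f :: real ^ 'n \<Rightarrow> real ^ 'n. det (matrix f) \<noteq> 0 \<longrightarrow>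
     distr lborel borel f = density lborel (\<lambda>_. ennreal (1 / \<bar>det (matrix f)\<bar>))"
  \<comment> \<open>Every linear map is a composition of maps with a vanishing coordinate, diagonal
    maps, exchanges of two coordinates and shears. The condition on the determinant is kept inside
    \<open>?P\<close> because a factor with a vanishing coordinate has determinant 0.\<close>
  have "?P f"
  proof (rule induct_linear_elementary[OF assms(1), of ?P])
    fix f g :: "real ^ 'n \<Rightarrow> real ^ 'n"
    assume lin: "linear f" "linear g" and P: "?P f" "?P g"
    have [measurable]: "f \<in> borel_measurable borel" "g \<in> borel_measurable borel"
      using lin by (auto intro!: borel_measurable_continuous_onI linear_continuous_on simp: linear_conv_bounded_linear)
    show "?P (f \<circ> g)"
    proof
      assume "det (matrix (f \<circ> g)) \<noteq> 0"
      then have d: "det (matrix f) \<noteq> 0" "det (matrix g) \<noteq> 0" and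
        dd: "det (matrix (f \<circ> g)) = det (matrix f) * det (matrix g)"
        by (auto simp: matrix_compose[OF lin(2,1)] det_mul)
      have "distr lborel borel (f \<circ> g) = distr (distr lborel borel g) borel f"
        by (subst distr_distr) auto
      also have "\<dots> = distr (density lborel (\<lambda>_. ennreal (1 / \<bar>det (matrix g)\<bar>))) borel f"
        using P d by simp
      also have "\<dots> = density (distr lborel borel f) (\<lambda>_. ennreal (1 / \<bar>det (matrix g)\<bar>))"
        by (rule density_distr[symmetric]) auto
      also have "\<dots> = density (density lborel (\<lambda>_. ennreal (1 / \<bar>det (matrix f)\<bar>))) (\<lambda>_. ennreal (1 / \<bar>det (matrix g)\<bar>))"
        using P d by simp
      also have "\<dots> = density lborel (\<lambda>_. ennreal (1 / \<bar>det (matrix (f \<circ> g))\<bar>))"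
        by (subst density_density_eq) (auto simp: dd abs_mult simp flip: ennreal_mult)
      finally show "distr lborel borel (f \<circ> g) = \<dots>" .
    qed
  next
    fix f :: "real ^ 'n \<Rightarrow> real ^ 'n" and i
    assume "linear f" "\<And>x. f x $ i = 0"
    then have "det (matrix f) = 0"
      by (intro det_zero_row) (auto simp: row_def matrix_def vec_eq_iff)
    then show "?P f" by simp
  next
    fix c :: "'n \<Rightarrow> real"
    have dc: "det (matrix (\<lambda>x::real^'n. \<chi> i. c i * x $ i)) = prod c UNIV"
      by (subst det_diagonal) (auto simp: matrix_def axis_def)
    show "?P (\<lambda>x. \<chi> i. c i * x $ i)"
    proof
      assume "det (matrix (\<lambda>x::real^'n. \<chi> i. c i * x $ i)) \<noteq> 0"
      then have c0: "c i \<noteq> 0" for i by (auto simp: dc)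
      \<comment> \<open>\<open>lborel_affine_euclidean\<close> indexes the scaling factors by basis
        vectors; \<open>c'\<close> recovers the factor \<open>c i\<close> from the basis vector
        \<open>axis i 1\<close>.\<close>
      define c' where "c' j = (\<Sum>i\<in>UNIV. c i * (j $ i))" for j :: "real ^ 'n"
      have c'a: "c' (axis i 1) = c i" for i
        by (simp add: c'_def axis_def if_distrib[where f="\<lambda>x. c _ * x"] cong: if_cong)
      have T: "(\<lambda>x::real^'n. 0 + (\<Sum>j\<in>Basis. (c' j * (x \<bullet> j)) *\<^sub>R j)) = (\<lambda>x. \<chi> i. c i * x $ i)"
      proof
        fix x :: "real ^ 'n"
        show "0 + (\<Sum>j\<in>Basis. (c' j * (x \<bullet> j)) *\<^sub>R j) = (\<chi> i. c i * x $ i)"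
        proof (rule euclidean_eqI)
          fix b :: "real ^ 'n" assume b: "b \<in> Basis"
          then obtain i where i: "b = axis i 1" by (auto simp: Basis_vec_def)
          have "(0 + (\<Sum>j\<in>Basis. (c' j * (x \<bullet> j)) *\<^sub>R j)) \<bullet> b = c' b * (x \<bullet> b)"
            using b by simp
          then show "(0 + (\<Sum>j\<in>Basis. (c' j * (x \<bullet> j)) *\<^sub>R j)) \<bullet> b = (\<chi> i. c i * x $ i) \<bullet> b"
            by (simp only: i c'a) (simp add: inner_axis)
        qed
      qed
      have "lborel = density (distr lborel borel (\<lambda>x::real^'n. 0 + (\<Sum>j\<in>Basis. (c' j * (x \<bullet> j)) *\<^sub>R j))) (\<lambda>_. (\<Prod>j\<in>(Basis::(real^'n) set). \<bar>c' j\<bar>))"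
        by (rule lborel_affine_euclidean) (auto simp: Basis_vec_def c'a c0)
      also have "(\<Prod>j\<in>(Basis::(real^'n) set). \<bar>c' j\<bar>) = (\<Prod>i\<in>UNIV. \<bar>c i\<bar>)"
      proof -
        have B: "(Basis::(real^'n) set) = range (\<lambda>i. axis i 1)" by (auto simp: Basis_vec_def)
        have "inj (\<lambda>i::'n. axis i (1::real))" by (auto simp: inj_def axis_eq_axis)
        then show ?thesis unfolding B by (subst prod.reindex) (simp_all add: c'a)
      qed
      also have "(\<Prod>i\<in>UNIV. \<bar>c i\<bar>) = \<bar>prod c UNIV\<bar>" by (simp add: abs_prod)
      finally have l: "lborel = density (distr lborel borel (\<lambda>x::real^'n. \<chi> i. c i * x $ i)) (\<lambda>_. ennreal \<bar>prod c UNIV\<bar>)"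
        unfolding T .
      have "density lborel (\<lambda>_. ennreal (1 / \<bar>prod c UNIV\<bar>)) =
         density (density (distr lborel borel (\<lambda>x::real^'n. \<chi> i. c i * x $ i)) (\<lambda>_. ennreal \<bar>prod c UNIV\<bar>)) (\<lambda>_. ennreal (1 / \<bar>prod c UNIV\<bar>))"
        using l by simp
      also have "\<dots> = density (distr lborel borel (\<lambda>x::real^'n. \<chi> i. c i * x $ i)) (\<lambda>_. 1)"
      proof -
        have "prod c UNIV \<noteq> 0" using c0 by simp
        then have "ennreal \<bar>prod c UNIV\<bar> * ennreal (1 / \<bar>prod c UNIV\<bar>) = 1"
          by (subst ennreal_mult[symmetric]) simp_all
        then show ?thesis by (subst density_density_eq) simp_all
      qed
      finally show "distr lborel borel (\<lambda>x::real^'n. \<chi> i. c i * x $ i) =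
        density lborel (\<lambda>_. ennreal (1 / \<bar>det (matrix (\<lambda>x::real^'n. \<chi> i. c i * x $ i))\<bar>))"
        by (simp add: dc density_1)
    qed
  next
    fix m n :: 'n assume mn: "m \<noteq> n"
    let ?s = "\<lambda>x::real^'n. \<chi> i. x $ Transposition.transpose m n i"
    have o: "orthogonal_transformation ?s"
      unfolding orthogonal_transformation_def
    proof
      show "linear ?s" by (rule linearI) (auto simp: vec_eq_iff)
      show "\<forall>v w. ?s v \<bullet> ?s w = v \<bullet> w"
      proof (intro allI)
        fix v w :: "real^'n"
        have "?s v \<bullet> ?s w = (\<Sum>i\<in>UNIV. v $ Transposition.transpose m n i * w $ Transposition.transpose m n i)"
          by (simp add: inner_vec_def)
        also have "\<dots> = (\<Sum>i\<in>UNIV. v $ i * w $ i)"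
          by (rule sum.reindex_bij_betw[OF bij_transpose])
        finally show "?s v \<bullet> ?s w = v \<bullet> w" by (simp add: inner_vec_def)
      qed
    qed
    then have "\<bar>det (matrix ?s)\<bar> = 1"
      by (simp add: orthogonal_transformation_det)
    then show "?P ?s" using lborel_linear_orthogonal[OF o] by (simp add: density_1)
  next
    fix m n :: 'n assume mn: "m \<noteq> n"
    let ?s = "\<lambda>x::real^'n. \<chi> i. if i = m then x$m + x$n else x$i"
    have s: "?s = (\<lambda>x. x + (x \<bullet> axis n 1) *\<^sub>R axis m 1)"
      by (auto simp: fun_eq_iff vec_eq_iff inner_axis) (auto simp: axis_def)
    have "det (matrix ?s) = 1"
    proof -
      have "matrix ?s = (\<chi> k. if k = m then row m (mat 1) + 1 *s row n (mat 1) else row k (mat 1))"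
        using mn by (auto simp: matrix_def row_def mat_def axis_def vec_eq_iff)
      then show ?thesis using det_row_operation[OF mn, of "mat 1 :: real^'n^'n" 1] by simp
    qed
    then show "?P ?s" unfolding s
      using lborel_linear_shear[of "axis m 1 :: real^'n" "axis n 1"] mn
      by (simp add: density_1 axis_in_Basis_iff axis_eq_axis)
  qed
  then show ?thesis using assms by blast
qed

text \<open>\<open>matrix_inv\<close> is a choice operator. For square matrices a one-sided inverse
  is already two-sided, and therefore equals the chosen one.\<close>

lemma matrix_inv_eqI:
  fixes A B :: "real ^ 'n ^ 'n"
  assumes AB: "A ** B = mat 1"
  shows "matrix_inv A = B"
proof -
  have BA: "B ** A = mat 1" using AB matrix_left_right_inverse by blast
  have "A ** matrix_inv A = mat 1"
    using someI[where P="\<lambda>X. A ** X = mat 1 \<and> X ** A = mat 1"] AB BA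
    unfolding matrix_inv_def by blast
  then have "B ** (A ** matrix_inv A) = B" by simp
  then show ?thesis by (simp only: matrix_mul_assoc BA matrix_mul_lid)
qed

lemma matrix_mul_uminus:
  fixes A B :: "real ^ 'n ^ 'n"
  shows "A ** (- B) = - (A ** B)" "(- A) ** B = - (A ** B)"
  using matrix_scalar_ac[of A "-1" B] scalar_matrix_assoc[of "-1" A B] by simp_all

text \<open>For the covariance \<open>L ** transpose L\<close> the exponent is the squared norm of
  the preimage under \<open>L\<close>, and the square root of the determinant is the absolute
  Jacobian of \<open>L\<close>. This turns Gaussian densities into linear images of one
  measure.\<close>

lemma centered_gaussian_eq:
  fixes L :: "real ^ 'n ^ 'n"
  assumes L: "invertible L"
  shows "centered_gaussian (L ** transpose L) = distr std_gaussian borel (\<lambda>x. L *v x)"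
proof -
  let ?C = "L ** transpose L"
  obtain L' where L': "L ** L' = mat 1" "L' ** L = mat 1"
    using L by (auto simp: invertible_def)
  have d0: "det L \<noteq> 0" using L by (simp add: invertible_det_nz)
  have Ci: "matrix_inv ?C = transpose L' ** L'"
  proof (rule matrix_inv_eqI)
    have "?C ** (transpose L' ** L') = L ** (transpose L ** transpose L') ** L'"
      by (simp add: matrix_mul_assoc)
    also have "transpose L ** transpose L' = mat 1"
      using L' by (simp flip: matrix_transpose_mul)
    finally show "?C ** (transpose L' ** L') = mat 1" using L' by simp
  qed
  have q: "x \<bullet> (matrix_inv ?C *v x) = (L' *v x) \<bullet> (L' *v x)" for x
    unfolding Ci by (simp add: dot_lmul_matrix[symmetric] matrix_vector_mul_assoc[symmetric])
      (metis dot_lmul_matrix inner_commute transpose_matrix_vector transpose_transpose)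
  have dC: "det ?C = (det L)\<^sup>2" by (simp add: det_mul det_transpose power2_eq_square)
  have [measurable]: "(*v) L \<in> borel_measurable borel"
    by (intro borel_measurable_continuous_onI continuous_intros)
  have [measurable]: "(*v) L' \<in> borel_measurable borel"
    by (intro borel_measurable_continuous_onI continuous_intros)
  have L'L: "L' *v (L *v x) = x" for x using L' by (simp add: matrix_vector_mul_assoc)
  define k where "k = sqrt ((2 * pi) ^ CARD('n))"
  have k0: "k > 0" by (simp add: k_def)
  have "centered_gaussian ?C = density lborel (\<lambda>x. ennreal (1 / \<bar>det L\<bar>) * ennreal (exp (- ((L' *v x) \<bullet> (L' *v x)) / 2) / k))"
    unfolding centered_gaussian_def q dC k_def
    by (intro density_cong AE_I2) (auto simp: real_sqrt_mult mult.commute simp flip: ennreal_mult)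
  also have "\<dots> = density (density lborel (\<lambda>_. ennreal (1 / \<bar>det L\<bar>))) (\<lambda>x. ennreal (exp (- ((L' *v x) \<bullet> (L' *v x)) / 2) / k))"
    by (subst density_density_eq) auto
  also have "density lborel (\<lambda>_. ennreal (1 / \<bar>det L\<bar>)) = distr lborel borel ((*v) L)"
    using lborel_linear_image[of "(*v) L"] d0 by simp
  also have "density (distr lborel borel ((*v) L)) (\<lambda>x. ennreal (exp (- ((L' *v x) \<bullet> (L' *v x)) / 2) / k))
     = distr (density lborel (\<lambda>x. ennreal (exp (- (x \<bullet> x) / 2) / k))) borel ((*v) L)"
    by (subst density_distr) (auto simp: L'L)
  also have "\<dots> = distr std_gaussian borel (\<lambda>x. L *v x)"
    by (simp add: std_gaussian_def k_def)
  finally show ?thesis .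
qed

subsection \<open>Linear flows\<close>

text \<open>Gronwall's inequality for the difference, from which \<open>h\<close> cancels. The
  forcing \<open>h\<close> may be arbitrary; in the applications it contains a Brownian
  path.\<close>

lemma linear_integral_equation_unique:
  fixes B :: "'a::euclidean_space \<Rightarrow> 'a" and d1 d2 h :: "real \<Rightarrow> 'a"
  assumes B: "linear B"
    and c: "continuous_on {0..} d1" "continuous_on {0..} d2"
    and eq: "\<And>t. t \<ge> 0 \<Longrightarrow> d1 t = h t + integral {0..t} (\<lambda>s. B (d1 s))"
      "\<And>t. t \<ge> 0 \<Longrightarrow> d2 t = h t + integral {0..t} (\<lambda>s. B (d2 s))"
    and t: "t \<ge> 0"
  shows "d1 t = d2 t"
proof -
  have bB: "bounded_linear B" using B by (simp add: linear_conv_bounded_linear)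
  define e where "e s = d1 s - d2 s" for s
  define \<beta> where "\<beta> = onorm B"
  have ce: "continuous_on {0..s} e" for s
    unfolding e_def by (intro continuous_on_diff continuous_on_subset[OF c(1)] continuous_on_subset[OF c(2)]) auto
  have cB: "continuous_on {0..s} (\<lambda>r. B (d1 r))" "continuous_on {0..s} (\<lambda>r. B (d2 r))" for s
    by (intro continuous_intros bounded_linear.continuous_on[OF bB] continuous_on_subset[OF c(1)] continuous_on_subset[OF c(2)]; auto)+
  have le: "norm (e s) \<le> \<beta> * integral {0..s} (\<lambda>r. norm (e r))" if s: "s \<ge> 0" for s
  proof -
    have "e s = integral {0..s} (\<lambda>r. B (d1 r)) - integral {0..s} (\<lambda>r. B (d2 r))"
      unfolding e_def using eq[OF s] by simp
    also have "\<dots> = integral {0..s} (\<lambda>r. B (d1 r) - B (d2 r))"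
      by (intro integral_diff[symmetric] integrable_continuous_real cB)
    also have "\<dots> = integral {0..s} (\<lambda>r. B (e r))"
      by (simp add: e_def linear_diff[OF B])
    also have "norm \<dots> \<le> integral {0..s} (\<lambda>r. \<beta> * norm (e r))"
      by (intro integral_norm_bound_integral integrable_continuous_real continuous_intros
            bounded_linear.continuous_on[OF bB] ce) (simp add: \<beta>_def onorm[OF bB])
    finally show ?thesis by simp
  qed
  \<comment> \<open>\<open>\<phi>\<close> has derivative at most \<open>\<beta> * \<phi>\<close> and
    vanishes at 0, so \<open>exp (- \<beta> * s) * \<phi> s\<close> decreases from 0. Then
    \<open>le\<close> bounds the norm of the difference itself.\<close>
  define \<phi> where "\<phi> s = integral {0..s} (\<lambda>r. norm (e r))" for s
  have d\<phi>: "(\<phi> has_real_derivative norm (e s)) (at s within {0..t})" if "s \<in> {0..t}" for s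
    unfolding \<phi>_def using that
    by (intro integral_has_real_derivative continuous_intros ce) auto
  have "exp (- \<beta> * t) * \<phi> t \<le> exp (- \<beta> * 0) * \<phi> 0"
  proof (rule DERIV_nonpos_imp_decreasing_open[of 0 t "\<lambda>s. exp (- \<beta> * s) * \<phi> s"])
    show "0 \<le> t" by (rule t)
    fix s assume s: "0 < s" "s < t"
    have "(\<phi> has_real_derivative norm (e s)) (at s)"
      using d\<phi>[of s] s by (simp add: at_within_Icc_at)
    then have "((\<lambda>s. exp (- \<beta> * s) * \<phi> s) has_real_derivative exp (- \<beta> * s) * (norm (e s) - \<beta> * \<phi> s)) (at s)"
      by (auto intro!: derivative_eq_intros simp: algebra_simps)
    moreover have "exp (- \<beta> * s) * (norm (e s) - \<beta> * \<phi> s) \<le> 0"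
      using le[of s] s by (intro mult_nonneg_nonpos) (auto simp: \<phi>_def)
    ultimately show "\<exists>y. ((\<lambda>s. exp (- \<beta> * s) * \<phi> s) has_real_derivative y) (at s) \<and> y \<le> 0" by blast
  next
    have "continuous_on {0..t} \<phi>"
      by (rule DERIV_continuous_on[OF d\<phi>])
    then show "continuous_on {0..t} (\<lambda>s. exp (- \<beta> * s) * \<phi> s)" by (intro continuous_intros)
  qed
  then have "\<phi> t \<le> 0" by (simp add: \<phi>_def mult_le_0_iff)
  moreover have "\<beta> \<ge> 0" unfolding \<beta>_def by (rule onorm_pos_le[OF bB])
  ultimately have "norm (e t) \<le> 0"
    using le[OF t] mult_nonneg_nonpos[of \<beta> "\<phi> t"] unfolding \<phi>_def by linarith
  then show ?thesis by (simp add: e_def)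
qed

text \<open>Riemann-Stieltjes sums of a merely continuous \<open>w\<close> against a continuously
  differentiable \<open>g\<close>. The tags are arbitrary because the Wiener integral below uses
  right end points after a summation by parts, while its variance is a sum over left end
  points.\<close>

lemma tagged_sums_tendsto_integral:
  fixes g g' w :: "real \<Rightarrow> 'a::euclidean_space"
  assumes t: "t > 0"
    and g: "\<And>s. s \<in> {0..t} \<Longrightarrow> (g has_vector_derivative g' s) (at s within {0..t})"
    and g': "continuous_on {0..t} g'" and w: "continuous_on {0..t} w"
    and tag: "\<And>n k. k < n \<Longrightarrow> \<tau> n k \<in> {real k * t / real n .. real (Suc k) * t / real n}"
  shows "(\<lambda>n. \<Sum>k<n. (g (real (Suc k) * t / real n) - g (real k * t / real n)) \<bullet> w (\<tau> n k))
    \<longlonglongrightarrow> integral {0..t} (\<lambda>s. g' s \<bullet> w s)"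
proof -
  define F where "F s = integral {0..s} (\<lambda>s. g' s \<bullet> w s)" for s
  have cgw: "continuous_on {0..t} (\<lambda>s. g' s \<bullet> w s)" by (intro continuous_intros g' w)
  have dF: "(F has_vector_derivative g' s \<bullet> w s) (at s within {0..t})" if "s \<in> {0..t}" for s
    unfolding F_def using that by (intro integral_has_vector_derivative cgw)
  have "compact (g' ` {0..t})" by (intro compact_continuous_image g' compact_Icc)
  then obtain G0 where "\<And>s. s \<in> {0..t} \<Longrightarrow> norm (g' s) \<le> G0"
    by (meson bounded_iff compact_imp_bounded imageI)
  then obtain G where G: "G > 0" "\<And>s. s \<in> {0..t} \<Longrightarrow> norm (g' s) \<le> G"
    by (metis less_add_one max.cobounded1 max.cobounded2 max.strict_coboundedI2 order_trans zero_less_one)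
  have uc: "uniformly_continuous_on {0..t} w" by (intro compact_uniformly_continuous w compact_Icc)
  show ?thesis
  proof (rule LIMSEQ_I)
    fix r :: real assume r: "r > 0"
    \<comment> \<open>Each of the \<open>n\<close> pieces contributes at most
      \<open>G * \<epsilon> * (t / real n)\<close>, so the total error is
      \<open>r / 2\<close>.\<close>
    define \<epsilon> where "\<epsilon> = r / (2 * G * t)"
    have \<epsilon>: "\<epsilon> > 0" using r G t by (simp add: \<epsilon>_def)
    obtain \<delta> where \<delta>: "\<delta> > 0" "\<And>x y. x \<in> {0..t} \<Longrightarrow> y \<in> {0..t} \<Longrightarrow> dist x y < \<delta> \<Longrightarrow> dist (w x) (w y) < \<epsilon>"
      using uc \<epsilon> unfolding uniformly_continuous_on_def by metis
    obtain N :: nat where N: "real N > t / \<delta>" using reals_Archimedean2 by blast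
    show "\<exists>no. \<forall>n\<ge>no. norm ((\<Sum>k<n. (g (real (Suc k) * t / real n) - g (real k * t / real n)) \<bullet> w (\<tau> n k)) - integral {0..t} (\<lambda>s. g' s \<bullet> w s)) < r"
    proof (intro exI[of _ "Suc N"] allI impI)
      fix n assume n: "n \<ge> Suc N"
      have n0: "real n > 0" using n by simp
      have tn: "t / real n < \<delta>"
      proof -
        have "t / \<delta> < real n" using N n by linarith
        then show ?thesis using \<delta>(1) n0 by (simp add: field_simps)
      qed
      let ?s = "\<lambda>k. real k * t / real n"
      have sb: "?s k \<in> {0..t}" if "k \<le> n" for k
        using that t n0 by (simp add: divide_le_eq)
      have step: "?s (Suc k) = ?s k + t / real n" for k by (simp add: distrib_right add_divide_distrib)
      \<comment> \<open>Mean value inequality for \<open>F s - g s \<bullet> w (\<tau> n k)\<close>,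
        whose derivative \<open>g' s \<bullet> (w s - w (\<tau> n k))\<close> is small by the
        uniform continuity of \<open>w\<close>.\<close>
      have piece: "norm ((F (?s (Suc k)) - F (?s k)) - (g (?s (Suc k)) - g (?s k)) \<bullet> w (\<tau> n k)) \<le> G * \<epsilon> * (t / real n)"
        if k: "k < n" for k
      proof -
        let ?I = "{?s k .. ?s (Suc k)}"
        have I: "?I \<subseteq> {0..t}" using sb[of k] sb[of "Suc k"] k by auto
        have "((\<lambda>s. F s - g s \<bullet> w (\<tau> n k)) has_derivative (\<lambda>h. h *\<^sub>R (g' s \<bullet> w s - g' s \<bullet> w (\<tau> n k)))) (at s within ?I)"
          if "s \<in> ?I" for s
        proof -
          have "(F has_vector_derivative g' s \<bullet> w s) (at s within ?I)" "(g has_vector_derivative g' s) (at s within ?I)"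
            using has_vector_derivative_within_subset[OF dF I] has_vector_derivative_within_subset[OF g I] that I by auto
          then have "((\<lambda>s. F s - g s \<bullet> w (\<tau> n k)) has_vector_derivative (g' s \<bullet> w s - g' s \<bullet> w (\<tau> n k))) (at s within ?I)"
            by (intro has_vector_derivative_diff bounded_linear.has_vector_derivative[OF bounded_linear_inner_left])
          then show ?thesis by (simp add: has_vector_derivative_def)
        qed
        moreover have "onorm (\<lambda>h::real. h *\<^sub>R (g' s \<bullet> w s - g' s \<bullet> w (\<tau> n k))) \<le> G * \<epsilon>" if s: "s \<in> ?I" for s
        proof (rule onorm_le)
          fix h :: real
          have "dist (w s) (w (\<tau> n k)) < \<epsilon>"
          proof (rule \<delta>(2))
            show "s \<in> {0..t}" "\<tau> n k \<in> {0..t}" using s tag[OF k] I by auto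
            show "dist s (\<tau> n k) < \<delta>" using s tag[OF k] tn step[of k] by (auto simp: dist_real_def abs_if)
          qed
          then have "norm (g' s \<bullet> (w s - w (\<tau> n k))) \<le> G * \<epsilon>"
            using G(2)[of s] s I G(1) \<epsilon>
            by (intro order_trans[OF Cauchy_Schwarz_ineq2[of "g' s" "w s - w (\<tau> n k)", folded real_norm_def]] mult_mono)
               (auto simp: dist_norm)
          then show "norm (h *\<^sub>R (g' s \<bullet> w s - g' s \<bullet> w (\<tau> n k))) \<le> G * \<epsilon> * norm h"
            by (simp add: inner_diff_right abs_mult mult.commute mult_left_mono)
        qed
        ultimately have "norm ((F (?s (Suc k)) - g (?s (Suc k)) \<bullet> w (\<tau> n k)) - (F (?s k) - g (?s k) \<bullet> w (\<tau> n k))) \<le> G * \<epsilon> * norm (?s (Suc k) - ?s k)"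
          using t n0 step[of k] by (intro differentiable_bound[of ?I]) auto
        then show ?thesis using step[of k] t n0
          by (simp add: inner_diff_left algebra_simps)
      qed
      have "integral {0..t} (\<lambda>s. g' s \<bullet> w s) = (\<Sum>k<n. F (?s (Suc k)) - F (?s k))"
        using n0 by (subst sum_lessThan_telescope) (simp add: F_def)
      then have "norm ((\<Sum>k<n. (g (?s (Suc k)) - g (?s k)) \<bullet> w (\<tau> n k)) - integral {0..t} (\<lambda>s. g' s \<bullet> w s))
        = norm (\<Sum>k<n. (F (?s (Suc k)) - F (?s k)) - (g (?s (Suc k)) - g (?s k)) \<bullet> w (\<tau> n k))"
        by (simp add: sum_subtractf norm_minus_commute)
      also have "\<dots> \<le> (\<Sum>k<n. G * \<epsilon> * (t / real n))"
        by (intro sum_norm_le piece) simp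
      also have "\<dots> = r / 2" using n0 G t by (simp add: \<epsilon>_def)
      also have "\<dots> < r" using r by simp
      finally show "norm ((\<Sum>k<n. (g (?s (Suc k)) - g (?s k)) \<bullet> w (\<tau> n k)) - integral {0..t} (\<lambda>s. g' s \<bullet> w s)) < r" .
    qed
  qed
qed

text \<open>The integral form of \<Phi>' = B \<Phi> with the identity as initial value, so \<Phi> is
  \<open>exp (t B)\<close> for t \<ge> 0. This form matches the equations of the processes, from
  which the flow will be extracted.\<close>

definition linear_flow :: "('a::euclidean_space \<Rightarrow> 'a) \<Rightarrow> (real \<Rightarrow> 'a \<Rightarrow> 'a) \<Rightarrow> bool" where
  "linear_flow B \<Phi> \<longleftrightarrow> linear B \<and> (\<forall>t\<ge>0. linear (\<Phi> t)) \<and>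
     (\<forall>x. continuous_on {0..} (\<lambda>t. \<Phi> t x) \<and> (\<forall>t\<ge>0. \<Phi> t x = x + integral {0..t} (\<lambda>s. B (\<Phi> s x))))"

lemma linear_flow_unique:
  assumes "linear_flow B \<Phi>" "linear_flow B \<Psi>" "t \<ge> 0"
  shows "\<Phi> t x = \<Psi> t x"
  by (rule linear_integral_equation_unique[where h="\<lambda>_. x" and B=B and ?d1.0="\<lambda>t. \<Phi> t x" and ?d2.0="\<lambda>t. \<Psi> t x"])
     (use assms in \<open>auto simp: linear_flow_def\<close>)

context
  fixes B :: "'a::euclidean_space \<Rightarrow> 'a" and \<Phi>
  assumes flow: "linear_flow B \<Phi>"
begin

lemma linear_flow_D:
  shows "linear B" "t \<ge> 0 \<Longrightarrow> linear (\<Phi> t)" "continuous_on {0..} (\<lambda>t. \<Phi> t x)"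
    "t \<ge> 0 \<Longrightarrow> \<Phi> t x = x + integral {0..t} (\<lambda>s. B (\<Phi> s x))"
  using flow unfolding linear_flow_def by auto

lemma linear_flow_zero: "\<Phi> 0 x = x"
  using linear_flow_D(4)[of 0 x] by simp

lemma linear_flow_continuous: "continuous_on {a..b} (\<lambda>t. \<Phi> t x)" if "0 \<le> a"
  by (rule continuous_on_subset[OF linear_flow_D(3)]) (use that in auto)

lemma linear_flow_derivative:
  assumes "0 \<le> s" "s \<le> t"
  shows "((\<lambda>s. \<Phi> s x) has_vector_derivative B (\<Phi> s x)) (at s within {0..t})"
proof -
  have "((\<lambda>s. x + integral {0..s} (\<lambda>s. B (\<Phi> s x))) has_vector_derivative 0 + B (\<Phi> s x)) (at s within {0..t})"
    using assms linear_flow_D(1)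
    by (intro has_vector_derivative_add has_vector_derivative_const integral_has_vector_derivative
        bounded_linear.continuous_on[where f=B] linear_flow_continuous)
       (auto simp: linear_conv_bounded_linear)
  then show ?thesis
    using assms linear_flow_D(4)
    by (intro has_vector_derivative_transform[of s "{0..t}" "\<lambda>s. \<Phi> s x"]) auto
qed

text \<open>Both sides solve the integral equation started at \<open>B x\<close>.\<close>

lemma linear_flow_commute:
  assumes t: "t \<ge> 0"
  shows "B (\<Phi> t x) = \<Phi> t (B x)"
proof (rule linear_integral_equation_unique[where h="\<lambda>_. B x" and B=B and ?d1.0="\<lambda>t. B (\<Phi> t x)" and ?d2.0="\<lambda>t. \<Phi> t (B x)"])
  have bB: "bounded_linear B" using linear_flow_D(1) by (simp add: linear_conv_bounded_linear)
  show "linear B" by (rule linear_flow_D)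
  show "continuous_on {0..} (\<lambda>t. B (\<Phi> t x))"
    by (intro bounded_linear.continuous_on[OF bB] linear_flow_D)
  show "continuous_on {0..} (\<lambda>t. \<Phi> t (B x))" by (rule linear_flow_D)
  fix t :: real assume t: "t \<ge> 0"
  show "\<Phi> t (B x) = B x + integral {0..t} (\<lambda>s. B (\<Phi> s (B x)))"
    using t by (rule linear_flow_D)
  have "B (\<Phi> t x) = B x + B (integral {0..t} (\<lambda>s. B (\<Phi> s x)))"
    using linear_flow_D(4)[OF t, of x] linear_add[OF linear_flow_D(1)] by metis
  also have "B (integral {0..t} (\<lambda>s. B (\<Phi> s x))) = integral {0..t} (\<lambda>s. B (B (\<Phi> s x)))"
    by (subst integral_linear[OF _ bB, symmetric])
       (auto simp: o_def intro!: integrable_continuous_real bounded_linear.continuous_on[OF bB] linear_flow_continuous)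
  finally show "B (\<Phi> t x) = B x + integral {0..t} (\<lambda>s. B (B (\<Phi> s x)))" .
qed (rule t)

text \<open>The adjoint of \<open>exp (t B)\<close> is the exponential of the adjoint. Taking
  adjoints exchanges the order of drift and flow, which is where their commutation enters.\<close>

lemma linear_flow_adjoint: "linear_flow (adjoint B) (\<lambda>t. adjoint (\<Phi> t))"
  unfolding linear_flow_def
proof (intro conjI allI impI)
  note lB = linear_flow_D(1)
  show lB': "linear (adjoint B)" by (rule adjoint_linear[OF lB])
  show "linear (adjoint (\<Phi> t))" if "t \<ge> 0" for t by (intro adjoint_linear linear_flow_D that)
  fix x
  have rep: "adjoint (\<Phi> t) x = (\<Sum>b\<in>Basis. (x \<bullet> \<Phi> t b) *\<^sub>R b)" if "t \<ge> 0" for t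
    by (subst euclidean_representation[of "adjoint (\<Phi> t) x", symmetric])
       (simp add: adjoint_clauses[OF linear_flow_D(2)[OF that]])
  show cont: "continuous_on {0..} (\<lambda>t. adjoint (\<Phi> t) x)"
  proof (rule continuous_on_eq)
    show "continuous_on {0..} (\<lambda>t. \<Sum>b\<in>Basis. (x \<bullet> \<Phi> t b) *\<^sub>R b)"
      by (intro continuous_intros linear_flow_D)
  qed (simp add: rep)
  fix t :: real assume t: "t \<ge> 0"
  have bB': "bounded_linear (adjoint B)" using lB' by (simp add: linear_conv_bounded_linear)
  have i1: "(\<lambda>s. adjoint B (adjoint (\<Phi> s) x)) integrable_on {0..t}"
    by (intro integrable_continuous_real bounded_linear.continuous_on[OF bB'] continuous_on_subset[OF cont]) auto
  have i2: "(\<lambda>s. B (\<Phi> s y)) integrable_on {0..t}" for y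
    using lB by (intro integrable_continuous_real bounded_linear.continuous_on[where f=B] linear_flow_continuous)
      (auto simp: linear_conv_bounded_linear)
  have "adjoint (\<Phi> t) x \<bullet> y = (x + integral {0..t} (\<lambda>s. adjoint B (adjoint (\<Phi> s) x))) \<bullet> y" for y
  proof -
    have "adjoint (\<Phi> t) x \<bullet> y = x \<bullet> \<Phi> t y"
      by (simp add: adjoint_clauses[OF linear_flow_D(2)[OF t]])
    also have "\<dots> = x \<bullet> y + x \<bullet> integral {0..t} (\<lambda>s. B (\<Phi> s y))"
      by (subst linear_flow_D(4)[OF t]) (simp add: inner_add_right)
    also have "x \<bullet> integral {0..t} (\<lambda>s. B (\<Phi> s y)) = integral {0..t} (\<lambda>s. x \<bullet> B (\<Phi> s y))"
      using integral_linear[OF i2 bounded_linear_inner_right[of x]] by (simp add: o_def)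
    also have "\<dots> = integral {0..t} (\<lambda>s. adjoint B (adjoint (\<Phi> s) x) \<bullet> y)"
      by (intro integral_cong)
         (simp add: linear_flow_commute adjoint_clauses[OF lB] adjoint_clauses[OF linear_flow_D(2)])
    also have "\<dots> = integral {0..t} (\<lambda>s. adjoint B (adjoint (\<Phi> s) x)) \<bullet> y"
      using integral_linear[OF i1 bounded_linear_inner_left[of y]] by (simp add: o_def)
    finally show ?thesis by (simp add: inner_add_left)
  qed
  then show "adjoint (\<Phi> t) x = x + integral {0..t} (\<lambda>s. adjoint B (adjoint (\<Phi> s) x))"
    using vector_eq_rdot by blast
qed

end

subsection \<open>Linear stochastic differential equations\<close>

lemma cf_centered_gaussian_scalar:
  fixes \<theta> :: "real ^ 'n"
  assumes "a > 0"
  shows "cf (centered_gaussian (a *\<^sub>R mat 1)) \<theta> = exp (- (a * (\<theta> \<bullet> \<theta>)) / 2)"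
proof -
  let ?L = "sqrt a *\<^sub>R mat 1 :: real ^ 'n ^ 'n"
  have mul: "(c *\<^sub>R mat 1 :: real ^ 'n ^ 'n) ** (d *\<^sub>R mat 1) = (c * d) *\<^sub>R mat 1" for c d
    by (simp add: matrix_scalar_ac scalar_matrix_assoc[symmetric])
  have tr: "transpose ?L = ?L" by (simp add: transpose_scalar)
  have "invertible ?L"
    unfolding invertible_def using assms by (intro exI[of _ "(1 / sqrt a) *\<^sub>R mat 1"]) (simp add: mul)
  then have "centered_gaussian (?L ** transpose ?L) = distr std_gaussian borel (\<lambda>x. ?L *v x)"
    by (rule centered_gaussian_eq)
  also have "?L ** transpose ?L = a *\<^sub>R mat 1" using assms by (simp add: tr mul)
  finally have "cf (centered_gaussian (a *\<^sub>R mat 1)) \<theta> = cf (distr std_gaussian borel (\<lambda>x::real^'n. ?L *v x)) \<theta>" by simp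
  also have "\<dots> = cf std_gaussian (sqrt a *\<^sub>R \<theta>)"
  proof -
    have [measurable]: "(*v) ?L \<in> borel_measurable borel"
      by (intro borel_measurable_continuous_onI continuous_intros)
    show ?thesis unfolding cf_def by (subst integral_distr) (auto simp: scaleR_matrix_vector_assoc[symmetric])
  qed
  also have "\<dots> = exp (- (a * (\<theta> \<bullet> \<theta>)) / 2)"
    using assms by (simp add: cf_std_gaussian)
  finally show ?thesis .
qed

text \<open>Abstracts the equation dY = B Y dt + \<iota> dW. The assumption \<open>lyapunov\<close>
  is the Lyapunov equation for the identity matrix, written as a quadratic form: the symmetric part
  of the drift balances the noise, so that the identity is a stationary covariance. In
  \<open>Y_eq\<close> the exceptional null set may depend on the starting point.\<close>

locale linear_sde =
  fixes \<Omega> :: "'w measure" and W :: "real \<Rightarrow> 'w \<Rightarrow> real ^ 'n"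
    and B :: "'a::euclidean_space \<Rightarrow> 'a" and \<iota> :: "real ^ 'n \<Rightarrow> 'a"
    and Y :: "'a \<Rightarrow> real \<Rightarrow> 'w \<Rightarrow> 'a"
  assumes bm: "standard_brownian_motion \<Omega> W"
    and linB: "linear B" and lin\<iota>: "linear \<iota>"
    and lyapunov: "\<And>\<theta>. \<theta> \<bullet> B \<theta> = - (adjoint \<iota> \<theta> \<bullet> adjoint \<iota> \<theta>) / 2"
    and Y_measurable: "\<And>x t. t \<ge> 0 \<Longrightarrow> Y x t \<in> borel_measurable \<Omega>"
    and Y_eq: "\<And>x. AE \<omega> in \<Omega>. continuous_on {0..} (\<lambda>t. Y x t \<omega>) \<and>
        (\<forall>t\<ge>0. Y x t \<omega> = x + integral {0..t} (\<lambda>s. B (Y x s \<omega>)) + \<iota> (W t \<omega>))"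
begin

sublocale prob_space \<Omega>
  using bm by (simp add: standard_brownian_motion_def)

lemma bounded_linear_B: "bounded_linear B"
  using linB by (simp add: linear_conv_bounded_linear)

definition solves :: "'a \<Rightarrow> 'w \<Rightarrow> bool" where
  "solves x \<omega> \<longleftrightarrow> continuous_on {0..} (\<lambda>t. Y x t \<omega>) \<and>
        (\<forall>t\<ge>0. Y x t \<omega> = x + integral {0..t} (\<lambda>s. B (Y x s \<omega>)) + \<iota> (W t \<omega>))"

lemma AE_solves: "AE \<omega> in \<Omega>. solves x \<omega>"
  unfolding solves_def by (rule Y_eq)

lemma solves_integrable:
  assumes "solves x \<omega>"
  shows "(\<lambda>s. B (Y x s \<omega>)) integrable_on {0..t}"
  using assms unfolding solves_def
  by (intro integrable_continuous_real bounded_linear.continuous_on[OF bounded_linear_B]) (auto elim: continuous_on_subset)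

text \<open>Differences of solutions driven by the same noise path solve the noiseless equation, so the
  linear flow can be read off from the solutions started at a basis.\<close>

lemma ex_linear_flow: "\<exists>\<Phi>. linear_flow B \<Phi>"
proof -
  \<comment> \<open>The exceptional null sets depend on the starting point; for the finitely many
    points 0 and \<open>Basis\<close> some path avoids all of them.\<close>
  have "AE \<omega> in \<Omega>. \<forall>b\<in>insert 0 Basis. solves b \<omega>"
    by (intro AE_finite_allI AE_solves) simp
  then have "\<exists>\<omega>. \<forall>b\<in>insert 0 Basis. solves b \<omega>"
    using AE_contr by (metis (mono_tags, lifting) eventually_mono)
  then obtain \<omega> where \<omega>: "\<And>b. b \<in> insert 0 Basis \<Longrightarrow> solves b \<omega>" by blast
  define \<Phi> where "\<Phi> t x = (\<Sum>b\<in>Basis. (x \<bullet> b) *\<^sub>R (Y b t \<omega> - Y 0 t \<omega>))" for t x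
  have "linear_flow B \<Phi>"
    unfolding linear_flow_def
  proof (intro conjI allI impI)
    show "linear B" by (rule linB)
    show "linear (\<Phi> t)" for t
      unfolding \<Phi>_def by (rule linearI)
        (simp_all add: inner_add_left scaleR_add_left sum.distrib scaleR_sum_right)
    have c: "continuous_on {0..} (\<lambda>t. Y b t \<omega>)" if "b \<in> insert 0 Basis" for b
      using \<omega>[OF that] by (simp add: solves_def)
    show "continuous_on {0..} (\<lambda>t. \<Phi> t x)" for x
      unfolding \<Phi>_def by (intro continuous_intros c) auto
    fix x and t :: real assume t: "t \<ge> 0"
    have i: "(\<lambda>s. B (Y b s \<omega>)) integrable_on {0..t}" if "b \<in> insert 0 Basis" for b
      using \<omega>[OF that] by (rule solves_integrable)
    have d: "Y b t \<omega> - Y 0 t \<omega> = b + integral {0..t} (\<lambda>s. B (Y b s \<omega>) - B (Y 0 s \<omega>))" if "b \<in> Basis" for b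
    proof -
      have "Y b t \<omega> = b + integral {0..t} (\<lambda>s. B (Y b s \<omega>)) + \<iota> (W t \<omega>)"
        "Y 0 t \<omega> = 0 + integral {0..t} (\<lambda>s. B (Y 0 s \<omega>)) + \<iota> (W t \<omega>)"
        using \<omega>[of b] \<omega>[of 0] that t unfolding solves_def by blast+
      moreover have "integral {0..t} (\<lambda>s. B (Y b s \<omega>) - B (Y 0 s \<omega>)) = integral {0..t} (\<lambda>s. B (Y b s \<omega>)) - integral {0..t} (\<lambda>s. B (Y 0 s \<omega>))"
        by (intro integral_diff i) (use that in auto)
      ultimately show ?thesis by simp
    qed
    have "\<Phi> t x = (\<Sum>b\<in>Basis. (x \<bullet> b) *\<^sub>R (b + integral {0..t} (\<lambda>s. B (Y b s \<omega>) - B (Y 0 s \<omega>))))"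
      unfolding \<Phi>_def by (intro sum.cong refl) (simp add: d)
    also have "\<dots> = x + (\<Sum>b\<in>Basis. integral {0..t} (\<lambda>s. (x \<bullet> b) *\<^sub>R (B (Y b s \<omega>) - B (Y 0 s \<omega>))))"
      by (simp add: scaleR_add_right sum.distrib euclidean_representation)
    also have "(\<Sum>b\<in>Basis. integral {0..t} (\<lambda>s. (x \<bullet> b) *\<^sub>R (B (Y b s \<omega>) - B (Y 0 s \<omega>))))
      = integral {0..t} (\<lambda>s. \<Sum>b\<in>Basis. (x \<bullet> b) *\<^sub>R (B (Y b s \<omega>) - B (Y 0 s \<omega>)))"
      by (intro integral_sum[symmetric] integrable_cmul integrable_diff i) auto
    also have "\<dots> = integral {0..t} (\<lambda>s. B (\<Phi> s x))"
      unfolding \<Phi>_def by (simp add: linear_sum[OF linB] linear_diff[OF linB] linear_cmul[OF linB])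
    finally show "\<Phi> t x = x + integral {0..t} (\<lambda>s. B (\<Phi> s x))" .
  qed
  then show ?thesis by blast
qed

definition flow :: "real \<Rightarrow> 'a \<Rightarrow> 'a" where
  "flow = (SOME \<Phi>. linear_flow B \<Phi>)"

lemma flow: "linear_flow B flow"
  unfolding flow_def by (rule someI_ex[OF ex_linear_flow])

text \<open>Both sides solve the equation with the same forcing
  \<open>x + \<iota> (W t \<omega>)\<close>. This separates the starting point from the randomness,
  which is how measurability of the semigroup in the starting point is obtained: the assumptions
  give measurability of \<open>Y x t\<close> for each \<open>x\<close> separately.\<close>

lemma Y_decomp: "AE \<omega> in \<Omega>. \<forall>t\<ge>0. Y x t \<omega> = flow t x + Y 0 t \<omega>"
  using AE_solves[of x] AE_solves[of 0]
proof eventually_elim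
  case (elim \<omega>)
  show ?case
  proof (intro allI impI)
    fix t :: real assume t: "t \<ge> 0"
    show "Y x t \<omega> = flow t x + Y 0 t \<omega>"
    proof (rule linear_integral_equation_unique[OF linB _ _ _ _ t, where h="\<lambda>t. x + \<iota> (W t \<omega>)" and ?d1.0="\<lambda>t. Y x t \<omega>" and ?d2.0="\<lambda>t. flow t x + Y 0 t \<omega>"])
      show "continuous_on {0..} (\<lambda>t. Y x t \<omega>)" using elim by (simp add: solves_def)
      show "continuous_on {0..} (\<lambda>t. flow t x + Y 0 t \<omega>)"
        using elim by (intro continuous_intros linear_flow_D[OF flow]) (simp add: solves_def)
      fix t :: real assume t: "t \<ge> 0"
      have "Y x t \<omega> = x + integral {0..t} (\<lambda>s. B (Y x s \<omega>)) + \<iota> (W t \<omega>)"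
        using elim(1) t unfolding solves_def by blast
      then show "Y x t \<omega> = x + \<iota> (W t \<omega>) + integral {0..t} (\<lambda>s. B (Y x s \<omega>))" by simp
      have "Y 0 t \<omega> = 0 + integral {0..t} (\<lambda>s. B (Y 0 s \<omega>)) + \<iota> (W t \<omega>)"
        using elim(2) t unfolding solves_def by blast
      moreover have "flow t x = x + integral {0..t} (\<lambda>s. B (flow s x))"
        by (rule linear_flow_D(4)[OF flow t])
      moreover have "integral {0..t} (\<lambda>s. B (flow s x + Y 0 s \<omega>)) = integral {0..t} (\<lambda>s. B (flow s x)) + integral {0..t} (\<lambda>s. B (Y 0 s \<omega>))"
        unfolding linear_add[OF linB]
        by (rule integral_add[OF integrable_continuous_real[OF bounded_linear.continuous_on[OF bounded_linear_B linear_flow_continuous[OF flow order_refl]]]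
              solves_integrable[OF elim(2)]])
      ultimately show "flow t x + Y 0 t \<omega> = x + \<iota> (W t \<omega>) + integral {0..t} (\<lambda>s. B (flow s x + Y 0 s \<omega>))"
        by (simp add: algebra_simps)
    qed
  qed
qed

text \<open>The law of the stochastic convolution, the integral of
  \<open>exp ((t - s) B) \<iota>\<close> against dW over [0, t].\<close>

definition noise :: "real \<Rightarrow> 'a measure" where
  "noise t = distr \<Omega> borel (Y 0 t)"

lemma sets_noise [simp, measurable_cong]: "sets (noise t) = sets borel"
  by (simp add: noise_def)

lemma space_noise [simp]: "space (noise t) = UNIV"
  by (simp add: noise_def)

lemma prob_space_noise: "t \<ge> 0 \<Longrightarrow> prob_space (noise t)"
  unfolding noise_def by (intro prob_space_distr Y_measurable)

text \<open>With \<open>g s = \<iota>\<^sup>* (flow (t - s))\<^sup>* \<theta>\<close>, the inner product of \<open>\<theta>\<close> with the noise is the Wiener integral of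
  \<open>g\<close>. Integration by parts makes it the pathwise limit of \<open>\<Sum>k. g (s\<^sub>k) \<bullet> (W (s\<^sub>k\<^sub>+\<^sub>1) - W (s\<^sub>k))\<close>,
  and the Lyapunov identity integrates \<open>g \<bullet> g\<close>.\<close>

lemma cf_noise:
  assumes t: "t > 0"
  shows "cf (noise t) \<theta> = exp (- ((\<theta> \<bullet> \<theta>) - (adjoint (flow t) \<theta> \<bullet> adjoint (flow t) \<theta>)) / 2)"
proof -
  note aflow = linear_flow_adjoint[OF flow]
  define \<Theta> where "\<Theta> s = adjoint (flow (t - s)) \<theta>" for s
  define g where "g s = adjoint \<iota> (\<Theta> s)" for s
  have bB': "bounded_linear (adjoint B)" and b\<iota>': "bounded_linear (adjoint \<iota>)" and b\<iota>: "bounded_linear \<iota>"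
    using adjoint_linear[OF linB] adjoint_linear[OF lin\<iota>] lin\<iota> by (simp_all add: linear_conv_bounded_linear)
  have img: "(\<lambda>s. t - s) ` {0..t} = {0..t}" by (auto simp: image_iff intro!: bexI[of _ "t - _"])
  have \<Theta>': "(\<Theta> has_vector_derivative - adjoint B (\<Theta> s)) (at s within {0..t})" if "s \<in> {0..t}" for s
  proof -
    have "((\<lambda>s. t - s) has_vector_derivative -1) (at s within {0..t})"
      by (auto intro!: derivative_eq_intros)
    moreover have "((\<lambda>s. adjoint (flow s) \<theta>) has_vector_derivative adjoint B (\<Theta> s)) (at (t - s) within (\<lambda>s. t - s) ` {0..t})"
      unfolding img \<Theta>_def using that by (intro linear_flow_derivative[OF aflow]) auto
    ultimately have "((\<lambda>s. adjoint (flow s) \<theta>) \<circ> (\<lambda>s. t - s) has_vector_derivative -1 *\<^sub>R adjoint B (\<Theta> s)) (at s within {0..t})"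
      by (rule vector_diff_chain_within)
    then show ?thesis by (simp add: \<Theta>_def[abs_def] o_def)
  qed
  have \<Theta>t: "\<Theta> t = \<theta>" "\<Theta> 0 = adjoint (flow t) \<theta>"
    using linear_flow_zero[OF aflow] by (simp_all add: \<Theta>_def)
  have c\<Theta>: "continuous_on {0..t} \<Theta>"
    using \<Theta>' by (rule continuous_on_vector_derivative)
  have g': "(g has_vector_derivative - adjoint \<iota> (adjoint B (\<Theta> s))) (at s within {0..t})" if "s \<in> {0..t}" for s
    using bounded_linear.has_vector_derivative[OF b\<iota>' \<Theta>'[OF that]]
    by (simp add: g_def[abs_def] linear_neg[OF adjoint_linear[OF lin\<iota>]])
  have cg: "continuous_on {0..t} g"
    unfolding g_def by (intro bounded_linear.continuous_on[OF b\<iota>'] c\<Theta>)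
  define \<tau> where "\<tau> n k = real k * t / real n" for n k :: nat
  have \<tau>step: "\<tau> n (Suc k) - \<tau> n k = t / real n" for n k
    by (simp add: \<tau>_def distrib_right add_divide_distrib)
  have \<tau>pos: "0 \<le> \<tau> n k" for n k using t by (simp add: \<tau>_def)
  define Sn where "Sn n \<omega> = (\<Sum>k<n. g (\<tau> n k) \<bullet> (W (\<tau> n (Suc k)) \<omega> - W (\<tau> n k) \<omega>))" for n \<omega>
  have [measurable]: "W s \<in> borel_measurable \<Omega>" if "s \<ge> 0" for s
    using bm that by (simp add: standard_brownian_motion_def)
  have Sn_meas [measurable]: "Sn n \<in> borel_measurable \<Omega>" for n
    unfolding Sn_def by (intro borel_measurable_sum borel_measurable_inner borel_measurable_diff) (auto simp: \<tau>pos)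
  have [measurable]: "Y 0 t \<in> borel_measurable \<Omega>" using t by (intro Y_measurable) simp
  have path: "AE \<omega> in \<Omega>. (\<lambda>n. Sn n \<omega>) \<longlonglongrightarrow> \<theta> \<bullet> Y 0 t \<omega>"
  proof -
    have "AE \<omega> in \<Omega>. W 0 \<omega> = 0" "AE \<omega> in \<Omega>. continuous_on {0..} (\<lambda>t. W t \<omega>)"
      using bm by (simp_all add: standard_brownian_motion_def)
    then show ?thesis using AE_solves[of 0]
    proof eventually_elim
      case (elim \<omega>)
      define w where "w s = W s \<omega>" for s
      define z where "z s = integral {0..s} (\<lambda>s. B (Y 0 s \<omega>))" for s
      have cw: "continuous_on {0..t} w" unfolding w_def by (rule continuous_on_subset[OF elim(2)]) auto
      have cY: "continuous_on {0..t} (\<lambda>s. Y 0 s \<omega>)"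
        using elim(3) unfolding solves_def by (auto elim: continuous_on_subset)
      have Yz: "Y 0 s \<omega> = z s + \<iota> (w s)" if "s \<ge> 0" for s
      proof -
        have "Y 0 s \<omega> = 0 + integral {0..s} (\<lambda>s. B (Y 0 s \<omega>)) + \<iota> (W s \<omega>)"
          using elim(3) that unfolding solves_def by blast
        then show ?thesis by (simp add: z_def w_def)
      qed
      have z': "(z has_vector_derivative B (Y 0 s \<omega>)) (at s within {0..t})" if "s \<in> {0..t}" for s
        unfolding z_def using that
        by (intro integral_has_vector_derivative bounded_linear.continuous_on[OF bounded_linear_B] cY)
      \<comment> \<open>In the product rule the drift terms cancel except for the noise part of
        \<open>Y 0\<close>, and what remains is \<open>w\<close> paired with minus the derivative of
        \<open>g\<close>. Integration expresses \<open>\<theta> \<bullet> z t\<close> by the limit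
        of the Riemann-Stieltjes sums.\<close>
      have "((\<lambda>s. \<Theta> s \<bullet> z s) has_vector_derivative (adjoint \<iota> (adjoint B (\<Theta> s)) \<bullet> w s)) (at s within {0..t})"
        if s: "s \<in> {0..t}" for s
      proof -
        have "((\<lambda>s. \<Theta> s \<bullet> z s) has_vector_derivative (\<Theta> s \<bullet> B (Y 0 s \<omega>) + (- adjoint B (\<Theta> s)) \<bullet> z s)) (at s within {0..t})"
          by (rule bounded_bilinear.has_vector_derivative[OF bounded_bilinear_inner \<Theta>'[OF s] z'[OF s]])
        moreover have "\<Theta> s \<bullet> B (Y 0 s \<omega>) + (- adjoint B (\<Theta> s)) \<bullet> z s = adjoint \<iota> (adjoint B (\<Theta> s)) \<bullet> w s"
          using s by (simp add: Yz linear_add[OF linB] inner_add_right adjoint_clauses[OF linB] adjoint_clauses[OF lin\<iota>])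
        ultimately show ?thesis by simp
      qed
      then have "((\<lambda>s. adjoint \<iota> (adjoint B (\<Theta> s)) \<bullet> w s) has_integral \<Theta> t \<bullet> z t - \<Theta> 0 \<bullet> z 0) {0..t}"
        using t by (intro fundamental_theorem_of_calculus) auto
      then have I: "integral {0..t} (\<lambda>s. (- adjoint \<iota> (adjoint B (\<Theta> s))) \<bullet> w s) = - (\<theta> \<bullet> z t)"
        by (simp add: \<Theta>t z_def integral_unique)
      have "(\<lambda>n. \<Sum>k<n. (g (\<tau> n (Suc k)) - g (\<tau> n k)) \<bullet> w (\<tau> n (Suc k))) \<longlonglongrightarrow> - (\<theta> \<bullet> z t)"
        unfolding I[symmetric] \<tau>_def
      proof (rule tagged_sums_tendsto_integral[OF t g' _ cw])
        show "continuous_on {0..t} (\<lambda>s. - adjoint \<iota> (adjoint B (\<Theta> s)))"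
          by (intro continuous_intros bounded_linear.continuous_on[OF bB'] bounded_linear.continuous_on[OF b\<iota>'] c\<Theta>)
        show "real (Suc k) * t / real n \<in> {real k * t / real n..real (Suc k) * t / real n}" for n k
          using t by (auto intro!: divide_right_mono mult_right_mono)
      qed
      then have "(\<lambda>n. g t \<bullet> w t - (\<Sum>k<n. (g (\<tau> n (Suc k)) - g (\<tau> n k)) \<bullet> w (\<tau> n (Suc k)))) \<longlonglongrightarrow> g t \<bullet> w t - - (\<theta> \<bullet> z t)"
        by (intro tendsto_intros)
      moreover have "g t \<bullet> w t - - (\<theta> \<bullet> z t) = \<theta> \<bullet> Y 0 t \<omega>"
        using t by (simp add: Yz g_def \<Theta>t inner_add_right adjoint_clauses[OF lin\<iota>])
      moreover have "\<forall>\<^sub>F n in sequentially. g t \<bullet> w t - (\<Sum>k<n. (g (\<tau> n (Suc k)) - g (\<tau> n k)) \<bullet> w (\<tau> n (Suc k))) = Sn n \<omega>"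
        using eventually_gt_at_top[of 0]
      proof eventually_elim
        case (elim n)
        \<comment> \<open>Summation by parts: with right end points as tags the terms combine
          exactly, and the boundary term at 0 vanishes because
          \<open>W 0 \<omega> = 0\<close>.\<close>
        have "Sn n \<omega> = (\<Sum>k<n. (g (\<tau> n (Suc k)) \<bullet> w (\<tau> n (Suc k)) - g (\<tau> n k) \<bullet> w (\<tau> n k))
            - (g (\<tau> n (Suc k)) - g (\<tau> n k)) \<bullet> w (\<tau> n (Suc k)))"
          unfolding Sn_def w_def by (intro sum.cong refl) (simp add: inner_diff_left inner_diff_right)
        also have "\<dots> = g (\<tau> n n) \<bullet> w (\<tau> n n) - g (\<tau> n 0) \<bullet> w (\<tau> n 0) - (\<Sum>k<n. (g (\<tau> n (Suc k)) - g (\<tau> n k)) \<bullet> w (\<tau> n (Suc k)))"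
          unfolding sum_lessThan_telescope[of "\<lambda>k. g (\<tau> n k) \<bullet> w (\<tau> n k)", symmetric] by (rule sum_subtractf)
        finally show ?case using elim \<open>W 0 \<omega> = 0\<close> by (simp add: \<tau>_def w_def)
      qed
      ultimately show ?case by (simp add: tendsto_cong)
    qed
  qed
  have lim1: "(\<lambda>n. CLINT \<omega>|\<Omega>. iexp (Sn n \<omega>)) \<longlonglongrightarrow> (CLINT \<omega>|\<Omega>. iexp (\<theta> \<bullet> Y 0 t \<omega>))"
  proof (rule integral_dominated_convergence[where w="\<lambda>_. 1"])
    show "AE \<omega> in \<Omega>. (\<lambda>n. iexp (Sn n \<omega>)) \<longlonglongrightarrow> iexp (\<theta> \<bullet> Y 0 t \<omega>)"
      using path by eventually_elim (intro tendsto_intros)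
  qed auto
  have fin: "(CLINT \<omega>|\<Omega>. iexp (Sn n \<omega>)) = exp (- (\<Sum>k<n. (\<tau> n (Suc k) - \<tau> n k) \<bullet> (g (\<tau> n k) \<bullet> g (\<tau> n k))) / 2)"
    if n: "n > 0" for n
  proof -
    let ?D = "\<lambda>k \<omega>. W (\<tau> n (Suc k)) \<omega> - W (\<tau> n k) \<omega>"
    have inc: "\<tau> n k < \<tau> n (Suc k)" for k
    proof -
      have "t / real n > 0" using t n by simp
      then show ?thesis using \<tau>step[of n k] by linarith
    qed
    have "indep_vars (\<lambda>_. borel) ?D {..<n}"
      using bm inc \<tau>pos unfolding standard_brownian_motion_def by blast
    then have ind: "indep_vars (\<lambda>_. borel) (\<lambda>k \<omega>. g (\<tau> n k) \<bullet> ?D k \<omega>) {..<n}"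
      by (rule indep_vars_compose2[where N="\<lambda>_. borel" and Y="\<lambda>k x. g (\<tau> n k) \<bullet> x"]) simp
    have "(CLINT \<omega>|\<Omega>. iexp (Sn n \<omega>)) = char (distr \<Omega> borel (\<lambda>\<omega>. \<Sum>k\<in>{..<n}. g (\<tau> n k) \<bullet> ?D k \<omega>)) 1"
      unfolding char_def Sn_def[symmetric] by (subst integral_distr) auto
    also have "\<dots> = (\<Prod>k<n. char (distr \<Omega> borel (\<lambda>\<omega>. g (\<tau> n k) \<bullet> ?D k \<omega>)) 1)"
      by (rule char_distr_sum[OF ind])
    also have "\<dots> = (\<Prod>k<n. complex_of_real (exp (- ((\<tau> n (Suc k) - \<tau> n k) \<bullet> (g (\<tau> n k) \<bullet> g (\<tau> n k))) / 2)))"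
    proof (rule prod.cong[OF refl])
      fix k
      have [measurable]: "?D k \<in> borel_measurable \<Omega>" using \<tau>pos by auto
      have "char (distr \<Omega> borel (\<lambda>\<omega>. g (\<tau> n k) \<bullet> ?D k \<omega>)) 1 = cf (distr \<Omega> borel (?D k)) (g (\<tau> n k))"
        unfolding char_def cf_def by (subst (1 2) integral_distr) auto
      also have "distr \<Omega> borel (?D k) = centered_gaussian ((\<tau> n (Suc k) - \<tau> n k) *\<^sub>R mat 1)"
        using bm inc[of k] \<tau>pos[of n k] unfolding standard_brownian_motion_def by blast
      also have "cf \<dots> (g (\<tau> n k)) = exp (- ((\<tau> n (Suc k) - \<tau> n k) \<bullet> (g (\<tau> n k) \<bullet> g (\<tau> n k))) / 2)"
        using inc[of k] by (subst cf_centered_gaussian_scalar) auto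
      finally show "char (distr \<Omega> borel (\<lambda>\<omega>. g (\<tau> n k) \<bullet> ?D k \<omega>)) 1 = \<dots>" .
    qed
    also have "\<dots> = exp (- (\<Sum>k<n. (\<tau> n (Suc k) - \<tau> n k) \<bullet> (g (\<tau> n k) \<bullet> g (\<tau> n k))) / 2)"
      by (simp add: exp_sum[symmetric] sum_negf sum_divide_distrib of_real_prod[symmetric] del: of_real_prod)
    finally show ?thesis .
  qed
  \<comment> \<open>By the Lyapunov identity \<open>\<Theta> s \<bullet> \<Theta> s\<close> has
    derivative \<open>g s \<bullet> g s\<close>. The inner product with 1 brings the integrand into
    the form of \<open>tagged_sums_tendsto_integral\<close> with the identity as integrator.\<close>
  have I2: "integral {0..t} (\<lambda>s. 1 \<bullet> (g s \<bullet> g s)) = \<theta> \<bullet> \<theta> - adjoint (flow t) \<theta> \<bullet> adjoint (flow t) \<theta>"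
  proof -
    have "((\<lambda>s. \<Theta> s \<bullet> \<Theta> s) has_vector_derivative 1 \<bullet> (g s \<bullet> g s)) (at s within {0..t})" if s: "s \<in> {0..t}" for s
    proof -
      have "((\<lambda>s. \<Theta> s \<bullet> \<Theta> s) has_vector_derivative (\<Theta> s \<bullet> (- adjoint B (\<Theta> s)) + (- adjoint B (\<Theta> s)) \<bullet> \<Theta> s)) (at s within {0..t})"
        by (rule bounded_bilinear.has_vector_derivative[OF bounded_bilinear_inner \<Theta>'[OF s] \<Theta>'[OF s]])
      moreover have "\<Theta> s \<bullet> (- adjoint B (\<Theta> s)) + (- adjoint B (\<Theta> s)) \<bullet> \<Theta> s = g s \<bullet> g s"
        using lyapunov[of "\<Theta> s"] by (simp add: g_def adjoint_clauses[OF linB] inner_commute)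
      ultimately show ?thesis by simp
    qed
    then have "((\<lambda>s. 1 \<bullet> (g s \<bullet> g s)) has_integral \<Theta> t \<bullet> \<Theta> t - \<Theta> 0 \<bullet> \<Theta> 0) {0..t}"
      using t by (intro fundamental_theorem_of_calculus) auto
    then show ?thesis by (simp add: \<Theta>t integral_unique)
  qed
  have "(\<lambda>n. \<Sum>k<n. (\<tau> n (Suc k) - \<tau> n k) \<bullet> (g (\<tau> n k) \<bullet> g (\<tau> n k))) \<longlonglongrightarrow> integral {0..t} (\<lambda>s. 1 \<bullet> (g s \<bullet> g s))"
    unfolding \<tau>_def
  proof (rule tagged_sums_tendsto_integral[OF t, where g="\<lambda>s. s"])
    show "real k * t / real n \<in> {real k * t / real n..real (Suc k) * t / real n}" for n k
      using t by (auto intro!: divide_right_mono mult_right_mono)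
  qed (auto intro!: continuous_intros cg derivative_eq_intros)
  then have "(\<lambda>n. complex_of_real (exp (- (\<Sum>k<n. (\<tau> n (Suc k) - \<tau> n k) \<bullet> (g (\<tau> n k) \<bullet> g (\<tau> n k))) / 2)))
     \<longlonglongrightarrow> complex_of_real (exp (- integral {0..t} (\<lambda>s. 1 \<bullet> (g s \<bullet> g s)) / 2))"
    by (intro tendsto_intros) simp_all
  moreover have "\<forall>\<^sub>F n in sequentially. complex_of_real (exp (- (\<Sum>k<n. (\<tau> n (Suc k) - \<tau> n k) \<bullet> (g (\<tau> n k) \<bullet> g (\<tau> n k))) / 2)) = (CLINT \<omega>|\<Omega>. iexp (Sn n \<omega>))"
    using eventually_gt_at_top[of 0] by eventually_elim (simp only: fin)
  ultimately have "(\<lambda>n. CLINT \<omega>|\<Omega>. iexp (Sn n \<omega>)) \<longlonglongrightarrow> complex_of_real (exp (- integral {0..t} (\<lambda>s. 1 \<bullet> (g s \<bullet> g s)) / 2))"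
    by (rule Lim_transform_eventually)
  from LIMSEQ_unique[OF lim1 this]
  have "(CLINT \<omega>|\<Omega>. iexp (\<theta> \<bullet> Y 0 t \<omega>)) = complex_of_real (exp (- integral {0..t} (\<lambda>s. 1 \<bullet> (g s \<bullet> g s)) / 2))" .
  moreover have "cf (noise t) \<theta> = (CLINT \<omega>|\<Omega>. iexp (\<theta> \<bullet> Y 0 t \<omega>))"
    unfolding cf_def noise_def by (subst integral_distr) auto
  ultimately show ?thesis unfolding I2 by simp
qed

end

subsection \<open>Stationary law and time reversal\<close>

text \<open>Cauchy-Schwarz, carried out for nonnegative integrals because the limit makes the
  squared distance finite only for small \<open>t\<close>. Integrability of the products is
  therefore supplied separately.\<close>

lemma L2_pairing_tendsto:
  fixes A :: "real \<Rightarrow> 'x \<Rightarrow> real" and h \<psi> :: "'x \<Rightarrow> real"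
  assumes [measurable]: "h \<in> borel_measurable M" "\<psi> \<in> borel_measurable M"
    and A [measurable]: "\<And>t. t > 0 \<Longrightarrow> A t \<in> borel_measurable M"
    and \<psi>2: "integrable M (\<lambda>x. (\<psi> x)\<^sup>2)"
    and iA: "\<And>t. t > 0 \<Longrightarrow> integrable M (\<lambda>x. A t x * \<psi> x)"
    and ih: "integrable M (\<lambda>x. h x * \<psi> x)"
    and lim: "((\<lambda>t. \<integral>\<^sup>+x. ennreal ((A t x - h x)\<^sup>2) \<partial>M) \<longlongrightarrow> 0) (at_right 0)"
  shows "((\<lambda>t. \<integral>x. A t x * \<psi> x \<partial>M) \<longlongrightarrow> (\<integral>x. h x * \<psi> x \<partial>M)) (at_right 0)"
proof -
  define N where "N t = (\<integral>\<^sup>+x. ennreal ((A t x - h x)\<^sup>2) \<partial>M)" for t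
  define c where "c = (\<integral>x. (\<psi> x)\<^sup>2 \<partial>M)"
  have c0: "c \<ge> 0" unfolding c_def by simp
  have Nc: "(\<integral>\<^sup>+x. ennreal ((\<psi> x)\<^sup>2) \<partial>M) = ennreal c"
    unfolding c_def by (rule nn_integral_eq_integral[OF \<psi>2]) simp
  have bound: "((\<integral>x. A t x * \<psi> x \<partial>M) - (\<integral>x. h x * \<psi> x \<partial>M))\<^sup>2 \<le> enn2real (N t) * c" if t: "t > 0" "N t < \<infinity>" for t
  proof -
    note [measurable] = A[OF t(1)]
    have i: "integrable M (\<lambda>x. (A t x - h x) * \<psi> x)"
      unfolding left_diff_distrib by (intro Bochner_Integration.integrable_diff iA ih t)
    define D where "D = (\<integral>x. A t x * \<psi> x \<partial>M) - (\<integral>x. h x * \<psi> x \<partial>M)"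
    have "D = (\<integral>x. (A t x - h x) * \<psi> x \<partial>M)"
      unfolding D_def left_diff_distrib by (rule Bochner_Integration.integral_diff[symmetric]) (intro iA ih t)+
    then have "ennreal \<bar>D\<bar> \<le> (\<integral>\<^sup>+x. ennreal (norm ((A t x - h x) * \<psi> x)) \<partial>M)"
      using integral_norm_bound_ennreal[OF i] by simp
    also have "\<dots> = (\<integral>\<^sup>+x. ennreal \<bar>A t x - h x\<bar> * ennreal \<bar>\<psi> x\<bar> \<partial>M)"
      by (simp add: abs_mult ennreal_mult)
    finally have "(ennreal \<bar>D\<bar>)\<^sup>2 \<le> (\<integral>\<^sup>+x. ennreal \<bar>A t x - h x\<bar> * ennreal \<bar>\<psi> x\<bar> \<partial>M)\<^sup>2"
      by (intro power_mono) auto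
    also have "\<dots> \<le> (\<integral>\<^sup>+x. (ennreal \<bar>A t x - h x\<bar>)\<^sup>2 \<partial>M) * (\<integral>\<^sup>+x. (ennreal \<bar>\<psi> x\<bar>)\<^sup>2 \<partial>M)"
      by (rule Cauchy_Schwarz_nn_integral) measurable
    also have "\<dots> = N t * ennreal c"
      by (simp add: ennreal_power N_def Nc)
    also have "\<dots> = ennreal (enn2real (N t) * c)"
      using t c0 by (simp add: ennreal_mult)
    finally show ?thesis
      using c0 by (simp add: ennreal_power D_def[symmetric])
  qed
  have ev: "\<forall>\<^sub>F t in at_right 0. N t < \<infinity>"
    using order_tendstoD(2)[OF lim, of 1] unfolding N_def
    by (auto elim!: eventually_mono simp: less_top[symmetric] intro: order.strict_trans)
  have "((\<lambda>t. enn2real (N t)) \<longlongrightarrow> enn2real 0) (at_right 0)"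
    using lim unfolding N_def[symmetric] by (intro tendsto_enn2real) auto
  then have "((\<lambda>t. enn2real (N t) * c) \<longlongrightarrow> 0 * c) (at_right 0)"
    by (intro tendsto_mult tendsto_const) simp
  then have z: "((\<lambda>t. enn2real (N t) * c) \<longlongrightarrow> 0) (at_right 0)" by simp
  have "((\<lambda>t. ((\<integral>x. A t x * \<psi> x \<partial>M) - (\<integral>x. h x * \<psi> x \<partial>M))\<^sup>2) \<longlongrightarrow> 0) (at_right 0)"
  proof (rule tendsto_sandwich[OF _ _ tendsto_const z])
    show "\<forall>\<^sub>F t in at_right 0. ((\<integral>x. A t x * \<psi> x \<partial>M) - (\<integral>x. h x * \<psi> x \<partial>M))\<^sup>2 \<le> enn2real (N t) * c"
      using ev eventually_at_right_less[of 0] by eventually_elim (rule bound)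
  qed simp
  then have "((\<lambda>t. (\<integral>x. A t x * \<psi> x \<partial>M) - (\<integral>x. h x * \<psi> x \<partial>M)) \<longlongrightarrow> 0) (at_right 0)"
    by (simp add: power_tendsto_0_iff)
  then show ?thesis by (simp add: LIM_zero_iff)
qed

lemma borel_measurable_linear [measurable_dest]:
  fixes f :: "'a::euclidean_space \<Rightarrow> 'b::euclidean_space"
  shows "linear f \<Longrightarrow> f \<in> borel_measurable borel"
  by (intro borel_measurable_continuous_onI linear_continuous_on) (simp add: linear_conv_bounded_linear)

lemma integrable_mult_square_integrable:
  fixes f g :: "'x \<Rightarrow> real"
  assumes [measurable]: "f \<in> borel_measurable M" "g \<in> borel_measurable M"
    and "integrable M (\<lambda>x. (f x)\<^sup>2)" "integrable M (\<lambda>x. (g x)\<^sup>2)"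
  shows "integrable M (\<lambda>x. f x * g x)"
proof (rule Bochner_Integration.integrable_bound[OF Bochner_Integration.integrable_add[OF assms(3,4)]])
  show "AE x in M. norm (f x * g x) \<le> norm ((f x)\<^sup>2 + (g x)\<^sup>2)"
  proof (rule AE_I2)
    fix x
    have "2 * \<bar>f x\<bar> * \<bar>g x\<bar> \<le> (f x)\<^sup>2 + (g x)\<^sup>2"
      using sum_squares_bound[of "\<bar>f x\<bar>" "\<bar>g x\<bar>"] by simp
    moreover have "0 \<le> \<bar>f x\<bar> * \<bar>g x\<bar>" by simp
    ultimately have "\<bar>f x\<bar> * \<bar>g x\<bar> \<le> (f x)\<^sup>2 + (g x)\<^sup>2" by linarith
    then show "norm (f x * g x) \<le> norm ((f x)\<^sup>2 + (g x)\<^sup>2)" by (simp add: abs_mult)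
  qed
qed measurable

lemma square_integrable_std_gaussianD:
  assumes "square_integrable std_gaussian u"
  shows "u \<in> borel_measurable borel" "integrable std_gaussian (\<lambda>x. (u x)\<^sup>2)"
  using assms by (simp_all add: square_integrable_def measurable_cong_sets[OF sets_std_gaussian refl])

section \<open>Semigroup, law at two times and stationarity\<close>

context linear_sde
begin

lemma linear_flow_at: "t \<ge> 0 \<Longrightarrow> linear (flow t)"
  by (rule linear_flow_D(2)[OF flow])

lemma measurable_flow: "t \<ge> 0 \<Longrightarrow> flow t \<in> borel_measurable borel"
  by (rule borel_measurable_linear[OF linear_flow_at])

lemma markov_semigroup_eq:
  assumes t: "t \<ge> 0" and [measurable]: "g \<in> borel_measurable borel"
  shows "markov_semigroup \<Omega> Y t g x = (\<integral>n. g (flow t x + n) \<partial>noise t)"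
proof -
  have [measurable]: "Y x t \<in> borel_measurable \<Omega>" for x by (rule Y_measurable[OF t])
  have "markov_semigroup \<Omega> Y t g x = (\<integral>\<omega>. g (flow t x + Y 0 t \<omega>) \<partial>\<Omega>)"
    unfolding markov_semigroup_def
    by (rule integral_cong_AE) (use Y_decomp[of x] t in \<open>auto elim!: eventually_mono\<close>)
  also have "\<dots> = (\<integral>n. g (flow t x + n) \<partial>noise t)"
    unfolding noise_def by (subst integral_distr) auto
  finally show ?thesis .
qed

lemma markov_semigroup_measurable:
  assumes t: "t \<ge> 0" and [measurable]: "g \<in> borel_measurable borel"
  shows "markov_semigroup \<Omega> Y t g \<in> borel_measurable borel"
proof -
  interpret N: prob_space "noise t" by (rule prob_space_noise[OF t])
  note [measurable] = measurable_flow[OF t]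
  have "(\<lambda>x. \<integral>n. g (flow t x + n) \<partial>noise t) \<in> borel_measurable borel"
    by (rule N.borel_measurable_lebesgue_integral) measurable
  then show ?thesis
    unfolding fun_eq_iff[THEN iffD2, OF allI, OF markov_semigroup_eq[OF assms]] .
qed

text \<open>The law of the states at times 0 and \<open>t\<close> when the initial state is Gaussian
  and independent of the noise.\<close>

definition joint :: "real \<Rightarrow> ('a \<times> 'a) measure" where
  "joint t = distr (std_gaussian \<Otimes>\<^sub>M noise t) borel (\<lambda>(x, n). (x, flow t x + n))"

lemma joint_measurable:
  assumes t: "t \<ge> 0"
  shows "(\<lambda>(x, n). (x, flow t x + n)) \<in> std_gaussian \<Otimes>\<^sub>M noise t \<rightarrow>\<^sub>M borel"
proof -
  note [measurable] = measurable_flow[OF t]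
  show ?thesis by (simp add: borel_prod[symmetric])
qed

lemma sets_joint [simp, measurable_cong]: "sets (joint t) = sets borel"
  by (simp add: joint_def)

lemma space_joint [simp]: "space (joint t) = UNIV"
  by (simp add: joint_def)

lemma pair_prob_space_noise: "t \<ge> 0 \<Longrightarrow> pair_prob_space (std_gaussian :: 'a measure) (noise t)"
  using prob_space_noise[of t] prob_space_std_gaussian[where 'a='a]
  by (simp add: pair_prob_space_def pair_sigma_finite_def prob_space_imp_sigma_finite)

lemma prob_space_joint: assumes "t \<ge> 0" shows "prob_space (joint t)"
proof -
  interpret pair_prob_space "std_gaussian :: 'a measure" "noise t" by (rule pair_prob_space_noise[OF assms])
  show ?thesis unfolding joint_def by (intro prob_space_distr joint_measurable assms)
qed

text \<open>A centred Gaussian law with identity covariance at both times and the flow as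
  cross-covariance: the term that the initial state contributes through
  \<open>adjoint (flow t) \<theta>\<close> cancels the one subtracted in
  \<open>cf_noise\<close>.\<close>

lemma cf_joint:
  assumes t: "t > 0"
  shows "cf (joint t) (\<eta>, \<theta>) = exp (- (\<eta> \<bullet> \<eta> + 2 * (flow t \<eta> \<bullet> \<theta>) + \<theta> \<bullet> \<theta>) / 2)"
proof -
  interpret pair_prob_space "std_gaussian :: 'a measure" "noise t"
    using t by (intro pair_prob_space_noise) simp
  note lin = linear_flow_at[OF less_imp_le[OF t]]
  note [measurable] = measurable_flow[OF less_imp_le[OF t]]
  let ?a = "adjoint (flow t) \<theta>"
  have i: "integrable (std_gaussian \<Otimes>\<^sub>M noise t) (\<lambda>(x, n). iexp ((\<eta> + ?a) \<bullet> x) * iexp (\<theta> \<bullet> n))"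
    by (rule P.integrable_const_bound[where B=1]) (auto simp: norm_mult)
  have "cf (joint t) (\<eta>, \<theta>) = (CLINT z|std_gaussian \<Otimes>\<^sub>M noise t. iexp ((\<eta>, \<theta>) \<bullet> (fst z, flow t (fst z) + snd z)))"
    unfolding cf_def joint_def
    by (subst integral_distr[OF joint_measurable]) (use t in \<open>auto simp: split_beta\<close>)
  also have "\<dots> = (CLINT z|std_gaussian \<Otimes>\<^sub>M noise t. (\<lambda>(x, n). iexp ((\<eta> + ?a) \<bullet> x) * iexp (\<theta> \<bullet> n)) z)"
    by (intro Bochner_Integration.integral_cong refl)
       (auto simp: split_beta exp_add[symmetric] inner_add_left inner_add_right adjoint_clauses[OF lin] algebra_simps)
  also have "\<dots> = (CLINT x|std_gaussian. CLINT n|noise t. iexp ((\<eta> + ?a) \<bullet> x) * iexp (\<theta> \<bullet> n))"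
    by (subst integral_fst'[OF i, symmetric]) simp
  also have "\<dots> = cf std_gaussian (\<eta> + ?a) * cf (noise t) \<theta>"
    unfolding cf_def by simp
  also have "\<dots> = exp (- ((\<eta> + ?a) \<bullet> (\<eta> + ?a)) / 2 + - ((\<theta> \<bullet> \<theta>) - (?a \<bullet> ?a)) / 2)"
    unfolding cf_std_gaussian cf_noise[OF t] of_real_mult[symmetric] exp_add[symmetric] ..
  also have "- ((\<eta> + ?a) \<bullet> (\<eta> + ?a)) / 2 + - ((\<theta> \<bullet> \<theta>) - (?a \<bullet> ?a)) / 2 = - (\<eta> \<bullet> \<eta> + 2 * (flow t \<eta> \<bullet> \<theta>) + \<theta> \<bullet> \<theta>) / 2"
  proof -
    have "\<eta> \<bullet> ?a = flow t \<eta> \<bullet> \<theta>" by (rule adjoint_clauses(1)[OF lin])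
    then show ?thesis by (simp add: inner_add_left inner_add_right inner_commute[of ?a \<eta>] field_simps)
  qed
  finally show ?thesis .
qed

lemma measurable_joint_fst_snd [measurable]:
  "fst \<in> borel_measurable (joint t)" "snd \<in> borel_measurable (joint t)"
  by (auto intro!: borel_measurable_continuous_onI continuous_intros simp: measurable_cong_sets[OF sets_joint refl])

lemma joint_marginals:
  assumes t: "t > 0"
  shows "distr (joint t) borel fst = std_gaussian" "distr (joint t) borel snd = std_gaussian"
proof -
  interpret J: prob_space "joint t" using t by (intro prob_space_joint) simp
  interpret G: prob_space "std_gaussian :: 'a measure" by (rule prob_space_std_gaussian)
  show "distr (joint t) borel fst = std_gaussian"
  proof (rule cf_uniqueness)
    fix \<theta> :: 'a
    have "cf (distr (joint t) borel fst) \<theta> = cf (joint t) (\<theta>, 0)"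
      unfolding cf_def by (subst integral_distr) (auto simp: inner_prod_def)
    then show "cf (distr (joint t) borel fst) \<theta> = cf std_gaussian \<theta>"
      by (simp add: cf_joint[OF t] cf_std_gaussian)
  qed (auto intro: J.finite_measure_distr G.finite_measure_axioms)
  show "distr (joint t) borel snd = std_gaussian"
  proof (rule cf_uniqueness)
    fix \<theta> :: 'a
    have "cf (distr (joint t) borel snd) \<theta> = cf (joint t) (0, \<theta>)"
      unfolding cf_def by (subst integral_distr) (auto simp: inner_prod_def)
    then show "cf (distr (joint t) borel snd) \<theta> = cf std_gaussian \<theta>"
      using linear_0[OF linear_flow_at[OF less_imp_le[OF t]]] by (simp add: cf_joint[OF t] cf_std_gaussian)
  qed (auto intro: J.finite_measure_distr G.finite_measure_axioms)
qed

lemma stationary: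
  assumes t: "t > 0"
  shows "distr (std_gaussian \<Otimes>\<^sub>M noise t) borel (\<lambda>(x, n). flow t x + n) = std_gaussian"
proof -
  have "std_gaussian = distr (joint t) borel snd" by (rule joint_marginals(2)[OF t, symmetric])
  also have "\<dots> = distr (std_gaussian \<Otimes>\<^sub>M noise t) borel (\<lambda>(x, n). flow t x + n)"
    unfolding joint_def
    by (subst distr_distr[OF _ joint_measurable])
       (use t in \<open>auto simp: o_def case_prod_beta' intro!: borel_measurable_continuous_onI continuous_intros\<close>)
  finally show ?thesis ..
qed

text \<open>Both marginals of the joint law are standard Gaussian, so \<open>u\<close> at time
  \<open>t\<close> and \<open>\<psi>\<close> at time 0 are square integrable under it and their
  product is integrable. Fubini then yields both claims for an arbitrary square integrable
  \<open>u\<close>.\<close>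

lemma semigroup_pairing:
  fixes u \<psi> :: "'a \<Rightarrow> real"
  assumes t: "t > 0"
    and u: "square_integrable std_gaussian u" and \<psi>: "square_integrable std_gaussian \<psi>"
  shows "integrable std_gaussian (\<lambda>x. markov_semigroup \<Omega> Y t u x * \<psi> x)"
    and "(\<integral>x. markov_semigroup \<Omega> Y t u x * \<psi> x \<partial>std_gaussian) = (\<integral>z. u (snd z) * \<psi> (fst z) \<partial>joint t)"
proof -
  interpret pair_prob_space "std_gaussian :: 'a measure" "noise t"
    using t by (intro pair_prob_space_noise) simp
  have t0: "t \<ge> 0" using t by simp
  have [measurable]: "u \<in> borel_measurable borel" "\<psi> \<in> borel_measurable borel"
    and u2: "integrable std_gaussian (\<lambda>x. (u x)\<^sup>2)" and \<psi>2: "integrable std_gaussian (\<lambda>x. (\<psi> x)\<^sup>2)"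
    using square_integrable_std_gaussianD[OF u] square_integrable_std_gaussianD[OF \<psi>] by simp_all
  have "integrable (distr (joint t) borel snd) (\<lambda>x. (u x)\<^sup>2)" "integrable (distr (joint t) borel fst) (\<lambda>x. (\<psi> x)\<^sup>2)"
    unfolding joint_marginals[OF t] by (rule u2 \<psi>2)+
  then have i2: "integrable (joint t) (\<lambda>z. (u (snd z))\<^sup>2)" "integrable (joint t) (\<lambda>z. (\<psi> (fst z))\<^sup>2)"
    by (simp_all add: integrable_distr_eq)
  have iJ: "integrable (joint t) (\<lambda>z. u (snd z) * \<psi> (fst z))"
    by (intro integrable_mult_square_integrable i2) measurable
  have mJ: "(\<lambda>z. u (snd z) * \<psi> (fst z)) \<in> borel_measurable (borel :: ('a \<times> 'a) measure)"
    by (simp add: borel_prod[symmetric])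
  have iP: "integrable (std_gaussian \<Otimes>\<^sub>M noise t) (\<lambda>(x, n). u (flow t x + n) * \<psi> x)"
    using iJ unfolding joint_def
    by (subst (asm) integrable_distr_eq[OF joint_measurable[OF t0] mJ]) (simp add: case_prod_beta')
  have eq: "markov_semigroup \<Omega> Y t u x * \<psi> x = (\<integral>n. (\<lambda>(x, n). u (flow t x + n) * \<psi> x) (x, n) \<partial>noise t)" for x
    by (simp add: markov_semigroup_eq[OF t0])
  show "integrable std_gaussian (\<lambda>x. markov_semigroup \<Omega> Y t u x * \<psi> x)"
    unfolding eq by (rule integrable_fst'[OF iP])
  have "(\<integral>x. markov_semigroup \<Omega> Y t u x * \<psi> x \<partial>std_gaussian) = (\<integral>z. (\<lambda>(x, n). u (flow t x + n) * \<psi> x) z \<partial>(std_gaussian \<Otimes>\<^sub>M noise t))"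
    unfolding eq by (rule integral_fst'[OF iP])
  also have "\<dots> = (\<integral>z. u (snd z) * \<psi> (fst z) \<partial>joint t)"
    unfolding joint_def by (subst integral_distr[OF joint_measurable[OF t0] mJ]) (simp add: case_prod_beta')
  finally show "(\<integral>x. markov_semigroup \<Omega> Y t u x * \<psi> x \<partial>std_gaussian) = (\<integral>z. u (snd z) * \<psi> (fst z) \<partial>joint t)" .
qed

end

section \<open>Time reversal and duality of generators\<close>

lemma std_gaussian_invariant:
  fixes F :: "'a::euclidean_space \<Rightarrow> 'a"
  assumes lin: "linear F" and iso: "\<And>x y. F x \<bullet> F y = x \<bullet> y" and inv: "\<And>x. F (F x) = x"
  shows "distr std_gaussian borel F = std_gaussian"
proof (rule cf_uniqueness)
  interpret G: prob_space "std_gaussian :: 'a measure" by (rule prob_space_std_gaussian)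
  note [measurable] = borel_measurable_linear[OF lin]
  show "finite_measure (distr std_gaussian borel F)" by (intro G.finite_measure_distr) simp
  show "finite_measure (std_gaussian :: 'a measure)" by (rule G.finite_measure_axioms)
  fix \<theta> :: 'a
  have "\<theta> \<bullet> F x = F \<theta> \<bullet> x" for x using iso[of "F \<theta>" x] by (simp add: inv)
  then have "cf (distr std_gaussian borel F) \<theta> = cf std_gaussian (F \<theta>)"
    unfolding cf_def by (subst integral_distr) auto
  then show "cf (distr std_gaussian borel F) \<theta> = cf std_gaussian \<theta>" by (simp add: cf_std_gaussian iso)
qed simp_all

text \<open>For identity stationary covariance the time reversed drift is the adjoint;
  \<open>reversal\<close> says that its conjugate by the involution \<open>F\<close> is the drift of
  the second equation. The equations may live on different probability spaces, since only laws are
  compared.\<close>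

locale reversible_pair = S1: linear_sde \<Omega> W B \<iota> Y + S2: linear_sde \<Omega>' W' B' \<iota>' Y'
  for \<Omega> :: "'w measure" and W :: "real \<Rightarrow> 'w \<Rightarrow> real ^ 'n" and B :: "'a::euclidean_space \<Rightarrow> 'a" and \<iota> Y
  and \<Omega>' :: "'v measure" and W' :: "real \<Rightarrow> 'v \<Rightarrow> real ^ 'm" and B' :: "'a::euclidean_space \<Rightarrow> 'a" and \<iota>' Y' +
  fixes F :: "'a \<Rightarrow> 'a"
  assumes linF: "linear F" and isoF: "\<And>x y. F x \<bullet> F y = x \<bullet> y" and invF: "\<And>x. F (F x) = x"
    and reversal: "\<And>x. B' x = F (adjoint B (F x))"
begin

lemma F_sym: "F x \<bullet> y = x \<bullet> F y"
  using isoF[of x "F y"] by (simp add: invF)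

lemma flow_reversed:
  assumes t: "t \<ge> 0"
  shows "S2.flow t x = F (adjoint (S1.flow t) (F x))"
proof (rule linear_flow_unique[OF S2.flow _ t, where \<Psi>="\<lambda>t x. F (adjoint (S1.flow t) (F x))"])
  have bF: "bounded_linear F" using linF by (simp add: linear_conv_bounded_linear)
  have bB: "bounded_linear (adjoint B)" using adjoint_linear[OF S1.linB] by (simp add: linear_conv_bounded_linear)
  note a = linear_flow_adjoint[OF S1.flow]
  show "linear_flow B' (\<lambda>t x. F (adjoint (S1.flow t) (F x)))"
    unfolding linear_flow_def
  proof (intro conjI allI impI)
    show "linear B'" by (rule S2.linB)
    show "linear (\<lambda>x. F (adjoint (S1.flow t) (F x)))" if "t \<ge> 0" for t
      using linear_compose[OF linear_compose[OF linF linear_flow_D(2)[OF a that]] linF] by (simp add: o_def)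
    show "continuous_on {0..} (\<lambda>t. F (adjoint (S1.flow t) (F x)))" for x
      by (intro bounded_linear.continuous_on[OF bF] linear_flow_D(3)[OF a])
    fix x and t :: real assume t: "t \<ge> 0"
    have "F (adjoint (S1.flow t) (F x)) = F (F x + integral {0..t} (\<lambda>s. adjoint B (adjoint (S1.flow s) (F x))))"
      using linear_flow_D(4)[OF a t, of "F x"] by metis
    also have "\<dots> = x + F (integral {0..t} (\<lambda>s. adjoint B (adjoint (S1.flow s) (F x))))"
      by (simp add: linear_add[OF linF] invF)
    also have "F (integral {0..t} (\<lambda>s. adjoint B (adjoint (S1.flow s) (F x)))) = integral {0..t} (\<lambda>s. F (adjoint B (adjoint (S1.flow s) (F x))))"
      by (subst integral_linear[OF _ bF, symmetric])
         (auto simp: o_def intro!: integrable_continuous_real bounded_linear.continuous_on[OF bB] linear_flow_continuous[OF a])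
    finally show "F (adjoint (S1.flow t) (F x)) = x + integral {0..t} (\<lambda>s. B' (F (adjoint (S1.flow s) (F x))))"
      by (simp add: reversal invF)
  qed
qed

lemma measurable_F [measurable]: "F \<in> borel_measurable borel"
  by (rule borel_measurable_linear[OF linF])

text \<open>Both laws are centred Gaussian with identity marginal covariances, so only the
  cross-covariances have to agree, and they do by \<open>flow_reversed\<close>.\<close>

lemma joint_reversed:
  assumes t: "t > 0"
  shows "distr (S1.joint t) borel (\<lambda>z. (F (snd z), F (fst z))) = S2.joint t"
proof (rule cf_uniqueness)
  interpret J1: prob_space "S1.joint t" using t by (intro S1.prob_space_joint) simp
  interpret J2: prob_space "S2.joint t" using t by (intro S2.prob_space_joint) simp
  have m [measurable]: "(\<lambda>z. (F (snd z), F (fst z))) \<in> borel_measurable (S1.joint t)"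
    by (simp add: borel_prod[symmetric])
  show "finite_measure (distr (S1.joint t) borel (\<lambda>z. (F (snd z), F (fst z))))"
    by (rule J1.finite_measure_distr[OF m])
  show "finite_measure (S2.joint t)" by (rule J2.finite_measure_axioms)
  fix \<theta> :: "'a \<times> 'a"
  obtain a b where \<theta>: "\<theta> = (a, b)" by (cases \<theta>)
  have "cf (distr (S1.joint t) borel (\<lambda>z. (F (snd z), F (fst z)))) (a, b) = cf (S1.joint t) (F b, F a)"
    unfolding cf_def by (subst integral_distr[OF m]) (auto simp: inner_prod_def F_sym add.commute)
  also have "\<dots> = exp (- (b \<bullet> b + 2 * (S1.flow t (F b) \<bullet> F a) + a \<bullet> a) / 2)"
    by (simp add: S1.cf_joint[OF t] isoF)
  also have "S1.flow t (F b) \<bullet> F a = S2.flow t a \<bullet> b"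
  proof -
    have "S2.flow t a \<bullet> b = adjoint (S1.flow t) (F a) \<bullet> F b"
      using t by (simp add: flow_reversed F_sym)
    also have "\<dots> = F a \<bullet> S1.flow t (F b)"
      using t by (simp add: adjoint_clauses[OF S1.linear_flow_at])
    finally show ?thesis by (simp add: inner_commute)
  qed
  also have "exp (- (b \<bullet> b + 2 * (S2.flow t a \<bullet> b) + a \<bullet> a) / 2) = cf (S2.joint t) (a, b)"
    by (simp add: S2.cf_joint[OF t] add_ac)
  finally show "cf (distr (S1.joint t) borel (\<lambda>z. (F (snd z), F (fst z)))) \<theta> = cf (S2.joint t) \<theta>" by (simp add: \<theta>)
qed simp_all

lemma distr_F: "distr std_gaussian borel F = std_gaussian"
  by (rule std_gaussian_invariant[OF linF isoF invF])

lemma integral_F: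
  fixes f :: "'a \<Rightarrow> real"
  assumes [measurable]: "f \<in> borel_measurable borel"
  shows "(\<integral>x. f (F x) \<partial>std_gaussian) = (\<integral>x. f x \<partial>std_gaussian)"
  by (subst (2) distr_F[symmetric], subst integral_distr) auto

lemma square_integrable_F:
  assumes "square_integrable std_gaussian f"
  shows "square_integrable std_gaussian (\<lambda>x. f (F x))"
proof -
  have [measurable]: "f \<in> borel_measurable borel" by (rule square_integrable_std_gaussianD[OF assms])
  have "integrable (distr std_gaussian borel F) (\<lambda>x. (f x)\<^sup>2)"
    using assms by (simp add: distr_F square_integrable_def)
  then show ?thesis by (simp add: square_integrable_def integrable_distr_eq)
qed

lemma semigroup_duality:
  assumes t: "t > 0"
    and u: "square_integrable std_gaussian u" and \<psi>: "square_integrable std_gaussian \<psi>"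
  shows "(\<integral>x. markov_semigroup \<Omega> Y t u x * \<psi> (F x) \<partial>std_gaussian)
       = (\<integral>x. markov_semigroup \<Omega>' Y' t \<psi> x * u (F x) \<partial>std_gaussian)"
proof -
  have [measurable]: "u \<in> borel_measurable borel" "\<psi> \<in> borel_measurable borel"
    using square_integrable_std_gaussianD[OF u] square_integrable_std_gaussianD[OF \<psi>] by simp_all
  have m: "(\<lambda>z. (F (snd z), F (fst z))) \<in> borel_measurable (S1.joint t)"
    by (simp add: borel_prod[symmetric])
  have m2: "(\<lambda>z. \<psi> (snd z) * u (F (fst z))) \<in> borel_measurable (borel :: ('a \<times> 'a) measure)"
    by (simp add: borel_prod[symmetric])
  have "(\<integral>x. markov_semigroup \<Omega> Y t u x * \<psi> (F x) \<partial>std_gaussian) = (\<integral>z. u (snd z) * \<psi> (F (fst z)) \<partial>S1.joint t)"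
    by (rule S1.semigroup_pairing(2)[OF t u square_integrable_F[OF \<psi>]])
  also have "\<dots> = (\<integral>z. \<psi> (snd z) * u (F (fst z)) \<partial>S2.joint t)"
    unfolding joint_reversed[OF t, symmetric]
    by (subst integral_distr[OF m m2]) (simp add: invF mult.commute)
  also have "\<dots> = (\<integral>x. markov_semigroup \<Omega>' Y' t \<psi> x * u (F x) \<partial>std_gaussian)"
    by (rule S2.semigroup_pairing(2)[OF t \<psi> square_integrable_F[OF u], symmetric])
  finally show ?thesis .
qed

text \<open>The pairing of \<open>u\<close> with \<open>\<xi>\<close> is symmetric under
  \<open>F\<close>, so by \<open>semigroup_duality\<close> the difference quotients of the two
  semigroups have equal pairings for each t > 0. Both sides converge by the definition of the
  generator, which applies to arbitrary elements of the graphs.\<close>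

lemma generator_duality:
  assumes u: "generator \<Omega> Y std_gaussian u h" and \<xi>: "generator \<Omega>' Y' std_gaussian \<xi> k"
  shows "(\<integral>x. h x * \<xi> (F x) \<partial>std_gaussian) = (\<integral>x. k x * u (F x) \<partial>std_gaussian)"
proof -
  have sq: "square_integrable std_gaussian u" "square_integrable std_gaussian h"
    "square_integrable std_gaussian \<xi>" "square_integrable std_gaussian k"
    using u \<xi> by (auto simp: generator_def)
  then have [measurable]: "u \<in> borel_measurable borel" "h \<in> borel_measurable borel"
    "\<xi> \<in> borel_measurable borel" "k \<in> borel_measurable borel"
    by (simp_all add: square_integrable_std_gaussianD)
  note sqF = square_integrable_F[OF sq(1)] square_integrable_F[OF sq(3)]
  have prod: "integrable std_gaussian (\<lambda>x. f x * g x)" if "square_integrable std_gaussian f" "square_integrable std_gaussian g" for f g :: "'a \<Rightarrow> real"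
    using that by (intro integrable_mult_square_integrable) (auto simp: square_integrable_def)
  have e1: "(\<integral>x. (markov_semigroup \<Omega> Y t u x - u x) / t * \<xi> (F x) \<partial>std_gaussian)
      = ((\<integral>x. markov_semigroup \<Omega> Y t u x * \<xi> (F x) \<partial>std_gaussian) - (\<integral>x. u x * \<xi> (F x) \<partial>std_gaussian)) / t"
    and i1: "integrable std_gaussian (\<lambda>x. (markov_semigroup \<Omega> Y t u x - u x) / t * \<xi> (F x))" if t: "t > 0" for t
    using S1.semigroup_pairing(1)[OF t sq(1) sqF(2)] prod[OF sq(1) sqF(2)]
    by (simp_all add: left_diff_distrib)
  have e2: "(\<integral>x. (markov_semigroup \<Omega>' Y' t \<xi> x - \<xi> x) / t * u (F x) \<partial>std_gaussian)
      = ((\<integral>x. markov_semigroup \<Omega>' Y' t \<xi> x * u (F x) \<partial>std_gaussian) - (\<integral>x. \<xi> x * u (F x) \<partial>std_gaussian)) / t"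
    and i2: "integrable std_gaussian (\<lambda>x. (markov_semigroup \<Omega>' Y' t \<xi> x - \<xi> x) / t * u (F x))" if t: "t > 0" for t
    using S2.semigroup_pairing(1)[OF t sq(3) sqF(1)] prod[OF sq(3) sqF(1)]
    by (simp_all add: left_diff_distrib)
  have l1: "((\<lambda>t. \<integral>x. (markov_semigroup \<Omega> Y t u x - u x) / t * \<xi> (F x) \<partial>std_gaussian) \<longlongrightarrow> (\<integral>x. h x * \<xi> (F x) \<partial>std_gaussian)) (at_right 0)"
  proof (rule L2_pairing_tendsto)
    fix t :: real assume t: "t > 0"
    show "(\<lambda>x. (markov_semigroup \<Omega> Y t u x - u x) / t) \<in> borel_measurable std_gaussian"
      using S1.markov_semigroup_measurable[of t u] t by simp
  qed (use sqF sq prod[OF sq(2) sqF(2)] i1 u in \<open>auto simp: square_integrable_def generator_def\<close>)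
  have l2: "((\<lambda>t. \<integral>x. (markov_semigroup \<Omega>' Y' t \<xi> x - \<xi> x) / t * u (F x) \<partial>std_gaussian) \<longlongrightarrow> (\<integral>x. k x * u (F x) \<partial>std_gaussian)) (at_right 0)"
  proof (rule L2_pairing_tendsto)
    fix t :: real assume t: "t > 0"
    show "(\<lambda>x. (markov_semigroup \<Omega>' Y' t \<xi> x - \<xi> x) / t) \<in> borel_measurable std_gaussian"
      using S2.markov_semigroup_measurable[of t \<xi>] t by simp
  qed (use sqF sq prod[OF sq(4) sqF(1)] i2 \<xi> in \<open>auto simp: square_integrable_def generator_def\<close>)
  have s: "(\<integral>x. u x * \<xi> (F x) \<partial>std_gaussian) = (\<integral>x. \<xi> x * u (F x) \<partial>std_gaussian)"
    using integral_F[of "\<lambda>x. u x * \<xi> (F x)"] by (simp add: invF mult.commute)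
  have "\<forall>\<^sub>F t in at_right 0. (\<integral>x. (markov_semigroup \<Omega> Y t u x - u x) / t * \<xi> (F x) \<partial>std_gaussian)
      = (\<integral>x. (markov_semigroup \<Omega>' Y' t \<xi> x - \<xi> x) / t * u (F x) \<partial>std_gaussian)"
    using eventually_at_right_less[of 0]
    by eventually_elim (simp only: e1 e2 s semigroup_duality[OF _ sq(1,3)])
  from tendsto_cong[OF this] l1 l2 show ?thesis
    using tendsto_unique[OF trivial_limit_at_right_real] by blast
qed

end

subsection \<open>The generator on quadratic polynomials\<close>

lemma integrable_std_gaussian_quadratic_bound:
  fixes f :: "'a::euclidean_space \<Rightarrow> real"
  assumes [measurable]: "f \<in> borel_measurable borel" and bound: "\<And>x. \<bar>f x\<bar> \<le> c * (1 + (norm x)\<^sup>2)"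
  shows "square_integrable std_gaussian f" "integrable std_gaussian f"
proof -
  interpret prob_space "std_gaussian :: 'a measure" by (rule prob_space_std_gaussian)
  have i: "integrable std_gaussian (\<lambda>x::'a. 2 * c\<^sup>2 * (1 + norm x ^ 4))"
    using integrable_std_gaussian_norm4[where 'a='a] by simp
  have le: "(f x)\<^sup>2 \<le> 2 * c\<^sup>2 * (1 + norm x ^ 4)" for x
  proof -
    have "(1 + (norm x)\<^sup>2)\<^sup>2 \<le> 2 * (1 + norm x ^ 4)"
    proof -
      have "0 \<le> (1 - (norm x)\<^sup>2)\<^sup>2" by simp
      then show ?thesis by (simp add: power2_eq_square power4_eq_xxxx algebra_simps)
    qed
    then have *: "c\<^sup>2 * (1 + (norm x)\<^sup>2)\<^sup>2 \<le> c\<^sup>2 * (2 * (1 + norm x ^ 4))"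
      by (rule mult_left_mono) simp
    have "(f x)\<^sup>2 \<le> (c * (1 + (norm x)\<^sup>2))\<^sup>2"
      using power_mono[OF bound[of x] abs_ge_zero, of 2] by simp
    also have "\<dots> = c\<^sup>2 * (1 + (norm x)\<^sup>2)\<^sup>2" by (simp add: power_mult_distrib)
    also note *
    finally show ?thesis by (simp add: algebra_simps)
  qed
  have s: "integrable std_gaussian (\<lambda>x. (f x)\<^sup>2)"
    by (rule Bochner_Integration.integrable_bound[OF i]) (auto intro!: AE_I2 order_trans[OF le])
  then show "square_integrable std_gaussian f" by (auto simp: square_integrable_def)
  show "integrable std_gaussian f"
    by (rule square_integrable_imp_integrable) (use s in auto)
qed

lemma quadratic_form_bounds:
  fixes Q :: "'a::euclidean_space \<Rightarrow> 'a"
  assumes "linear Q"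
  obtains q where "q \<ge> 0" "\<And>x. norm (Q x) \<le> q * norm x" "\<And>x y. \<bar>x \<bullet> Q y\<bar> \<le> q * norm x * norm y"
proof -
  have b: "bounded_linear Q" using assms by (simp add: linear_conv_bounded_linear)
  then obtain q where q: "q \<ge> 0" "\<And>x. norm (Q x) \<le> norm x * q"
    using bounded_linear.nonneg_bounded by blast
  have "\<bar>x \<bullet> Q y\<bar> \<le> q * norm x * norm y" for x y
  proof -
    have "\<bar>x \<bullet> Q y\<bar> \<le> norm x * norm (Q y)" by (rule Cauchy_Schwarz_ineq2)
    also have "\<dots> \<le> norm x * (norm y * q)" by (intro mult_left_mono q) simp
    finally show ?thesis by (simp add: ac_simps)
  qed
  with q show ?thesis by (intro that[of q]) (auto simp: mult.commute)
qed

lemma norm_le_one_plus_square: "norm x \<le> 1 + (norm x)\<^sup>2"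
proof -
  have "0 \<le> (norm x - 1)\<^sup>2 + (norm x)\<^sup>2 + 1" by simp
  then show ?thesis by (simp add: power2_eq_square algebra_simps)
qed

lemma abs_inner_le_quadratic: "\<bar>c \<bullet> x\<bar> \<le> norm c * (1 + (norm x)\<^sup>2)"
  by (rule order_trans[OF Cauchy_Schwarz_ineq2 mult_left_mono[OF norm_le_one_plus_square norm_ge_zero]])

lemma std_gaussian_quadratic_integrable:
  fixes Q :: "'a::euclidean_space \<Rightarrow> 'a" and c :: 'a and k :: real
  assumes "linear Q"
  shows "square_integrable std_gaussian (\<lambda>x. x \<bullet> Q x + c \<bullet> x + k)"
    and "integrable std_gaussian (\<lambda>x. x \<bullet> Q x + c \<bullet> x + k)"
proof -
  note [measurable] = borel_measurable_linear[OF assms]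
  obtain q where q: "q \<ge> 0" "\<And>x y. \<bar>x \<bullet> Q y\<bar> \<le> q * norm x * norm y"
    using quadratic_form_bounds[OF assms] by metis
  have bound: "\<bar>x \<bullet> Q x + c \<bullet> x + k\<bar> \<le> (q + norm c + \<bar>k\<bar>) * (1 + (norm x)\<^sup>2)" for x
  proof -
    have "\<bar>x \<bullet> Q x\<bar> \<le> q * (norm x)\<^sup>2" using q(2)[of x x] by (simp add: power2_eq_square mult.assoc)
    moreover have "0 \<le> \<bar>k\<bar> * (norm x)\<^sup>2" by simp
    moreover have "\<bar>x \<bullet> Q x + c \<bullet> x + k\<bar> \<le> \<bar>x \<bullet> Q x\<bar> + \<bar>c \<bullet> x\<bar> + \<bar>k\<bar>" by linarith
    ultimately have "\<bar>x \<bullet> Q x + c \<bullet> x + k\<bar> \<le> q * (norm x)\<^sup>2 + norm c * (1 + (norm x)\<^sup>2) + \<bar>k\<bar> + \<bar>k\<bar> * (norm x)\<^sup>2"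
      using abs_inner_le_quadratic[of c x] by linarith
    then show ?thesis using q(1) by (simp add: algebra_simps)
  qed
  have m: "(\<lambda>x. x \<bullet> Q x + c \<bullet> x + k) \<in> borel_measurable borel" by measurable
  show "square_integrable std_gaussian (\<lambda>x. x \<bullet> Q x + c \<bullet> x + k)"
    "integrable std_gaussian (\<lambda>x. x \<bullet> Q x + c \<bullet> x + k)"
    by (rule integrable_std_gaussian_quadratic_bound[OF m bound])+
qed

context linear_sde
begin

text \<open>The characteristic function is even. Hence linear functionals of the noise have mean
  zero.\<close>

lemma noise_symmetric:
  assumes t: "t > 0"
  shows "distr (noise t) borel uminus = noise t"
proof (rule cf_uniqueness)
  interpret N: prob_space "noise t" using t by (intro prob_space_noise) simp
  show "finite_measure (distr (noise t) borel uminus)" by (intro N.finite_measure_distr) simp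
  show "finite_measure (noise t)" by (rule N.finite_measure_axioms)
  fix \<theta>
  have "cf (distr (noise t) borel uminus) \<theta> = cf (noise t) (- \<theta>)"
    unfolding cf_def by (subst integral_distr) auto
  also have "\<dots> = cf (noise t) \<theta>"
    using linear_neg[OF adjoint_linear[OF linear_flow_at[OF less_imp_le[OF t]]]] by (simp add: cf_noise[OF t])
  finally show "cf (distr (noise t) borel uminus) \<theta> = cf (noise t) \<theta>" .
qed simp_all

text \<open>By stationarity \<open>flow t x + n\<close> has a second moment under the product law.
  By Fubini it has one in \<open>n\<close> for some fixed \<open>x\<close>, and removing the
  constant \<open>flow t x\<close> preserves this.\<close>

lemma integrable_noise_norm2:
  assumes t: "t > 0"
  shows "integrable (noise t) (\<lambda>n. (norm n)\<^sup>2)"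
proof -
  have t0: "t \<ge> 0" using t by simp
  interpret pair_prob_space "std_gaussian :: 'a measure" "noise t" by (rule pair_prob_space_noise[OF t0])
  note [measurable] = measurable_flow[OF t0]
  have m: "(\<lambda>(x, n). flow t x + n) \<in> std_gaussian \<Otimes>\<^sub>M noise t \<rightarrow>\<^sub>M borel" by measurable
  have "integrable (std_gaussian :: 'a measure) (\<lambda>x. (norm x)\<^sup>2)"
    by (rule integrable_std_gaussian_quadratic_bound(2)[where c=1]) auto
  then have "integrable (distr (std_gaussian \<Otimes>\<^sub>M noise t) borel (\<lambda>(x, n). flow t x + n)) (\<lambda>x. (norm x)\<^sup>2)"
    by (simp add: stationary[OF t])
  then have "integrable (std_gaussian \<Otimes>\<^sub>M noise t) (\<lambda>z. (norm (flow t (fst z) + snd z))\<^sup>2)"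
    by (subst (asm) integrable_distr_eq[OF m]) (auto simp: case_prod_beta')
  then have "AE x in std_gaussian. integrable (noise t) (\<lambda>n. (norm (flow t x + n))\<^sup>2)"
    by (drule_tac AE_integrable_fst') simp
  then have "\<exists>x. integrable (noise t) (\<lambda>n. (norm (flow t x + n))\<^sup>2)"
    using M1.AE_contr by (metis (mono_tags, lifting) eventually_mono)
  then obtain x where x: "integrable (noise t) (\<lambda>n. (norm (flow t x + n))\<^sup>2)" by blast
  then have i: "integrable (noise t) (\<lambda>n. 2 * (norm (flow t x + n))\<^sup>2 + 2 * (norm (flow t x))\<^sup>2)" by simp
  show ?thesis
  proof (rule Bochner_Integration.integrable_bound[OF i])
    show "AE n in noise t. norm ((norm n)\<^sup>2) \<le> norm (2 * (norm (flow t x + n))\<^sup>2 + 2 * (norm (flow t x))\<^sup>2)"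
    proof (rule AE_I2)
      fix n
      have "norm n \<le> norm (flow t x + n) + norm (flow t x)"
        using norm_triangle_ineq4[of "flow t x + n" "flow t x"] by simp
      then have "(norm n)\<^sup>2 \<le> (norm (flow t x + n) + norm (flow t x))\<^sup>2" by (intro power_mono) auto
      also have "\<dots> \<le> 2 * (norm (flow t x + n))\<^sup>2 + 2 * (norm (flow t x))\<^sup>2"
        using sum_squares_bound[of "norm (flow t x + n)" "norm (flow t x)"] by (simp add: power2_sum)
      finally show "norm ((norm n)\<^sup>2) \<le> norm (2 * (norm (flow t x + n))\<^sup>2 + 2 * (norm (flow t x))\<^sup>2)" by simp
    qed
  qed measurable
qed

lemma noise_inner:
  assumes t: "t > 0"
  shows "integrable (noise t) (\<lambda>n. a \<bullet> n)" "(\<integral>n. a \<bullet> n \<partial>noise t) = 0"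
proof -
  interpret N: prob_space "noise t" using t by (intro prob_space_noise) simp
  have "integrable (noise t) (\<lambda>n. norm a * (1 + (norm n)\<^sup>2))"
    using integrable_noise_norm2[OF t] by simp
  then show i: "integrable (noise t) (\<lambda>n. a \<bullet> n)"
  proof (rule Bochner_Integration.integrable_bound)
    show "AE n in noise t. norm (a \<bullet> n) \<le> norm (norm a * (1 + (norm n)\<^sup>2))"
      using abs_inner_le_quadratic[of a] by (auto intro!: AE_I2)
  qed measurable
  have "(\<integral>n. a \<bullet> n \<partial>noise t) = (\<integral>n. a \<bullet> n \<partial>distr (noise t) borel uminus)"
    by (simp add: noise_symmetric[OF t])
  also have "\<dots> = - (\<integral>n. a \<bullet> n \<partial>noise t)"
    by (subst integral_distr) auto
  finally show "(\<integral>n. a \<bullet> n \<partial>noise t) = 0" by simp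
qed

text \<open>Stationarity determines the additive constant.\<close>

lemma semigroup_quadratic:
  fixes Q :: "'a \<Rightarrow> 'a" and c :: 'a and k :: real
  assumes t: "t > 0" and Q: "linear Q"
  defines "w \<equiv> \<lambda>x. x \<bullet> Q x + c \<bullet> x"
  shows "markov_semigroup \<Omega> Y t (\<lambda>x. w x + k) x
    = w (flow t x) + k + (\<integral>x. w x \<partial>std_gaussian) - (\<integral>x. w (flow t x) \<partial>std_gaussian)"
proof -
  have t0: "t \<ge> 0" using t by simp
  interpret G: prob_space "std_gaussian :: 'a measure" by (rule prob_space_std_gaussian)
  interpret N: prob_space "noise t" by (rule prob_space_noise[OF t0])
  note [measurable] = borel_measurable_linear[OF Q] measurable_flow[OF t0]
  have [measurable]: "w \<in> borel_measurable borel" unfolding w_def by measurable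
  obtain q where q: "q \<ge> 0" "\<And>x y. \<bar>x \<bullet> Q y\<bar> \<le> q * norm x * norm y"
    using quadratic_form_bounds[OF Q] by metis
  have sq: "square_integrable std_gaussian (\<lambda>x. w x + k)" and iw: "integrable std_gaussian w"
    using std_gaussian_quadratic_integrable(1)[OF Q, of c k] std_gaussian_quadratic_integrable(2)[OF Q, of c 0]
    by (simp_all add: w_def)
  note lf = linear_flow_at[OF t0]
  have "linear (\<lambda>x. adjoint (flow t) (Q (flow t x)))"
    using linear_compose[OF linear_compose[OF lf Q] adjoint_linear[OF lf]] by (simp add: o_def)
  then have iwf: "integrable std_gaussian (\<lambda>x. w (flow t x))"
    using std_gaussian_quadratic_integrable(2)[of _ "adjoint (flow t) c" 0]
    by (fastforce simp: w_def adjoint_clauses[OF lf])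
  \<comment> \<open>The noise enters through this number alone. It is eliminated at the end by
    taking Gaussian means, so the covariance of the noise is never computed.\<close>
  define \<kappa> where "\<kappa> = (\<integral>n. n \<bullet> Q n \<partial>noise t)"
  have iq: "integrable (noise t) (\<lambda>n. n \<bullet> Q n)"
  proof (rule Bochner_Integration.integrable_bound)
    show "integrable (noise t) (\<lambda>n. q * (norm n)\<^sup>2)" using integrable_noise_norm2[OF t] by simp
    show "AE n in noise t. norm (n \<bullet> Q n) \<le> norm (q * (norm n)\<^sup>2)"
    proof (rule AE_I2)
      fix n show "norm (n \<bullet> Q n) \<le> norm (q * (norm n)\<^sup>2)"
        using q(2)[of n n] q(1) by (simp add: power2_eq_square abs_mult mult.assoc)
    qed
  qed measurable
  have P: "markov_semigroup \<Omega> Y t (\<lambda>x. w x + k) x = w (flow t x) + k + \<kappa>" for x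
  proof -
    let ?a = "adjoint Q (flow t x) + Q (flow t x) + c"
    have "markov_semigroup \<Omega> Y t (\<lambda>x. w x + k) x = (\<integral>n. w (flow t x + n) + k \<partial>noise t)"
      by (rule markov_semigroup_eq[OF t0]) measurable
    also have "\<dots> = (\<integral>n. (w (flow t x) + k) + n \<bullet> Q n + ?a \<bullet> n \<partial>noise t)"
      unfolding w_def
      by (intro Bochner_Integration.integral_cong refl)
         (simp add: linear_add[OF Q] inner_add_left inner_add_right adjoint_clauses[OF Q] inner_commute)
    also have "\<dots> = (w (flow t x) + k) + \<kappa> + 0"
      using iq noise_inner[OF t, of ?a] by (simp add: \<kappa>_def N.prob_space[unfolded space_noise])
    finally show ?thesis by simp
  qed
  have "(\<integral>x. markov_semigroup \<Omega> Y t (\<lambda>x. w x + k) x * 1 \<partial>std_gaussian) = (\<integral>z. (w (snd z) + k) * 1 \<partial>joint t)"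
    by (rule semigroup_pairing(2)[OF t sq]) (simp add: square_integrable_def)
  also have "\<dots> = (\<integral>x. w x + k \<partial>distr (joint t) borel snd)"
    by (subst integral_distr) auto
  also have "\<dots> = (\<integral>x. w x + k \<partial>std_gaussian)" by (simp only: joint_marginals[OF t])
  finally have "(\<integral>x. w (flow t x) + (k + \<kappa>) \<partial>std_gaussian) = (\<integral>x. w x + k \<partial>std_gaussian)"
    by (simp add: P add.assoc)
  then have "(\<integral>x. w (flow t x) \<partial>std_gaussian) + \<kappa> = (\<integral>x. w x \<partial>std_gaussian)"
    using iw iwf by (simp add: G.prob_space[unfolded space_std_gaussian])
  then show ?thesis unfolding P by simp
qed

text \<open>The sum over the basis bounds the operator norm of the error of the difference quotient,
  which makes the later estimates uniform in \<open>x\<close> up to powers of its norm.\<close>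

lemma flow_difference_quotient:
  "((\<lambda>t. \<Sum>b\<in>Basis. norm ((1 / t) *\<^sub>R (flow t b - b) - B b)) \<longlongrightarrow> 0) (at_right 0)"
proof -
  have "((\<lambda>t. norm ((1 / t) *\<^sub>R (flow t b - b) - B b)) \<longlongrightarrow> 0) (at_right 0)" for b
  proof -
    have "((\<lambda>s. flow s b) has_vector_derivative B (flow 0 b)) (at 0 within {0..1})"
      by (rule linear_flow_derivative[OF flow]) auto
    then have "((\<lambda>s. (1 / norm (s - 0)) *\<^sub>R (flow s b - (flow 0 b + (s - 0) *\<^sub>R B (flow 0 b)))) \<longlongrightarrow> 0) (at 0 within {0..1})"
      unfolding has_vector_derivative_def has_derivative_within by blast
    then have "((\<lambda>s. (1 / \<bar>s\<bar>) *\<^sub>R (flow s b - (b + s *\<^sub>R B b))) \<longlongrightarrow> 0) (at_right 0)"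
      by (simp add: linear_flow_zero[OF flow] at_within_Icc_at_right)
    moreover have "\<forall>\<^sub>F s in at_right 0. (1 / \<bar>s\<bar>) *\<^sub>R (flow s b - (b + s *\<^sub>R B b)) = (1 / s) *\<^sub>R (flow s b - b) - B b"
      using eventually_at_right_less[of 0] by eventually_elim (simp add: algebra_simps)
    ultimately have "((\<lambda>s. (1 / s) *\<^sub>R (flow s b - b) - B b) \<longlongrightarrow> 0) (at_right 0)"
      by (rule Lim_transform_eventually)
    then show ?thesis by (rule tendsto_norm_zero)
  qed
  then have "((\<lambda>t. \<Sum>b\<in>Basis. norm ((1 / t) *\<^sub>R (flow t b - b) - B b)) \<longlongrightarrow> (\<Sum>b\<in>(Basis::'a set). 0)) (at_right 0)"
    by (intro tendsto_sum)
  then show ?thesis by simp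
qed

text \<open>The second order part of the generator sends a quadratic polynomial to a constant. By
  stationarity the image has mean zero, so this constant is minus the mean of the transport term
  \<open>Dw\<close>, and no trace has to be evaluated.\<close>

lemma generator_quadratic:
  fixes Q :: "'a \<Rightarrow> 'a" and c :: 'a and k :: real
  assumes Q: "linear Q"
  defines "Dw \<equiv> \<lambda>x. B x \<bullet> Q x + x \<bullet> Q (B x) + c \<bullet> B x"
  shows "generator \<Omega> Y std_gaussian (\<lambda>x. x \<bullet> Q x + c \<bullet> x + k) (\<lambda>x. Dw x - (\<integral>x. Dw x \<partial>std_gaussian))"
proof -
  define w where "w = (\<lambda>x. x \<bullet> Q x + c \<bullet> x)"
  interpret G: prob_space "std_gaussian :: 'a measure" by (rule prob_space_std_gaussian)
  have G1: "measure (std_gaussian :: 'a measure) UNIV = 1" using G.prob_space by simp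
  note [measurable] = borel_measurable_linear[OF Q] borel_measurable_linear[OF linB]
  have [measurable]: "w \<in> borel_measurable borel" "Dw \<in> borel_measurable borel" unfolding w_def Dw_def by measurable
  obtain q where q: "q \<ge> 0" "\<And>x y. \<bar>x \<bullet> Q y\<bar> \<le> q * norm x * norm y"
    using quadratic_form_bounds[OF Q] by metis
  obtain \<beta> where \<beta>: "\<beta> \<ge> 0" "\<And>x. norm (B x) \<le> \<beta> * norm x"
    using quadratic_form_bounds[OF linB] by metis
  have nx: "norm x \<le> 1 + (norm x)\<^sup>2" "(norm x)\<^sup>2 \<le> 1 + (norm x)\<^sup>2" "1 \<le> 1 + (norm x)\<^sup>2" for x :: 'a
    using norm_le_one_plus_square[of x] by simp_all
  have cb: "\<bar>c \<bullet> y\<bar> \<le> norm c * m * (1 + (norm x)\<^sup>2)" if "norm y \<le> m * norm x" "m \<ge> 0" for x y :: 'a and m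
  proof -
    have "\<bar>c \<bullet> y\<bar> \<le> norm c * norm y" by (rule Cauchy_Schwarz_ineq2)
    also have "\<dots> \<le> norm c * (m * (1 + (norm x)\<^sup>2))"
      using that nx(1)[of x] by (intro mult_left_mono order_trans[OF that(1)]) auto
    finally show ?thesis by (simp add: mult.assoc)
  qed
  have qb: "\<bar>y \<bullet> Q z\<bar> \<le> q * (m * m') * (1 + (norm x)\<^sup>2)"
    if "norm y \<le> m * norm x" "norm z \<le> m' * norm x" "m \<ge> 0" "m' \<ge> 0" for x y z :: 'a and m m'
  proof -
    have "\<bar>y \<bullet> Q z\<bar> \<le> q * (norm y * norm z)" using q(2)[of y z] by (simp add: mult.assoc)
    also have "\<dots> \<le> q * ((m * norm x) * (m' * norm x))"
      using that q(1) by (intro mult_left_mono mult_mono) auto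
    also have "\<dots> = q * (m * m') * (norm x)\<^sup>2" by (simp add: power2_eq_square)
    also have "\<dots> \<le> q * (m * m') * (1 + (norm x)\<^sup>2)" using that q(1) by (intro mult_left_mono) auto
    finally show ?thesis .
  qed
  have "linear (\<lambda>x. adjoint B (Q x) + Q (B x))"
    using linear_compose_add[OF linear_compose[OF Q adjoint_linear[OF linB]] linear_compose[OF linB Q]] by (simp add: o_def)
  from std_gaussian_quadratic_integrable[OF this, of "adjoint B c"]
  have Dk: "square_integrable std_gaussian (\<lambda>x. Dw x + k')" "integrable std_gaussian (\<lambda>x. Dw x + k')" for k'
    by (simp_all add: Dw_def inner_add_right adjoint_clauses[OF linB])
  have iD: "integrable std_gaussian Dw" using Dk(2)[of 0] by simp
  define C1 where "C1 = (\<integral>x. 1 + (norm x)\<^sup>2 \<partial>(std_gaussian :: 'a measure))"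
  have iC: "integrable (std_gaussian :: 'a measure) (\<lambda>x. 1 + (norm x)\<^sup>2)"
    by (rule integrable_std_gaussian_quadratic_bound(2)[where c=1]) auto
  have C1: "C1 \<ge> 0" unfolding C1_def by simp
  define C2 where "C2 = (\<integral>x. (1 + (norm x)\<^sup>2)\<^sup>2 \<partial>(std_gaussian :: 'a measure))"
  have iC2: "integrable (std_gaussian :: 'a measure) (\<lambda>x. (1 + (norm x)\<^sup>2)\<^sup>2)"
    using integrable_std_gaussian_quadratic_bound(1)[of "\<lambda>x::'a. 1 + (norm x)\<^sup>2" 1] by (simp add: square_integrable_def)
  have iw: "integrable std_gaussian w"
    using std_gaussian_quadratic_integrable(2)[OF Q, of c 0] by (simp add: w_def)
  define \<eta> where "\<eta> t = (\<Sum>b\<in>Basis. norm ((1 / t) *\<^sub>R (flow t b - b) - B b))" for t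
  have \<eta>0: "\<eta> t \<ge> 0" for t unfolding \<eta>_def by (simp add: sum_nonneg)
  \<comment> \<open>Collects the errors: \<open>2 * q * \<eta> t\<close> from the two cross terms
    with the remainder \<open>r\<close>, the term with factor \<open>t\<close> from the quadratic
    form of the increment, and \<open>norm c * \<eta> t\<close> from the linear part.\<close>
  define \<epsilon> where "\<epsilon> t = 2 * q * \<eta> t + t * (q * ((\<beta> + \<eta> t) * (\<beta> + \<eta> t))) + norm c * \<eta> t" for t
  have \<eta>lim: "(\<eta> \<longlongrightarrow> 0) (at_right 0)"
    unfolding \<eta>_def[abs_def] by (rule flow_difference_quotient)
  have "(\<epsilon> \<longlongrightarrow> 2 * q * 0 + 0 * (q * ((\<beta> + 0) * (\<beta> + 0))) + norm c * 0) (at_right 0)"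
    unfolding \<epsilon>_def[abs_def] by (intro tendsto_intros \<eta>lim)
  then have \<epsilon>lim: "(\<epsilon> \<longlongrightarrow> 0) (at_right 0)" by simp
  define D where "D t x = (w (flow t x) - w x) / t - Dw x" for t x
  have Dbound: "\<bar>D t x\<bar> \<le> \<epsilon> t * (1 + (norm x)\<^sup>2)" if t: "t > 0" for t x
  proof -
    define r where "r = (1 / t) *\<^sub>R (flow t x - x) - B x"
    have lf: "linear (flow t)" using t by (intro linear_flow_at) simp
    have rn: "norm r \<le> \<eta> t * norm x"
    proof -
      have "r = (\<Sum>b\<in>Basis. (x \<bullet> b) *\<^sub>R ((1 / t) *\<^sub>R (flow t b - b) - B b))"
      proof -
        have "linear (\<lambda>x. (1 / t) *\<^sub>R (flow t x - x) - B x)"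
          by (intro linear_compose_sub linear_compose_scale_right lf linB linear_id[unfolded id_def])
        from linear_sum[OF this, of "\<lambda>b. (x \<bullet> b) *\<^sub>R b" Basis] linear_cmul[OF this]
        show ?thesis unfolding r_def by (simp add: euclidean_representation)
      qed
      also have "norm \<dots> \<le> (\<Sum>b\<in>Basis. norm ((1 / t) *\<^sub>R (flow t b - b) - B b) * norm x)"
      proof (rule sum_norm_le)
        fix b :: 'a assume b: "b \<in> Basis"
        show "norm ((x \<bullet> b) *\<^sub>R ((1 / t) *\<^sub>R (flow t b - b) - B b)) \<le> norm ((1 / t) *\<^sub>R (flow t b - b) - B b) * norm x"
          using mult_right_mono[OF Basis_le_norm[OF b, of x] norm_ge_zero[of "(1 / t) *\<^sub>R (flow t b - b) - B b"]]
          by (simp add: mult.commute)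
      qed
      finally show ?thesis unfolding \<eta>_def by (simp add: sum_distrib_right)
    qed
    have fl: "flow t x = x + t *\<^sub>R (B x + r)" using t by (simp add: r_def algebra_simps)
    have "w (flow t x) - w x = t * ((B x + r) \<bullet> Q x + x \<bullet> Q (B x + r) + c \<bullet> (B x + r) + t * ((B x + r) \<bullet> Q (B x + r)))"
      unfolding fl w_def linear_add[OF Q, of x] linear_cmul[OF Q]
      by (simp only: inner_add_left[of x] inner_add_right[of _ x] inner_scaleR_left inner_scaleR_right) (simp add: algebra_simps)
    then have "D t x = r \<bullet> Q x + x \<bullet> Q r + t * ((B x + r) \<bullet> Q (B x + r)) + c \<bullet> r"
      unfolding D_def Dw_def using t by (simp add: linear_add[OF Q] inner_add_left inner_add_right)
    then have "\<bar>D t x\<bar> \<le> \<bar>r \<bullet> Q x\<bar> + \<bar>x \<bullet> Q r\<bar> + t * \<bar>(B x + r) \<bullet> Q (B x + r)\<bar> + \<bar>c \<bullet> r\<bar>"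
      using t abs_mult[of t "(B x + r) \<bullet> Q (B x + r)"] by linarith
    also have "\<dots> \<le> q * (\<eta> t * 1) * (1 + (norm x)\<^sup>2) + q * (1 * \<eta> t) * (1 + (norm x)\<^sup>2)
        + t * (q * ((\<beta> + \<eta> t) * (\<beta> + \<eta> t)) * (1 + (norm x)\<^sup>2)) + norm c * \<eta> t * (1 + (norm x)\<^sup>2)"
    proof -
      have Br: "norm (B x + r) \<le> (\<beta> + \<eta> t) * norm x"
        using norm_triangle_ineq[of "B x" r] \<beta>(2)[of x] rn by (simp add: distrib_right)
      show ?thesis
        using \<eta>0[of t] \<beta>(1) t rn Br
        by (intro add_mono mult_left_mono qb cb) auto
    qed
    also have "\<dots> = \<epsilon> t * (1 + (norm x)\<^sup>2)"
      unfolding \<epsilon>_def by (simp add: algebra_simps)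
    finally show ?thesis .
  qed
  have \<epsilon>0: "\<epsilon> t \<ge> 0" if "t > 0" for t
    unfolding \<epsilon>_def using that q(1) \<eta>0 \<beta>(1) by (intro add_nonneg_nonneg mult_nonneg_nonneg) auto
  have bound: "(\<integral>\<^sup>+x. ennreal (((markov_semigroup \<Omega> Y t (\<lambda>x. w x + k) x - (w x + k)) / t - (Dw x - (\<integral>x. Dw x \<partial>std_gaussian)))\<^sup>2) \<partial>std_gaussian)
      \<le> ennreal ((\<epsilon> t * (1 + C1))\<^sup>2 * C2)" if t: "t > 0" for t
  proof -
    note [measurable] = measurable_flow[OF less_imp_le[OF t]]
    have [measurable]: "D t \<in> borel_measurable borel" unfolding D_def by measurable
    have iDt: "integrable std_gaussian (D t)"
      by (rule integrable_std_gaussian_quadratic_bound(2)[OF _ Dbound[OF t]]) measurable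
    have iwf: "integrable std_gaussian (\<lambda>x. w (flow t x))"
    proof -
      have "integrable std_gaussian (\<lambda>x. t * (D t x + Dw x) + w x)"
        using iDt iD iw by simp
      moreover have "t * (D t x + Dw x) + w x = w (flow t x)" for x using t by (simp add: D_def)
      ultimately show ?thesis by simp
    qed
    have ED: "(\<integral>x. D t x \<partial>std_gaussian) = ((\<integral>x. w (flow t x) \<partial>std_gaussian) - (\<integral>x. w x \<partial>std_gaussian)) / t - (\<integral>x. Dw x \<partial>std_gaussian)"
      unfolding D_def using iwf iw iD by simp
    \<comment> \<open>The mean corrections in \<open>semigroup_quadratic\<close> and in the claimed
      image combine, so that the error is \<open>D t\<close> minus its mean.\<close>
    have eq: "(markov_semigroup \<Omega> Y t (\<lambda>x. w x + k) x - (w x + k)) / t - (Dw x - (\<integral>x. Dw x \<partial>std_gaussian)) = D t x - (\<integral>x. D t x \<partial>std_gaussian)" for x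
    proof -
      have "markov_semigroup \<Omega> Y t (\<lambda>x. w x + k) x
        = w (flow t x) + k + (\<integral>x. w x \<partial>std_gaussian) - (\<integral>x. w (flow t x) \<partial>std_gaussian)"
        using semigroup_quadratic[OF t Q, of c k x] by (simp add: w_def)
      then show ?thesis
        using ED by (simp add: D_def diff_divide_distrib add_divide_distrib)
    qed
    have "\<bar>\<integral>x. D t x \<partial>std_gaussian\<bar> \<le> (\<integral>x. \<bar>D t x\<bar> \<partial>std_gaussian)" by (rule integral_abs_bound)
    also have "\<dots> \<le> (\<integral>x. \<epsilon> t * (1 + (norm x)\<^sup>2) \<partial>(std_gaussian :: 'a measure))"
      using iDt iC by (intro Bochner_Integration.integral_mono Dbound t) auto
    also have "\<dots> = \<epsilon> t * C1" by (simp add: C1_def)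
    finally have m: "\<bar>\<integral>x. D t x \<partial>std_gaussian\<bar> \<le> \<epsilon> t * C1" .
    have "(D t x - (\<integral>x. D t x \<partial>std_gaussian))\<^sup>2 \<le> (\<epsilon> t * (1 + C1))\<^sup>2 * (1 + (norm x)\<^sup>2)\<^sup>2" for x
    proof -
      have "\<epsilon> t * C1 * 1 \<le> \<epsilon> t * C1 * (1 + (norm x)\<^sup>2)"
        using \<epsilon>0[OF t] C1 by (intro mult_left_mono) auto
      then have "\<bar>D t x - (\<integral>x. D t x \<partial>std_gaussian)\<bar> \<le> \<epsilon> t * (1 + C1) * (1 + (norm x)\<^sup>2)"
        using Dbound[OF t, of x] m by (simp add: algebra_simps)
      from power_mono[OF this abs_ge_zero, of 2] show ?thesis by (simp add: power_mult_distrib)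
    qed
    then have "(\<integral>\<^sup>+x. ennreal ((D t x - (\<integral>x. D t x \<partial>std_gaussian))\<^sup>2) \<partial>std_gaussian)
       \<le> (\<integral>\<^sup>+x. ennreal ((\<epsilon> t * (1 + C1))\<^sup>2 * (1 + (norm x)\<^sup>2)\<^sup>2) \<partial>(std_gaussian :: 'a measure))"
      by (intro nn_integral_mono ennreal_leI)
    also have "\<dots> = ennreal (\<integral>x. (\<epsilon> t * (1 + C1))\<^sup>2 * (1 + (norm x)\<^sup>2)\<^sup>2 \<partial>(std_gaussian :: 'a measure))"
      using iC2 by (intro nn_integral_eq_integral) auto
    also have "\<dots> = ennreal ((\<epsilon> t * (1 + C1))\<^sup>2 * C2)" by (simp add: C2_def)
    finally show ?thesis unfolding eq .
  qed
  have "((\<lambda>t. ennreal ((\<epsilon> t * (1 + C1))\<^sup>2 * C2)) \<longlongrightarrow> ennreal ((0 * (1 + C1))\<^sup>2 * C2)) (at_right 0)"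
    by (intro tendsto_intros \<epsilon>lim)
  then have z: "((\<lambda>t. ennreal ((\<epsilon> t * (1 + C1))\<^sup>2 * C2)) \<longlongrightarrow> 0) (at_right 0)" by simp
  show ?thesis
    unfolding generator_def
  proof (intro conjI)
    show "square_integrable std_gaussian (\<lambda>x. x \<bullet> Q x + c \<bullet> x + k)"
      by (rule std_gaussian_quadratic_integrable(1)[OF Q])
    show "square_integrable std_gaussian (\<lambda>x. Dw x - (\<integral>x. Dw x \<partial>std_gaussian))"
      using Dk(1)[of "- (\<integral>x. Dw x \<partial>std_gaussian)"] by simp
    show "((\<lambda>t. \<integral>\<^sup>+x. ennreal (((markov_semigroup \<Omega> Y t (\<lambda>x. x \<bullet> Q x + c \<bullet> x + k) x - (x \<bullet> Q x + c \<bullet> x + k)) / t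
       - (Dw x - (\<integral>x. Dw x \<partial>std_gaussian)))\<^sup>2) \<partial>std_gaussian) \<longlongrightarrow> 0) (at_right 0)"
      using bound unfolding w_def
      by (intro tendsto_sandwich[OF _ _ tendsto_const z])
         (auto intro!: eventually_mono[OF eventually_at_right_less[of 0]])
  qed
qed

end

subsection \<open>Gaussian covariances and Neumann series\<close>

text \<open>Wick's formula: centring the second factor removes the product of the traces and the
  constant \<open>k\<close>, vanishing odd moments remove the mixed terms, and the two remaining
  pairings contribute equally.\<close>

lemma std_gaussian_quadratic_covariance:
  fixes Q R :: "'a::euclidean_space \<Rightarrow> 'a" and c d :: 'a and k :: real
  assumes Q: "linear Q" and R: "linear R" and symR: "\<And>x y. R x \<bullet> y = x \<bullet> R y"
  shows "(\<integral>x. (x \<bullet> Q x + c \<bullet> x + k) * (x \<bullet> R x + d \<bullet> x - (\<integral>x. x \<bullet> R x + d \<bullet> x \<partial>std_gaussian)) \<partial>std_gaussian)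
    = 2 * (\<Sum>b\<in>Basis. Q b \<bullet> R b) + c \<bullet> d"
proof -
  interpret G: prob_space "std_gaussian :: 'a measure" by (rule prob_space_std_gaussian)
  have G1: "measure (std_gaussian :: 'a measure) UNIV = 1" using G.prob_space by simp
  have quad: "x \<bullet> A x = (\<Sum>i\<in>Basis. \<Sum>j\<in>Basis. (i \<bullet> A j) * ((i \<bullet> x) * (j \<bullet> x)))" if "linear A" for A :: "'a \<Rightarrow> 'a" and x
  proof -
    have "A x = (\<Sum>j\<in>Basis. (x \<bullet> j) *\<^sub>R A j)"
      using linear_sum[OF that, of "\<lambda>b. (x \<bullet> b) *\<^sub>R b" Basis] linear_cmul[OF that]
      by (simp add: euclidean_representation)
    then have "x \<bullet> A x = (\<Sum>i\<in>Basis. (x \<bullet> i) * ((\<Sum>j\<in>Basis. (x \<bullet> j) *\<^sub>R A j) \<bullet> i))"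
      by (subst euclidean_inner) simp
    then show ?thesis
      by (simp add: inner_sum_left inner_sum_right sum_distrib_left inner_commute ac_simps)
  qed
  \<comment> \<open>The trace of \<open>A\<close>, in the form of a double sum in which the second
    moments produce it.\<close>
  let ?t = "\<lambda>A :: 'a \<Rightarrow> 'a. \<Sum>i\<in>Basis. \<Sum>j\<in>Basis. (i \<bullet> A j) * (i \<bullet> j)"
  have m2: "has_bochner_integral std_gaussian (\<lambda>x. x \<bullet> A x) (?t A)" if "linear A" for A :: "'a \<Rightarrow> 'a"
    unfolding quad[OF that] by (intro has_bochner_integral_sum has_bochner_integral_mult_right std_gaussian_moment2)
  have m3: "has_bochner_integral std_gaussian (\<lambda>x. (x \<bullet> A x) * (a \<bullet> x)) 0" if "linear A" for A :: "'a \<Rightarrow> 'a" and a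
  proof -
    have "has_bochner_integral std_gaussian (\<lambda>x. \<Sum>i\<in>Basis. \<Sum>j\<in>Basis. (i \<bullet> A j) * ((i \<bullet> x) * (j \<bullet> x) * (a \<bullet> x)))
       (\<Sum>i\<in>(Basis::'a set). \<Sum>j\<in>(Basis::'a set). (i \<bullet> A j) * 0)"
      by (intro has_bochner_integral_sum has_bochner_integral_mult_right std_gaussian_moment3)
    then show ?thesis unfolding quad[OF that] by (simp add: sum_distrib_right mult.assoc)
  qed
  have m4: "has_bochner_integral std_gaussian (\<lambda>x. (x \<bullet> Q x) * (x \<bullet> R x)) (?t Q * ?t R + 2 * (\<Sum>b\<in>Basis. Q b \<bullet> R b))"
  proof -
    have "has_bochner_integral std_gaussian
      (\<lambda>x. \<Sum>i\<in>Basis. \<Sum>j\<in>Basis. \<Sum>k\<in>Basis. \<Sum>l\<in>Basis. (i \<bullet> Q j) * (k \<bullet> R l) * ((i \<bullet> x) * (j \<bullet> x) * (k \<bullet> x) * (l \<bullet> x)))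
      (\<Sum>i\<in>Basis. \<Sum>j\<in>Basis. \<Sum>k\<in>Basis. \<Sum>l\<in>Basis. (i \<bullet> Q j) * (k \<bullet> R l) * ((i \<bullet> j) * (k \<bullet> l) + (i \<bullet> k) * (j \<bullet> l) + (i \<bullet> l) * (j \<bullet> k)))"
      by (intro has_bochner_integral_sum has_bochner_integral_mult_right std_gaussian_moment4)
    moreover have "(\<Sum>i\<in>Basis. \<Sum>j\<in>Basis. \<Sum>k\<in>Basis. \<Sum>l\<in>Basis. (i \<bullet> Q j) * (k \<bullet> R l) * ((i \<bullet> x) * (j \<bullet> x) * (k \<bullet> x) * (l \<bullet> x)))
       = (x \<bullet> Q x) * (x \<bullet> R x)" for x
      unfolding quad[OF Q] quad[OF R] by (simp only: sum_distrib_right) (simp only: sum_distrib_left ac_simps)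
    moreover have "(\<Sum>i\<in>Basis. \<Sum>j\<in>Basis. \<Sum>k\<in>Basis. \<Sum>l\<in>Basis. (i \<bullet> Q j) * (k \<bullet> R l) * ((i \<bullet> j) * (k \<bullet> l) + (i \<bullet> k) * (j \<bullet> l) + (i \<bullet> l) * (j \<bullet> k)))
      = ?t Q * ?t R + 2 * (\<Sum>b\<in>Basis. Q b \<bullet> R b)"
    proof -
      have d1: "(\<Sum>i\<in>Basis. \<Sum>j\<in>Basis. \<Sum>k\<in>Basis. \<Sum>l\<in>Basis. (i \<bullet> Q j) * (k \<bullet> R l) * ((i \<bullet> j) * (k \<bullet> l))) = ?t Q * ?t R"
        by (simp only: sum_distrib_right) (simp only: sum_distrib_left ac_simps)
      have del: "(\<Sum>l\<in>Basis. f l * (j \<bullet> l)) = f j" if "j \<in> Basis" for f and j :: 'a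
        using that by (simp add: inner_Basis if_distrib[where f="\<lambda>x. f _ * x"] sum.delta' cong: if_cong)
      have e: "(\<Sum>i\<in>Basis. \<Sum>j\<in>Basis. (i \<bullet> Q j) * (i \<bullet> R j)) = (\<Sum>b\<in>Basis. Q b \<bullet> R b)"
        by (subst sum.swap) (simp add: euclidean_inner[of "Q _" "R _"] inner_commute)
      have d2: "(\<Sum>i\<in>Basis. \<Sum>j\<in>Basis. \<Sum>k\<in>Basis. \<Sum>l\<in>Basis. (i \<bullet> Q j) * (k \<bullet> R l) * ((i \<bullet> k) * (j \<bullet> l))) = (\<Sum>b\<in>Basis. Q b \<bullet> R b)"
      proof -
        have "(\<Sum>k\<in>Basis. \<Sum>l\<in>Basis. (i \<bullet> Q j) * (k \<bullet> R l) * ((i \<bullet> k) * (j \<bullet> l))) = (i \<bullet> Q j) * (i \<bullet> R j)"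
          if ij: "i \<in> Basis" "j \<in> Basis" for i j
        proof -
          have "(\<Sum>k\<in>Basis. \<Sum>l\<in>Basis. (i \<bullet> Q j) * (k \<bullet> R l) * ((i \<bullet> k) * (j \<bullet> l)))
            = (\<Sum>k\<in>Basis. (\<Sum>l\<in>Basis. ((i \<bullet> Q j) * (k \<bullet> R l)) * (j \<bullet> l)) * (i \<bullet> k))"
            by (simp add: sum_distrib_left ac_simps)
          then show ?thesis by (simp only: del ij)
        qed
        then show ?thesis by (simp add: e)
      qed
      \<comment> \<open>This pairing exchanges the two indices of \<open>R\<close>, hence the use of
        \<open>symR\<close>.\<close>
      have d3: "(\<Sum>i\<in>Basis. \<Sum>j\<in>Basis. \<Sum>k\<in>Basis. \<Sum>l\<in>Basis. (i \<bullet> Q j) * (k \<bullet> R l) * ((i \<bullet> l) * (j \<bullet> k))) = (\<Sum>b\<in>Basis. Q b \<bullet> R b)"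
      proof -
        have "(\<Sum>k\<in>Basis. \<Sum>l\<in>Basis. (i \<bullet> Q j) * (k \<bullet> R l) * ((i \<bullet> l) * (j \<bullet> k))) = (i \<bullet> Q j) * (i \<bullet> R j)"
          if ij: "i \<in> Basis" "j \<in> Basis" for i j
        proof -
          have "(\<Sum>k\<in>Basis. \<Sum>l\<in>Basis. (i \<bullet> Q j) * (k \<bullet> R l) * ((i \<bullet> l) * (j \<bullet> k)))
            = (\<Sum>k\<in>Basis. (\<Sum>l\<in>Basis. ((i \<bullet> Q j) * (k \<bullet> R l)) * (i \<bullet> l)) * (j \<bullet> k))"
            by (simp add: sum_distrib_left ac_simps)
          then have "(\<Sum>k\<in>Basis. \<Sum>l\<in>Basis. (i \<bullet> Q j) * (k \<bullet> R l) * ((i \<bullet> l) * (j \<bullet> k))) = (i \<bullet> Q j) * (j \<bullet> R i)"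
            by (simp only: del ij)
          then show ?thesis using symR[of i j] by (simp add: inner_commute)
        qed
        then show ?thesis by (simp add: e)
      qed
      show ?thesis by (simp only: distrib_left sum.distrib d1 d2 d3)
    qed
    ultimately show ?thesis by simp
  qed
  have ER: "(\<integral>x. x \<bullet> R x + d \<bullet> x \<partial>std_gaussian) = ?t R"
    using has_bochner_integral_add[OF m2[OF R] std_gaussian_moment1[of d]] by (simp add: has_bochner_integral_iff)
  have h: "has_bochner_integral std_gaussian
     (\<lambda>x. ((x \<bullet> Q x) * (x \<bullet> R x) + (x \<bullet> Q x) * (d \<bullet> x) + (x \<bullet> R x) * (c \<bullet> x) + (c \<bullet> x) * (d \<bullet> x))
        + ((k * (x \<bullet> R x) + k * (d \<bullet> x)) - ?t R * (x \<bullet> Q x) - ?t R * (c \<bullet> x) - k * ?t R))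
     (((?t Q * ?t R + 2 * (\<Sum>b\<in>Basis. Q b \<bullet> R b)) + 0 + 0 + c \<bullet> d)
        + ((k * ?t R + k * 0) - ?t R * ?t Q - ?t R * 0 - k * ?t R))"
    by (intro has_bochner_integral_add has_bochner_integral_diff has_bochner_integral_mult_right
        m2 m3 m4 Q R std_gaussian_moment1 std_gaussian_moment2)
       (auto simp: has_bochner_integral_iff G1)
  have "(\<lambda>x. (x \<bullet> Q x + c \<bullet> x + k) * (x \<bullet> R x + d \<bullet> x - ?t R)) =
     (\<lambda>x. ((x \<bullet> Q x) * (x \<bullet> R x) + (x \<bullet> Q x) * (d \<bullet> x) + (x \<bullet> R x) * (c \<bullet> x) + (c \<bullet> x) * (d \<bullet> x))
        + ((k * (x \<bullet> R x) + k * (d \<bullet> x)) - ?t R * (x \<bullet> Q x) - ?t R * (c \<bullet> x) - k * ?t R))"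
    by (rule ext) algebra
  then show ?thesis using h unfolding ER by (simp add: has_bochner_integral_iff)
qed

text \<open>\<open>U \<mu>\<close> is the series of \<open>\<mu> ^ k *\<^sub>R (Q ^^ k) u0\<close>.
  Applying \<open>L\<close> termwise leaves a scalar power series, whose derivatives at 0 are read
  off from its coefficients; the factor 2 is 2!.\<close>

lemma Neumann_series_derivatives:
  fixes Q :: "'a::banach \<Rightarrow> 'a" and L :: "'a \<Rightarrow> real" and u0 :: 'a
  assumes Q: "bounded_linear Q" and L: "bounded_linear L"
  obtains \<delta> U D where "\<delta> > 0"
    "\<And>\<mu>. \<bar>\<mu>\<bar> < \<delta> \<Longrightarrow> U \<mu> = u0 + \<mu> *\<^sub>R Q (U \<mu>)"
    "\<And>\<mu>. \<bar>\<mu>\<bar> < \<delta> \<Longrightarrow> ((\<lambda>\<mu>. L (U \<mu>)) has_real_derivative D \<mu>) (at \<mu>)"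
    "D 0 = L (Q u0)" "(D has_real_derivative 2 * L (Q (Q u0))) (at 0)"
proof -
  obtain b where b: "b > 0" "\<And>x. norm (Q x) \<le> norm x * b" using bounded_linear.pos_bounded[OF Q] by blast
  define v where "v k = (Q ^^ k) u0" for k
  have vS: "v (Suc k) = Q (v k)" for k by (simp add: v_def)
  have vb: "norm (v k) \<le> b ^ k * norm u0" for k
  proof (induction k)
    case (Suc k)
    have "norm (v (Suc k)) \<le> norm (v k) * b" unfolding vS by (rule b)
    also have "\<dots> \<le> (b ^ k * norm u0) * b" using Suc b by (intro mult_right_mono) auto
    finally show ?case by (simp add: ac_simps)
  qed (simp add: v_def)
  \<comment> \<open>Since \<open>b\<close> bounds \<open>Q\<close>, the terms are dominated by a
    geometric series of ratio 1/2 for \<open>\<bar>\<mu>\<bar> \<le> \<delta>\<close>. The end point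
    is included because termwise differentiation inside the interval is justified by convergence at
    \<delta>.\<close>
  define \<delta> where "\<delta> = 1 / (2 * b)"
  have \<delta>: "\<delta> > 0" using b by (simp add: \<delta>_def)
  define U where "U \<mu> = (\<Sum>k. \<mu> ^ k *\<^sub>R v k)" for \<mu> :: real
  have sum: "summable (\<lambda>k. \<mu> ^ k *\<^sub>R v k)" if "\<bar>\<mu>\<bar> \<le> \<delta>" for \<mu>
  proof (rule summable_comparison_test'[where N=0])
    show "summable (\<lambda>k. (1 / 2) ^ k * norm u0)" by (intro summable_mult2 summable_geometric) simp
    fix k
    have "\<bar>\<mu>\<bar> * b \<le> 1 / 2" using that b by (simp add: \<delta>_def field_simps)
    then have "(\<bar>\<mu>\<bar> * b) ^ k \<le> (1 / 2) ^ k" using b by (intro power_mono) auto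
    then have "(\<bar>\<mu>\<bar> * b) ^ k * norm u0 \<le> (1 / 2) ^ k * norm u0" by (rule mult_right_mono) simp
    moreover have "norm (\<mu> ^ k *\<^sub>R v k) \<le> \<bar>\<mu>\<bar> ^ k * (b ^ k * norm u0)"
      by (simp add: power_abs mult_left_mono vb)
    ultimately show "norm (\<mu> ^ k *\<^sub>R v k) \<le> (1 / 2) ^ k * norm u0" by (simp add: power_mult_distrib mult.assoc)
  qed
  have fixpoint: "U \<mu> = u0 + \<mu> *\<^sub>R Q (U \<mu>)" if "\<bar>\<mu>\<bar> < \<delta>" for \<mu>
  proof -
    note s = sum[OF less_imp_le[OF that]]
    have "\<mu> *\<^sub>R Q (U \<mu>) = (\<Sum>k. \<mu> *\<^sub>R Q (\<mu> ^ k *\<^sub>R v k))"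
      unfolding U_def bounded_linear.suminf[OF Q s]
      by (rule bounded_linear.suminf[OF bounded_linear_scaleR_right bounded_linear.summable[OF Q s]])
    also have "\<dots> = (\<Sum>k. \<mu> ^ Suc k *\<^sub>R v (Suc k))"
      using linear_cmul[OF bounded_linear.linear[OF Q]] by (simp add: vS)
    also have "\<dots> = U \<mu> - u0" unfolding U_def using suminf_split_head[OF s] by (simp add: v_def)
    finally show ?thesis by simp
  qed
  define c where "c k = L (v k)" for k
  have cs: "summable (\<lambda>k. c k * \<mu> ^ k)" "L (U \<mu>) = (\<Sum>k. c k * \<mu> ^ k)" if "\<bar>\<mu>\<bar> \<le> \<delta>" for \<mu>
    using bounded_linear.summable[OF L sum[OF that]] bounded_linear.suminf[OF L sum[OF that]]
      linear_cmul[OF bounded_linear.linear[OF L]]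
    by (simp_all add: c_def U_def mult.commute)
  define D where "D \<mu> = (\<Sum>k. diffs c k * \<mu> ^ k)" for \<mu>
  have s\<delta>: "summable (\<lambda>k. c k * \<delta> ^ k)" using cs(1)[of \<delta>] \<delta> by simp
  have der: "((\<lambda>\<mu>. L (U \<mu>)) has_real_derivative D \<mu>) (at \<mu>)" if \<mu>: "\<bar>\<mu>\<bar> < \<delta>" for \<mu>
  proof -
    have "((\<lambda>x. \<Sum>k. c k * x ^ k) has_real_derivative D \<mu>) (at \<mu>)"
      unfolding D_def using \<mu> \<delta> by (intro termdiffs_strong[OF s\<delta>]) simp
    moreover have "\<forall>\<^sub>F x in nhds \<mu>. (\<Sum>k. c k * x ^ k) = L (U x)"
    proof -
      have "\<forall>\<^sub>F x in nhds \<mu>. x \<in> {-\<delta><..<\<delta>}" using \<mu> by (intro eventually_nhds_in_open) auto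
      then show ?thesis by eventually_elim (use cs(2) in auto)
    qed
    ultimately show ?thesis by (metis DERIV_cong_ev)
  qed
  \<comment> \<open>The differentiated series converges strictly inside the first interval; half the
    radius is enough for the second derivative at 0.\<close>
  have dd: "summable (\<lambda>k. diffs c k * (\<delta> / 2) ^ k)"
    using \<delta> cs(1) by (intro termdiff_converges[of "\<delta> / 2" \<delta>]) auto
  have D2: "(D has_real_derivative (\<Sum>k. diffs (diffs c) k * 0 ^ k)) (at 0)"
    unfolding D_def using \<delta> by (intro termdiffs_strong[OF dd]) simp
  show ?thesis
  proof (rule that[OF \<delta> fixpoint der])
    show "D 0 = L (Q u0)" unfolding D_def powser_zero by (simp add: diffs_def c_def v_def)
    show "(D has_real_derivative 2 * L (Q (Q u0))) (at 0)"
      using D2 unfolding powser_zero by (simp add: diffs_def c_def v_def numeral_2_eq_2)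
  qed
qed

subsection \<open>The Poisson equation in normalised coordinates\<close>

text \<open>Links the product measure in the definition of the asymptotic variance with the standard
  Gaussian of the phase space, on which the stochastic equation is analysed.\<close>

lemma pair_std_gaussian:
  "(std_gaussian :: 'a::euclidean_space measure) \<Otimes>\<^sub>M (std_gaussian :: 'b::euclidean_space measure) = std_gaussian"
proof (rule cf_uniqueness)
  have "pair_prob_space (std_gaussian :: 'a measure) (std_gaussian :: 'b measure)"
    using prob_space_std_gaussian[where 'a='a] prob_space_std_gaussian[where 'a='b]
    by (simp add: pair_prob_space_def pair_sigma_finite_def prob_space_imp_sigma_finite)
  then interpret pair_prob_space "std_gaussian :: 'a measure" "std_gaussian :: 'b measure" .
  interpret G: prob_space "std_gaussian :: ('a \<times> 'b) measure" by (rule prob_space_std_gaussian)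
  show "finite_measure ((std_gaussian :: 'a measure) \<Otimes>\<^sub>M (std_gaussian :: 'b measure))" by (rule P.finite_measure_axioms)
  show "finite_measure (std_gaussian :: ('a \<times> 'b) measure)" by (rule G.finite_measure_axioms)
  show "sets ((std_gaussian :: 'a measure) \<Otimes>\<^sub>M (std_gaussian :: 'b measure)) = sets borel"
    by (simp add: borel_prod[symmetric] cong: sets_pair_measure_cong)
  fix \<theta> :: "'a \<times> 'b"
  obtain a b where \<theta>: "\<theta> = (a, b)" by (cases \<theta>)
  have i: "integrable ((std_gaussian :: 'a measure) \<Otimes>\<^sub>M (std_gaussian :: 'b measure)) (\<lambda>(x, y). iexp (a \<bullet> x) * iexp (b \<bullet> y))"
    by (rule P.integrable_const_bound[where B=1]) (auto simp: norm_mult)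
  have "cf ((std_gaussian :: 'a measure) \<Otimes>\<^sub>M (std_gaussian :: 'b measure)) \<theta>
    = (CLINT z|std_gaussian \<Otimes>\<^sub>M std_gaussian. (\<lambda>(x, y). iexp (a \<bullet> x) * iexp (b \<bullet> y)) z)"
    unfolding cf_def \<theta>
    by (intro Bochner_Integration.integral_cong refl) (auto simp: inner_prod_def exp_add[symmetric] algebra_simps)
  also have "\<dots> = (CLINT x|std_gaussian. CLINT y|std_gaussian. iexp (a \<bullet> x) * iexp (b \<bullet> y))"
    by (subst integral_fst'[OF i, symmetric]) simp
  also have "\<dots> = cf std_gaussian a * cf std_gaussian b" unfolding cf_def by simp
  also have "\<dots> = cf std_gaussian \<theta>"
    unfolding cf_std_gaussian \<theta> of_real_mult[symmetric] exp_add[symmetric] by (simp add: field_simps)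
  finally show "cf ((std_gaussian :: 'a measure) \<Otimes>\<^sub>M (std_gaussian :: 'b measure)) \<theta> = cf std_gaussian \<theta>" .
qed simp

lemma integrable_of_square_integrable_std_gaussian:
  assumes "square_integrable std_gaussian f"
  shows "integrable std_gaussian f"
proof -
  interpret prob_space "std_gaussian :: 'a measure" by (rule prob_space_std_gaussian)
  show ?thesis using assms unfolding square_integrable_def by (blast intro: square_integrable_imp_integrable)
qed

section \<open>Linear algebra of the normalised drift and the quadratic ansatz\<close>

lemma skew_symmetric_inner:
  fixes J :: "real ^ 'n ^ 'n"
  assumes "skew_symmetric_matrix J"
  shows "(J *v x) \<bullet> y = - (x \<bullet> (J *v y))" "x \<bullet> (J *v x) = 0"
proof -
  have *: "(J *v x) \<bullet> y = - (x \<bullet> (J *v y))" for x y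
  proof -
    have "(J *v x) \<bullet> y = x \<bullet> (transpose J *v y)"
      by (metis dot_lmul_matrix inner_commute transpose_matrix_vector)
    also have "transpose J *v y = - (J *v y)"
      using assms unfolding skew_symmetric_matrix_def by (metis scaleR_matrix_vector_assoc scaleR_minus1_left)
    finally show ?thesis by simp
  qed
  then show "(J *v x) \<bullet> y = - (x \<bullet> (J *v y))" .
  show "x \<bullet> (J *v x) = 0" using *[of x x] by (simp add: inner_commute)
qed

lemma symmetric_inner:
  fixes A :: "real ^ 'n ^ 'n"
  assumes "symmetric_matrix A"
  shows "(A *v x) \<bullet> y = x \<bullet> (A *v y)"
  using assms by (metis dot_lmul_matrix inner_commute transpose_matrix_vector symmetric_matrix_def)

definition drift :: "real ^ 'n ^ 'n \<Rightarrow> real \<Rightarrow> real \<Rightarrow> (real ^ 'n) \<times> (real ^ 'n) \<Rightarrow> (real ^ 'n) \<times> (real ^ 'n)" where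
  "drift J \<gamma> \<mu> x = (snd x - \<mu> *\<^sub>R (J *v fst x), - fst x - \<mu> *\<^sub>R (J *v snd x) - \<gamma> *\<^sub>R snd x)"

definition momentum_noise :: "real \<Rightarrow> real ^ 'n \<Rightarrow> (real ^ 'n) \<times> (real ^ 'n)" where
  "momentum_noise c w = (0, c *\<^sub>R w)"

definition momentum_flip :: "(real ^ 'n) \<times> (real ^ 'n) \<Rightarrow> (real ^ 'n) \<times> (real ^ 'n)" where
  "momentum_flip x = (fst x, - snd x)"

text \<open>The block matrix with rows \<open>(E, F)\<close> and \<open>(F, G)\<close>. For
  symmetric blocks it represents the form
  \<open>q \<bullet> E q + 2 (q \<bullet> F p) + p \<bullet> G p\<close>.\<close>

definition quad_map :: "real ^ 'n ^ 'n \<Rightarrow> real ^ 'n ^ 'n \<Rightarrow> real ^ 'n ^ 'n \<Rightarrow> (real ^ 'n) \<times> (real ^ 'n) \<Rightarrow> (real ^ 'n) \<times> (real ^ 'n)" where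
  "quad_map E F G x = (E *v fst x + F *v snd x, F *v fst x + G *v snd x)"

lemma linear_drift: "linear (drift J \<gamma> \<mu>)"
  by (rule linearI) (simp_all add: drift_def algebra_simps matrix_vector_right_distrib scaleR_add_right matrix_vector_mult_scaleR)

lemma linear_momentum_noise: "linear (momentum_noise c)"
  by (rule linearI) (simp_all add: momentum_noise_def algebra_simps)

lemma linear_momentum_flip: "linear momentum_flip"
  by (rule linearI) (simp_all add: momentum_flip_def)

lemma linear_quad_map: "linear (quad_map E F G)"
  by (rule linearI) (simp_all add: quad_map_def matrix_vector_right_distrib scaleR_add_right matrix_vector_mult_scaleR algebra_simps)

lemma adjoint_momentum_noise: "adjoint (momentum_noise c) = (\<lambda>x. c *\<^sub>R snd x)"
  by (rule adjoint_unique) (simp add: momentum_noise_def inner_prod_def)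

lemma adjoint_drift:
  fixes J :: "real ^ 'n ^ 'n"
  assumes "skew_symmetric_matrix J"
  shows "adjoint (drift J \<gamma> \<mu>) = (\<lambda>x. (- snd x + \<mu> *\<^sub>R (J *v fst x), fst x + \<mu> *\<^sub>R (J *v snd x) - \<gamma> *\<^sub>R snd x))"
proof (rule adjoint_unique, intro allI)
  fix x y :: "(real ^ 'n) \<times> (real ^ 'n)"
  show "drift J \<gamma> \<mu> x \<bullet> y = x \<bullet> (- snd y + \<mu> *\<^sub>R (J *v fst y), fst y + \<mu> *\<^sub>R (J *v snd y) - \<gamma> *\<^sub>R snd y)"
    unfolding drift_def inner_prod_def
    by (simp add: inner_add_left inner_add_right inner_diff_left inner_diff_right skew_symmetric_inner(1)[OF assms])
qed

lemma drift_lyapunov: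
  assumes "skew_symmetric_matrix J" "\<gamma> \<ge> 0"
  shows "\<theta> \<bullet> drift J \<gamma> \<mu> \<theta> = - (adjoint (momentum_noise (sqrt (2 * \<gamma>))) \<theta> \<bullet> adjoint (momentum_noise (sqrt (2 * \<gamma>))) \<theta>) / 2"
  unfolding adjoint_momentum_noise
  using assms(2) by (simp add: drift_def inner_prod_def inner_diff_right skew_symmetric_inner[OF assms(1)] inner_commute
     real_sqrt_mult[symmetric])

text \<open>The adjoint reverses both antisymmetric parts of the drift, the exchange of position and
  momentum and the part with \<open>J\<close>. The flip restores the former, so in effect only the
  sign of \<mu> changes.\<close>

lemma drift_reversal:
  assumes "skew_symmetric_matrix J"
  shows "drift J \<gamma> (- \<mu>) x = momentum_flip (adjoint (drift J \<gamma> \<mu>) (momentum_flip x))"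
  unfolding adjoint_drift[OF assms] drift_def momentum_flip_def
  by (simp add: linear_neg[OF matrix_vector_mul_linear])

lemma quad_map_symmetric:
  assumes "symmetric_matrix E" "symmetric_matrix F" "symmetric_matrix G"
  shows "quad_map E F G x \<bullet> y = x \<bullet> quad_map E F G y"
  by (simp add: quad_map_def inner_prod_def inner_add_left inner_add_right assms[THEN symmetric_inner])

text \<open>Comparison of coefficients in the Poisson equation: \<open>1\<close>, \<open>2\<close>
  and \<open>3\<close> are the terms of type \<open>q q\<close>, \<open>q p\<close> and
  \<open>p p\<close>, while \<open>4\<close> and \<open>5\<close> are the terms linear in
  \<open>q\<close> and in \<open>p\<close>. The commutators arise when the forms that contain
  \<open>J\<close> are symmetrised.\<close>

lemma quad_map_drift:
  fixes J E F G K :: "real ^ 'n ^ 'n" and a b l :: "real ^ 'n"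
  assumes J: "skew_symmetric_matrix J"
    and sym: "symmetric_matrix E" "symmetric_matrix F" "symmetric_matrix G"
    and 1: "2 *\<^sub>R F + \<mu> *\<^sub>R (E ** J - J ** E) = K"
    and 2: "E = \<gamma> *\<^sub>R F + G + \<mu> *\<^sub>R (F ** J - J ** F)"
    and 3: "2 *\<^sub>R F = (2 * \<gamma>) *\<^sub>R G + \<mu> *\<^sub>R (G ** J - J ** G)"
    and 4: "b = l + \<mu> *\<^sub>R (J *v a)"
    and 5: "a = \<gamma> *\<^sub>R b - \<mu> *\<^sub>R (J *v b)"
  defines "B \<equiv> drift J \<gamma> \<mu>" and "Q \<equiv> quad_map E F G"
  shows "B x \<bullet> Q x + x \<bullet> Q (B x) + (a, b) \<bullet> B x = - (fst x \<bullet> (K *v fst x) + l \<bullet> fst x)"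
proof -
  obtain q p where x: "x = (q, p)" by (cases x)
  have comm: "y \<bullet> ((A ** J - J ** A) *v z) = (A *v y) \<bullet> (J *v z) + (J *v y) \<bullet> (A *v z)"
    if "symmetric_matrix A" for A y z
    using symmetric_inner[OF that, of y "J *v z"] skew_symmetric_inner(1)[OF J, of y "A *v z"]
    by (simp add: matrix_vector_mult_diff_rdistrib matrix_vector_mul_assoc[symmetric] inner_diff_right)
  have s: "(A *v y) \<bullet> z = y \<bullet> (A *v z)" if "symmetric_matrix A" for A and y z :: "real^'n"
    by (rule symmetric_inner[OF that])
  have e1: "q \<bullet> (K *v q) = 2 * (q \<bullet> (F *v q)) + \<mu> * (2 * ((J *v q) \<bullet> (E *v q)))"
    unfolding 1[symmetric] matrix_vector_mult_add_rdistrib scaleR_matrix_vector_assoc[symmetric] inner_add_right inner_scaleR_right comm[OF sym(1)]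
    by (simp add: inner_commute)
  have e2: "p \<bullet> (E *v q) = \<gamma> * (p \<bullet> (F *v q)) + p \<bullet> (G *v q) + \<mu> * ((F *v p) \<bullet> (J *v q) + (J *v p) \<bullet> (F *v q))"
    by (subst 2) (simp add: matrix_vector_mult_add_rdistrib scaleR_matrix_vector_assoc[symmetric] inner_add_right comm[OF sym(2)])
  have e3: "2 * (p \<bullet> (F *v p)) = 2 * \<gamma> * (p \<bullet> (G *v p)) + \<mu> * (2 * ((J *v p) \<bullet> (G *v p)))"
  proof -
    have "p \<bullet> ((2 *\<^sub>R F) *v p) = 2 * \<gamma> * (p \<bullet> (G *v p)) + \<mu> * (2 * ((J *v p) \<bullet> (G *v p)))"
      by (subst 3) (simp add: matrix_vector_mult_add_rdistrib scaleR_matrix_vector_assoc[symmetric] inner_add_right comm[OF sym(3)] inner_commute)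
    then show ?thesis by (simp add: scaleR_matrix_vector_assoc[symmetric])
  qed
  have e4: "b \<bullet> q = l \<bullet> q - \<mu> * (a \<bullet> (J *v q))"
    by (subst 4) (simp add: inner_add_left skew_symmetric_inner[OF J])
  have e5: "a \<bullet> p = \<gamma> * (b \<bullet> p) + \<mu> * (b \<bullet> (J *v p))"
    by (subst 5) (simp add: inner_diff_left skew_symmetric_inner[OF J])
  have symQ: "B x \<bullet> Q x = x \<bullet> Q (B x)"
    unfolding Q_def using quad_map_symmetric[OF sym, of "B x" x] by (simp add: inner_commute)
  have "B x \<bullet> Q x = p \<bullet> (E *v q) + p \<bullet> (F *v p) - \<mu> * ((J *v q) \<bullet> (E *v q)) - \<mu> * ((J *v q) \<bullet> (F *v p))
      - q \<bullet> (F *v q) - q \<bullet> (G *v p) - \<mu> * ((J *v p) \<bullet> (F *v q)) - \<mu> * ((J *v p) \<bullet> (G *v p))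
      - \<gamma> * (p \<bullet> (F *v q)) - \<gamma> * (p \<bullet> (G *v p))"
    unfolding B_def Q_def x drift_def quad_map_def
    by (simp add: inner_prod_def inner_add_left inner_add_right inner_diff_left inner_diff_right algebra_simps)
  moreover have "q \<bullet> (G *v p) = p \<bullet> (G *v q)" "(J *v q) \<bullet> (F *v p) = (F *v p) \<bullet> (J *v q)"
    using s[OF sym(3), of q p] by (simp_all add: inner_commute)
  ultimately have "2 * (B x \<bullet> Q x) = - (q \<bullet> (K *v q))"
    using e1 e2 e3 by (simp add: algebra_simps)
  moreover have "(a, b) \<bullet> B x = - (l \<bullet> q)"
    unfolding B_def x drift_def using e4 e5
    by (simp add: inner_prod_def inner_diff_right algebra_simps)
  ultimately show ?thesis unfolding symQ[symmetric] by (simp add: x)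
qed

text \<open>The inner product of matrices is the entrywise one. The observable involves positions
  only, so among the blocks of the solution only \<open>E\<close> contributes to the
  covariance.\<close>

lemma quad_map_trace_inner:
  fixes E F G K :: "real ^ 'n ^ 'n"
  shows "(\<Sum>b\<in>Basis. quad_map E F G b \<bullet> quad_map K 0 0 b) = E \<bullet> K"
proof -
  have B: "(Basis :: (real ^ 'n) set) = range (\<lambda>i. axis i 1)" by (auto simp: Basis_vec_def)
  have inj: "inj (\<lambda>i::'n. axis i (1::real))" by (auto simp: inj_def axis_eq_axis)
  have disj: "((\<lambda>u. (u, 0)) ` (Basis :: (real^'n) set)) \<inter> ((\<lambda>u. (0, u)) ` (Basis :: (real^'n) set)) = {}"
    using nonzero_Basis by auto
  have "(\<Sum>b\<in>Basis. quad_map E F G b \<bullet> quad_map K 0 0 b)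
    = (\<Sum>u\<in>Basis. quad_map E F G (u, 0) \<bullet> quad_map K 0 0 (u, 0)) + (\<Sum>u\<in>Basis. quad_map E F G (0, u) \<bullet> quad_map K 0 0 (0, u))"
    unfolding Basis_prod_def
    by (subst sum.union_disjoint[OF _ _ disj]) (auto simp: sum.reindex inj_on_def)
  also have "\<dots> = (\<Sum>u\<in>Basis. (E *v u) \<bullet> (K *v u))"
    by (simp add: quad_map_def inner_prod_def)
  also have "\<dots> = (\<Sum>i\<in>UNIV. (E *v axis i 1) \<bullet> (K *v axis i 1))"
    unfolding B by (subst sum.reindex[OF inj]) simp
  also have "\<dots> = (\<Sum>i\<in>UNIV. \<Sum>j\<in>UNIV. E $ j $ i * K $ j $ i)"
    by (simp add: matrix_vector_mult_basis column_def inner_vec_def)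
  also have "\<dots> = E \<bullet> K"
    by (subst sum.swap) (simp add: inner_vec_def)
  finally show ?thesis .
qed

text \<open>The momentum flip of the dynamics with parameter \<open>- \<mu>\<close> is the time reversal of the dynamics with
  parameter \<open>\<mu>\<close>. Hence the pairing of any solution of the Poisson equation with the observable is
  determined by the explicit quadratic solution for \<open>- \<mu>\<close>.\<close>

lemma asymptotic_variance_quadratic:
  fixes J K :: "real ^ 'n ^ 'n" and l :: "real ^ 'n" and Y :: "real \<Rightarrow> (real ^ 'n) \<times> (real ^ 'n) \<Rightarrow> real \<Rightarrow> 'w \<Rightarrow> (real ^ 'n) \<times> (real ^ 'n)"
    and E F G :: "real \<Rightarrow> real ^ 'n ^ 'n" and a b :: "real \<Rightarrow> real ^ 'n"
  assumes J: "skew_symmetric_matrix J" and K: "symmetric_matrix K" and \<gamma>: "\<gamma> \<ge> 0"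
    and sde: "\<And>\<mu>. linear_sde \<Omega> W (drift J \<gamma> \<mu>) (momentum_noise (sqrt (2 * \<gamma>))) (Y \<mu>)"
    and sym: "\<And>\<nu>. \<nu> \<in> {\<mu>, - \<mu>} \<Longrightarrow> symmetric_matrix (E \<nu>) \<and> symmetric_matrix (F \<nu>) \<and> symmetric_matrix (G \<nu>)"
    and 1: "\<And>\<nu>. \<nu> \<in> {\<mu>, - \<mu>} \<Longrightarrow> 2 *\<^sub>R F \<nu> + \<nu> *\<^sub>R (E \<nu> ** J - J ** E \<nu>) = K"
    and 2: "\<And>\<nu>. \<nu> \<in> {\<mu>, - \<mu>} \<Longrightarrow> E \<nu> = \<gamma> *\<^sub>R F \<nu> + G \<nu> + \<nu> *\<^sub>R (F \<nu> ** J - J ** F \<nu>)"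
    and 3: "\<And>\<nu>. \<nu> \<in> {\<mu>, - \<mu>} \<Longrightarrow> 2 *\<^sub>R F \<nu> = (2 * \<gamma>) *\<^sub>R G \<nu> + \<nu> *\<^sub>R (G \<nu> ** J - J ** G \<nu>)"
    and 4: "\<And>\<nu>. \<nu> \<in> {\<mu>, - \<mu>} \<Longrightarrow> b \<nu> = l + \<nu> *\<^sub>R (J *v a \<nu>)"
    and 5: "\<And>\<nu>. \<nu> \<in> {\<mu>, - \<mu>} \<Longrightarrow> a \<nu> = \<gamma> *\<^sub>R b \<nu> - \<nu> *\<^sub>R (J *v b \<nu>)"
  shows "asymptotic_variance \<Omega> (Y \<mu>) std_gaussian std_gaussian (\<lambda>q. q \<bullet> (K *v q) + l \<bullet> q + C)
    = 2 * (E \<mu> \<bullet> K) + a \<mu> \<bullet> l"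
proof -
  let ?f = "\<lambda>q. q \<bullet> (K *v q) + l \<bullet> q + C"
  let ?R = "quad_map K 0 0" and ?G = "std_gaussian :: ((real ^ 'n) \<times> (real ^ 'n)) measure"
  interpret G: prob_space ?G by (rule prob_space_std_gaussian)
  interpret Gq: prob_space "std_gaussian :: (real ^ 'n) measure" by (rule prob_space_std_gaussian)
  have G1: "measure ?G UNIV = 1" using G.prob_space by simp
  interpret R: reversible_pair \<Omega> W "drift J \<gamma> \<mu>" "momentum_noise (sqrt (2 * \<gamma>))" "Y \<mu>"
      \<Omega> W "drift J \<gamma> (- \<mu>)" "momentum_noise (sqrt (2 * \<gamma>))" "Y (- \<mu>)" momentum_flip
    by (intro reversible_pair.intro reversible_pair_axioms.intro sde linear_momentum_flip drift_reversal[OF J])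
       (simp_all add: momentum_flip_def inner_prod_def)
  have Rx: "x \<bullet> ?R x + (l, 0) \<bullet> x = fst x \<bullet> (K *v fst x) + l \<bullet> fst x" for x
    by (simp add: quad_map_def inner_prod_def)
  have symR: "?R x \<bullet> y = x \<bullet> ?R y" for x y
    by (simp add: quad_map_def inner_prod_def symmetric_inner[OF K])
  define m where "m = (\<integral>x. x \<bullet> ?R x + (l, 0) \<bullet> x \<partial>?G)"
  have [measurable]: "(*v) K \<in> borel_measurable borel"
    by (intro borel_measurable_continuous_onI continuous_intros)
  have fm [measurable]: "?f \<in> borel_measurable borel" by measurable
  have iR: "integrable ?G (\<lambda>x. x \<bullet> ?R x + (l, 0) \<bullet> x)"
  proof -
    have "square_integrable ?G (\<lambda>x. x \<bullet> ?R x + (l, 0) \<bullet> x + 0)"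
      using R.S1.generator_quadratic[OF linear_quad_map, of K 0 0 "(l, 0)" 0] unfolding generator_def by blast
    then show ?thesis unfolding add_0_right by (rule integrable_of_square_integrable_std_gaussian)
  qed
  have mean: "(\<integral>q. ?f q \<partial>std_gaussian) = m + C"
  proof -
    have "distr ?G std_gaussian fst = (std_gaussian :: (real^'n) measure)"
      unfolding pair_std_gaussian[symmetric] by (rule Gq.distr_pair_fst)
    then have "(\<integral>q. ?f q \<partial>std_gaussian) = (\<integral>q. ?f q \<partial>distr ?G std_gaussian fst)" by simp
    also have "\<dots> = (\<integral>x. ?f (fst x) \<partial>?G)"
    proof (rule integral_distr)
      show "fst \<in> ?G \<rightarrow>\<^sub>M (std_gaussian :: (real^'n) measure)"
        unfolding pair_std_gaussian[symmetric] by (rule measurable_fst)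
    qed measurable
    also have "\<dots> = (\<integral>x. (x \<bullet> ?R x + (l, 0) \<bullet> x) + C \<partial>?G)" by (simp add: Rx)
    also have "\<dots> = m + C" unfolding m_def using iR by (simp add: G1)
    finally show ?thesis .
  qed
  define \<phi> where "\<phi> x = ?f (fst x) - (\<integral>q. ?f q \<partial>std_gaussian)" for x :: "(real ^ 'n) \<times> (real ^ 'n)"
  have \<phi>R: "\<phi> x = x \<bullet> ?R x + (l, 0) \<bullet> x - m" for x
    unfolding \<phi>_def mean by (simp add: Rx)
  have [measurable]: "\<phi> \<in> borel_measurable borel"
    unfolding \<phi>R[abs_def] using borel_measurable_linear[OF linear_quad_map[of K 0 0]] by measurable
  have \<phi>flip: "\<phi> (momentum_flip x) = \<phi> x" for x by (simp add: \<phi>_def momentum_flip_def)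
  define u0 where "u0 \<nu> x = x \<bullet> quad_map (E \<nu>) (F \<nu>) (G \<nu>) x + (a \<nu>, b \<nu>) \<bullet> x" for \<nu> x
  \<comment> \<open>Subtracting the mean gives the mean-zero normalisation; an additive constant
    does not affect the image under the generator.\<close>
  define u where "u \<nu> x = u0 \<nu> x + - (\<integral>x. u0 \<nu> x \<partial>?G)" for \<nu> x
  have sol: "poisson_solution \<Omega> (Y \<nu>) ?G \<phi> (u \<nu>)" if \<nu>: "\<nu> \<in> {\<mu>, - \<mu>}" for \<nu>
  proof -
    interpret S: linear_sde \<Omega> W "drift J \<gamma> \<nu>" "momentum_noise (sqrt (2 * \<gamma>))" "Y \<nu>" by (rule sde)
    let ?Q = "quad_map (E \<nu>) (F \<nu>) (G \<nu>)"
    have D: "drift J \<gamma> \<nu> x \<bullet> ?Q x + x \<bullet> ?Q (drift J \<gamma> \<nu> x) + (a \<nu>, b \<nu>) \<bullet> drift J \<gamma> \<nu> x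
       = - (x \<bullet> ?R x + (l, 0) \<bullet> x)" for x
      unfolding Rx using sym[OF \<nu>] by (intro quad_map_drift J 1 2 3 4 5 \<nu>) auto
    have "generator \<Omega> (Y \<nu>) ?G (\<lambda>x. x \<bullet> ?Q x + (a \<nu>, b \<nu>) \<bullet> x + k)
       (\<lambda>x. - (x \<bullet> ?R x + (l, 0) \<bullet> x) - (\<integral>x. - (x \<bullet> ?R x + (l, 0) \<bullet> x) \<partial>?G))" for k
      using S.generator_quadratic[OF linear_quad_map, of "E \<nu>" "F \<nu>" "G \<nu>" "(a \<nu>, b \<nu>)" k] unfolding D .
    moreover have "(\<lambda>x. - (x \<bullet> ?R x + (l, 0) \<bullet> x) - (\<integral>x. - (x \<bullet> ?R x + (l, 0) \<bullet> x) \<partial>?G)) = (\<lambda>x. - \<phi> x)"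
      unfolding \<phi>R m_def integral_minus by (simp only: minus_diff_eq) auto
    ultimately have g: "generator \<Omega> (Y \<nu>) ?G (\<lambda>x. u0 \<nu> x + k) (\<lambda>x. - \<phi> x)" for k
      by (simp only: u0_def)
    have "integrable ?G (u0 \<nu>)"
      using g[of 0] unfolding generator_def add_0_right by (blast intro: integrable_of_square_integrable_std_gaussian)
    then have "(\<integral>x. u \<nu> x \<partial>?G) = 0" unfolding u_def by (simp add: G1)
    then show ?thesis using g[of "- (\<integral>x. u0 \<nu> x \<partial>?G)"] by (simp add: poisson_solution_def u_def[abs_def])
  qed
  \<comment> \<open>The Gaussian and \<open>\<phi>\<close> are invariant under the flip, which
    absorbs the flips in \<open>generator_duality\<close>. Applied to \<open>u \<mu>\<close>, the
    claim also equates the explicit values for \<mu> and -\<mu>.\<close>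
  have val: "(\<integral>x. v x * \<phi> x \<partial>?G) = (\<integral>x. u (- \<mu>) x * \<phi> x \<partial>?G)" if "poisson_solution \<Omega> (Y \<mu>) ?G \<phi> v" for v
  proof -
    have gv: "generator \<Omega> (Y \<mu>) ?G v (\<lambda>x. - \<phi> x)" and gu: "generator \<Omega> (Y (- \<mu>)) ?G (u (- \<mu>)) (\<lambda>x. - \<phi> x)"
      using that sol[of "- \<mu>"] by (simp_all add: poisson_solution_def)
    have "v \<in> borel_measurable borel" "u (- \<mu>) \<in> borel_measurable borel"
      using gv gu by (auto simp: generator_def intro: square_integrable_std_gaussianD)
    then have [measurable]: "v \<in> borel_measurable borel" "u (- \<mu>) \<in> borel_measurable borel" .
    have "(\<integral>x. v x * \<phi> x \<partial>?G) = (\<integral>x. v (momentum_flip x) * \<phi> (momentum_flip x) \<partial>?G)"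
      by (rule R.integral_F[symmetric]) measurable
    also have "\<dots> = - (\<integral>x. - \<phi> x * v (momentum_flip x) \<partial>?G)"
      by (simp add: \<phi>flip mult.commute)
    also have "\<dots> = - (\<integral>x. - \<phi> x * u (- \<mu>) (momentum_flip x) \<partial>?G)"
      by (simp only: R.generator_duality[OF gv gu])
    also have "\<dots> = (\<integral>x. u (- \<mu>) (momentum_flip x) * \<phi> (momentum_flip x) \<partial>?G)"
      by (simp add: \<phi>flip mult.commute)
    also have "\<dots> = (\<integral>x. u (- \<mu>) x * \<phi> x \<partial>?G)"
      by (rule R.integral_F) measurable
    finally show ?thesis .
  qed
  have cov: "(\<integral>x. u \<mu> x * \<phi> x \<partial>?G) = 2 * (E \<mu> \<bullet> K) + a \<mu> \<bullet> l"
    unfolding u_def u0_def \<phi>R m_def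
    by (rule trans[OF std_gaussian_quadratic_covariance[OF linear_quad_map linear_quad_map symR]])
       (simp add: quad_map_trace_inner)
  \<comment> \<open>Existence is witnessed by \<open>u \<mu>\<close>. For uniqueness an arbitrary
    solution and \<open>u \<mu>\<close> are both compared with \<open>u (- \<mu>)\<close>.\<close>
  show ?thesis
    unfolding asymptotic_variance_def Let_def \<phi>_def[symmetric] pair_std_gaussian
  proof (rule the_equality)
    show "\<exists>v. poisson_solution \<Omega> (Y \<mu>) ?G \<phi> v \<and> 2 * (E \<mu> \<bullet> K) + a \<mu> \<bullet> l = (\<integral>x. v x * \<phi> x \<partial>?G)"
      using sol[of \<mu>] cov by auto
  next
    fix c assume "\<exists>v. poisson_solution \<Omega> (Y \<mu>) ?G \<phi> v \<and> c = (\<integral>x. v x * \<phi> x \<partial>?G)"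
    then show "c = 2 * (E \<mu> \<bullet> K) + a \<mu> \<bullet> l"
      using val val[OF sol[of \<mu>]] cov by auto
  qed
qed

subsection \<open>Change of variables\<close>

text \<open>Under the image measure everything is evaluated at points \<open>D x\<close>, where the
  left inverse \<open>D'\<close> returns \<open>x\<close>; exchanging the two maps gives the
  converse direction for a bijection. Measurability of the semigroup serves to transform the
  nonnegative integrals.\<close>

lemma poisson_solution_transfer:
  fixes X :: "'x::euclidean_space \<Rightarrow> real \<Rightarrow> 'w \<Rightarrow> 'x" and D D' :: "'x \<Rightarrow> 'x" and \<phi> u :: "'x \<Rightarrow> real"
  assumes [measurable]: "D \<in> borel_measurable borel" "D' \<in> borel_measurable borel"
    and D'D: "\<And>x. D' (D x) = x"
    and sets [simp, measurable_cong]: "sets N = sets borel"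
    and meas: "\<And>t g. t > 0 \<Longrightarrow> g \<in> borel_measurable borel \<Longrightarrow> markov_semigroup \<Omega> X t g \<in> borel_measurable borel"
    and sol: "poisson_solution \<Omega> X N \<phi> u"
  shows "poisson_solution \<Omega> (\<lambda>y t \<omega>. D (X (D' y) t \<omega>)) (distr N borel D) (\<lambda>y. \<phi> (D' y)) (\<lambda>y. u (D' y))"
proof -
  have sq: "square_integrable N u" "square_integrable N (\<lambda>x. - \<phi> x)"
    and lim: "((\<lambda>t. \<integral>\<^sup>+x. ennreal (((markov_semigroup \<Omega> X t u x - u x) / t - - \<phi> x)\<^sup>2) \<partial>N) \<longlongrightarrow> 0) (at_right 0)"
    and z: "(\<integral>x. u x \<partial>N) = 0"
    using sol by (auto simp: poisson_solution_def generator_def)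
  have m: "u \<in> borel_measurable borel" "(\<lambda>x. - \<phi> x) \<in> borel_measurable borel"
    using sq by (auto simp: square_integrable_def measurable_cong_sets[OF sets refl])
  then have [measurable]: "u \<in> borel_measurable borel" "\<phi> \<in> borel_measurable borel"
    using borel_measurable_uminus_eq by blast+
  have semi: "markov_semigroup \<Omega> (\<lambda>y t \<omega>. D (X (D' y) t \<omega>)) t (\<lambda>y. u (D' y)) y = markov_semigroup \<Omega> X t u (D' y)" for t y
    by (simp add: markov_semigroup_def D'D)
  have mD: "D \<in> N \<rightarrow>\<^sub>M borel" by measurable
  have "generator \<Omega> (\<lambda>y t \<omega>. D (X (D' y) t \<omega>)) (distr N borel D) (\<lambda>y. u (D' y)) (\<lambda>y. - \<phi> (D' y))"
    unfolding generator_def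
  proof (intro conjI)
    show "square_integrable (distr N borel D) (\<lambda>y. u (D' y))" "square_integrable (distr N borel D) (\<lambda>y. - \<phi> (D' y))"
      using sq by (simp_all add: square_integrable_def integrable_distr_eq D'D)
    have "\<forall>\<^sub>F t in at_right 0. (\<integral>\<^sup>+x. ennreal (((markov_semigroup \<Omega> X t u x - u x) / t - - \<phi> x)\<^sup>2) \<partial>N)
      = (\<integral>\<^sup>+y. ennreal (((markov_semigroup \<Omega> (\<lambda>y t \<omega>. D (X (D' y) t \<omega>)) t (\<lambda>y. u (D' y)) y - u (D' y)) / t - - \<phi> (D' y))\<^sup>2) \<partial>distr N borel D)"
      using eventually_at_right_less[of 0]
    proof eventually_elim
      case (elim t)
      have [measurable]: "markov_semigroup \<Omega> X t u \<in> borel_measurable borel" by (rule meas[OF elim]) measurable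
      show ?case unfolding semi by (subst nn_integral_distr[OF mD]) (simp_all add: D'D)
    qed
    from Lim_transform_eventually[OF lim this]
    show "((\<lambda>t. \<integral>\<^sup>+y. ennreal (((markov_semigroup \<Omega> (\<lambda>y t \<omega>. D (X (D' y) t \<omega>)) t (\<lambda>y. u (D' y)) y - u (D' y)) / t - - \<phi> (D' y))\<^sup>2) \<partial>distr N borel D) \<longlongrightarrow> 0) (at_right 0)" .
  qed
  moreover have "(\<integral>y. u (D' y) \<partial>distr N borel D) = 0"
    by (subst integral_distr[OF mD]) (simp_all add: D'D z)
  ultimately show ?thesis by (simp add: poisson_solution_def)
qed

text \<open>Solutions correspond under the change of variables, so both definite descriptions range
  over the same values. Measurability of the semigroup is assumed in the new variables, where the
  linear equation will provide it, and is carried back to \<open>X\<close>.\<close>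

lemma asymptotic_variance_transfer:
  fixes X :: "('a::euclidean_space) \<times> ('b::euclidean_space) \<Rightarrow> real \<Rightarrow> 'w \<Rightarrow> 'a \<times> 'b"
    and A A' :: "'a \<Rightarrow> 'a" and C C' :: "'b \<Rightarrow> 'b"
  assumes [measurable]: "A \<in> borel_measurable borel" "A' \<in> borel_measurable borel"
      "C \<in> borel_measurable borel" "C' \<in> borel_measurable borel" "f \<in> borel_measurable borel"
    and inv: "\<And>x. A (A' x) = x" "\<And>x. A' (A x) = x" "\<And>x. C (C' x) = x" "\<And>x. C' (C x) = x"
    and sets [simp, measurable_cong]: "sets \<pi> = sets borel" "sets \<kappa> = sets borel"
    and prob: "prob_space \<pi>" "prob_space \<kappa>"
    and meas: "\<And>t g. t > 0 \<Longrightarrow> g \<in> borel_measurable borel \<Longrightarrow>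
      markov_semigroup \<Omega> (\<lambda>y t \<omega>. map_prod A C (X (map_prod A' C' y) t \<omega>)) t g \<in> borel_measurable borel"
  shows "asymptotic_variance \<Omega> X \<pi> \<kappa> f
    = asymptotic_variance \<Omega> (\<lambda>y t \<omega>. map_prod A C (X (map_prod A' C' y) t \<omega>)) (distr \<pi> borel A) (distr \<kappa> borel C) (\<lambda>q. f (A' q))"
proof -
  interpret p: prob_space \<pi> by fact
  interpret k: prob_space \<kappa> by fact
  let ?D = "map_prod A C" and ?D' = "map_prod A' C'" and ?N = "\<pi> \<Otimes>\<^sub>M \<kappa>"
  let ?Y = "\<lambda>y t \<omega>. ?D (X (?D' y) t \<omega>)"
  have D: "?D (?D' y) = y" "?D' (?D x) = x" for x y by (simp_all add: inv prod.map_comp map_prod_def split_beta)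
  have mDD [measurable]: "?D \<in> borel_measurable borel" "?D' \<in> borel_measurable borel"
    unfolding map_prod_def borel_prod[symmetric] by measurable
  have sN [simp, measurable_cong]: "sets ?N = sets borel"
    by (simp add: borel_prod[symmetric] cong: sets_pair_measure_cong)
  have N': "distr \<pi> borel A \<Otimes>\<^sub>M distr \<kappa> borel C = distr ?N borel ?D"
  proof -
    have "sigma_finite_measure (distr \<kappa> borel C)"
      by (intro prob_space_imp_sigma_finite k.prob_space_distr) measurable
    then have "distr \<pi> borel A \<Otimes>\<^sub>M distr \<kappa> borel C = distr ?N (borel \<Otimes>\<^sub>M borel) (\<lambda>(x, y). (A x, C y))"
      by (intro pair_measure_distr) measurable
    then show ?thesis by (simp add: borel_prod map_prod_def)
  qed
  have mD: "?D \<in> ?N \<rightarrow>\<^sub>M borel" by measurable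
  have mX: "markov_semigroup \<Omega> X t g \<in> borel_measurable borel" if "t > 0" and [measurable]: "g \<in> borel_measurable borel" for t g
  proof -
    have [measurable]: "markov_semigroup \<Omega> ?Y t (\<lambda>y. g (?D' y)) \<in> borel_measurable borel"
      by (rule meas[OF that(1)]) measurable
    have "markov_semigroup \<Omega> X t g = (\<lambda>x. markov_semigroup \<Omega> ?Y t (\<lambda>y. g (?D' y)) (?D x))"
      by (simp add: fun_eq_iff markov_semigroup_def D)
    then show ?thesis by simp
  qed
  define \<phi> where "\<phi> x = f (fst x) - (\<integral>q. f q \<partial>\<pi>)" for x :: "'a \<times> 'b"
  have [measurable]: "(fst :: 'a \<times> 'b \<Rightarrow> 'a) \<in> borel_measurable borel"
    by (intro borel_measurable_continuous_onI continuous_intros)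
  have [measurable]: "\<phi> \<in> borel_measurable borel" unfolding \<phi>_def by measurable
  have \<phi>': "(\<lambda>x. f (A' (fst x)) - (\<integral>q. f (A' q) \<partial>distr \<pi> borel A)) = (\<lambda>y. \<phi> (?D' y))"
    by (subst integral_distr) (simp_all add: \<phi>_def inv)
  have "(\<exists>u. poisson_solution \<Omega> X ?N \<phi> u \<and> v = (\<integral>x. u x * \<phi> x \<partial>?N)) \<longleftrightarrow>
      (\<exists>u. poisson_solution \<Omega> ?Y (distr ?N borel ?D) (\<lambda>y. \<phi> (?D' y)) u \<and> v = (\<integral>y. u y * \<phi> (?D' y) \<partial>distr ?N borel ?D))" (is "?PX \<longleftrightarrow> ?PY") for v
  proof
    assume "?PX"
    then obtain u where u: "poisson_solution \<Omega> X ?N \<phi> u" "v = (\<integral>x. u x * \<phi> x \<partial>?N)" by blast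
    have "u \<in> borel_measurable borel"
      using u(1) by (simp add: poisson_solution_def generator_def square_integrable_def measurable_cong_sets[OF sN refl])
    then have [measurable]: "u \<in> borel_measurable borel" .
    have "poisson_solution \<Omega> ?Y (distr ?N borel ?D) (\<lambda>y. \<phi> (?D' y)) (\<lambda>y. u (?D' y))"
      by (rule poisson_solution_transfer[where D="?D" and D'="?D'" and X=X and N="?N" and u=u and \<phi>=\<phi> and \<Omega>=\<Omega>])
         (assumption | rule mDD D sN mX u(1))+
    moreover have "v = (\<integral>y. u (?D' y) * \<phi> (?D' y) \<partial>distr ?N borel ?D)"
      unfolding u(2) by (subst integral_distr[OF mD]) (simp_all add: D)
    ultimately show "?PY" by blast
  next
    assume "?PY"
    then obtain u where u: "poisson_solution \<Omega> ?Y (distr ?N borel ?D) (\<lambda>y. \<phi> (?D' y)) u"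
      "v = (\<integral>y. u y * \<phi> (?D' y) \<partial>distr ?N borel ?D)" by blast
    have "u \<in> borel_measurable borel"
      using u(1) by (simp add: poisson_solution_def generator_def square_integrable_def)
    then have [measurable]: "u \<in> borel_measurable borel" .
    have pull_back: "distr (distr ?N borel ?D) borel ?D' = ?N"
    proof -
      have "distr (distr ?N borel ?D) borel ?D' = distr ?N borel (?D' \<circ> ?D)"
        by (rule distr_distr) measurable
      also have "\<dots> = distr ?N ?N (\<lambda>x. x)" by (rule distr_cong) (simp_all only: D o_apply sN)
      finally show ?thesis by simp
    qed
    have "poisson_solution \<Omega> (\<lambda>x t \<omega>. ?D' (?Y (?D x) t \<omega>)) (distr (distr ?N borel ?D) borel ?D') (\<lambda>x. \<phi> (?D' (?D x))) (\<lambda>x. u (?D x))"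
      by (rule poisson_solution_transfer[where D="?D'" and D'="?D" and X="?Y" and N="distr ?N borel ?D" and u=u
            and \<phi>="\<lambda>y. \<phi> (?D' y)" and \<Omega>=\<Omega>])
         (assumption | rule mDD D sets_distr meas u(1))+
    then have "poisson_solution \<Omega> X ?N \<phi> (\<lambda>x. u (?D x))" unfolding pull_back by (simp add: D)
    moreover have "v = (\<integral>x. u (?D x) * \<phi> x \<partial>?N)"
      unfolding u(2) by (subst integral_distr[OF mD]) (simp_all add: D)
    ultimately show "?PX" by blast
  qed
  then show ?thesis
    unfolding asymptotic_variance_def Let_def N' \<phi>' \<phi>_def[symmetric] by simp
qed

lemma gradient_quadratic:
  fixes S :: "real ^ 'n ^ 'n"
  assumes "symmetric_matrix S"
  shows "gradient (\<lambda>q. 1 / 2 * (q \<bullet> (S *v q))) x = S *v x"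
  unfolding gradient_def
proof (rule the_equality)
  have "((\<lambda>q. 1 / 2 * (q \<bullet> (S *v q))) has_derivative (\<lambda>h. 1 / 2 * (x \<bullet> (S *v h) + h \<bullet> (S *v x)))) (at x)"
    by (intro derivative_intros bounded_linear_imp_has_derivative matrix_vector_mul_bounded_linear)
  moreover have "(\<lambda>h. 1 / 2 * (x \<bullet> (S *v h) + h \<bullet> (S *v x))) = (\<lambda>h. h \<bullet> (S *v x))"
    using symmetric_inner[OF assms] by (auto simp: inner_commute)
  ultimately show d: "GDERIV (\<lambda>q. 1 / 2 * (q \<bullet> (S *v q))) x :> S *v x" by (simp add: gderiv_def)
  fix D assume "GDERIV (\<lambda>q. 1 / 2 * (q \<bullet> (S *v q))) x :> D"
  then have "(\<lambda>h. h \<bullet> D) = (\<lambda>h. h \<bullet> (S *v x))"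
    using d unfolding gderiv_def by (rule has_derivative_unique)
  then show "D = S *v x" by (metis vector_eq_ldot)
qed

text \<open>From \<open>J2 = S ** J1 ** S\<close> it follows that
  \<open>P ** J2 ** matrix_inv S\<close> equals \<open>H ** J1\<close>, so in the new variables
  positions and momenta see the same matrix \<open>H ** J1 ** H\<close>. The noise simplifies
  because \<open>P *v (R *v w)\<close> is \<open>sqrt (2 * \<gamma>)\<close> times
  \<open>w\<close>.\<close>

lemma perturbed_langevin_linear_sde:
  fixes S H P J1 J2 :: "real ^ 'n ^ 'n"
  assumes bm: "standard_brownian_motion \<Omega> W"
    and dyn: "perturbed_langevin_dynamics \<Omega> W V S (\<gamma> *\<^sub>R S) R J1 J2 \<mu> X"
    and grad: "\<And>q. gradient V q = S *v q"
    and HP: "H ** P = mat 1" and S: "H ** H = S" and R: "R = sqrt (2 * \<gamma>) *\<^sub>R H"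
    and H: "symmetric_matrix H" and J1: "skew_symmetric_matrix J1" and J2: "S ** J1 ** S = J2" and \<gamma>: "\<gamma> \<ge> 0"
  shows "linear_sde \<Omega> W (drift (H ** J1 ** H) \<gamma> \<mu>) (momentum_noise (sqrt (2 * \<gamma>)))
    (\<lambda>y t \<omega>. map_prod ((*v) H) ((*v) P) (X (map_prod ((*v) P) ((*v) H) y) t \<omega>))"
proof (rule linear_sde.intro)
  have PH: "P ** H = mat 1" using HP matrix_left_right_inverse by blast
  have "S ** (P ** P) = H ** (H ** P) ** P" by (simp add: S[symmetric] matrix_mul_assoc)
  then have Si: "matrix_inv S = P ** P" by (intro matrix_inv_eqI) (simp add: HP)
  let ?J = "H ** J1 ** H"
  let ?D = "map_prod ((*v) H) ((*v) P)" and ?D' = "map_prod ((*v) P) ((*v) H)"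
  have sJ: "skew_symmetric_matrix ?J"
    using H J1 unfolding skew_symmetric_matrix_def symmetric_matrix_def
    by (simp add: matrix_transpose_mul matrix_mul_assoc matrix_mul_uminus)
  have v: "H *v (P *v z) = z" "P *v (H *v z) = z" "S *v z = H *v (H *v z)" "matrix_inv S *v z = P *v (P *v z)"
    "J2 *v z = S *v (J1 *v (S *v z))" "?J *v z = H *v (J1 *v (H *v z))" for z
    by (simp_all add: matrix_vector_mul_assoc HP PH S Si J2[symmetric] matrix_mul_assoc)
  have [measurable]: "?D \<in> borel_measurable borel"
    by (rule borel_measurable_linear, rule linearI)
       (simp_all add: map_prod_def split_beta matrix_vector_right_distrib matrix_vector_mult_scaleR)
  show "standard_brownian_motion \<Omega> W" by (rule bm)
  show "linear (drift ?J \<gamma> \<mu>)" by (rule linear_drift)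
  show "linear (momentum_noise (sqrt (2 * \<gamma>)) :: real ^ 'n \<Rightarrow> _)" by (rule linear_momentum_noise)
  show "\<theta> \<bullet> drift ?J \<gamma> \<mu> \<theta> = - (adjoint (momentum_noise (sqrt (2 * \<gamma>))) \<theta> \<bullet> adjoint (momentum_noise (sqrt (2 * \<gamma>))) \<theta>) / 2" for \<theta>
    by (rule drift_lyapunov[OF sJ \<gamma>])
  show "(\<lambda>\<omega>. ?D (X (?D' y) t \<omega>)) \<in> borel_measurable \<Omega>" if "t \<ge> 0" for y t
  proof -
    have [measurable]: "X (?D' y) t \<in> borel_measurable \<Omega>"
      using dyn that unfolding perturbed_langevin_dynamics_def by blast
    show ?thesis by measurable
  qed
  fix y
  have "AE \<omega> in \<Omega>. continuous_on {0..} (\<lambda>t. X (?D' y) t \<omega>) \<and>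
         (\<forall>t\<ge>0.
            fst (X (?D' y) t \<omega>) = fst (?D' y)
              + integral {0..t} (\<lambda>s. matrix_inv S *v snd (X (?D' y) s \<omega>)
                                   - \<mu> *\<^sub>R (J1 *v gradient V (fst (X (?D' y) s \<omega>)))) \<and>
            snd (X (?D' y) t \<omega>) = snd (?D' y)
              + integral {0..t} (\<lambda>s. - gradient V (fst (X (?D' y) s \<omega>))
                                   - \<mu> *\<^sub>R (J2 *v (matrix_inv S *v snd (X (?D' y) s \<omega>)))
                                   - (\<gamma> *\<^sub>R S) *v (matrix_inv S *v snd (X (?D' y) s \<omega>)))
              + R *v W t \<omega>)"
    using dyn unfolding perturbed_langevin_dynamics_def by blast
  then show "AE \<omega> in \<Omega>. continuous_on {0..} (\<lambda>t. ?D (X (?D' y) t \<omega>)) \<and>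
     (\<forall>t\<ge>0. ?D (X (?D' y) t \<omega>) = y + integral {0..t} (\<lambda>s. drift ?J \<gamma> \<mu> (?D (X (?D' y) s \<omega>))) + momentum_noise (sqrt (2 * \<gamma>)) (W t \<omega>))"
  proof eventually_elim
    case (elim \<omega>)
    define q p where "q s = fst (X (?D' y) s \<omega>)" and "p s = snd (X (?D' y) s \<omega>)" for s
    have cX: "continuous_on {0..} (\<lambda>t. X (?D' y) t \<omega>)" using elim by blast
    have cq: "continuous_on A q" "continuous_on A p" if "A \<subseteq> {0..}" for A
      unfolding q_def p_def using continuous_on_subset[OF cX that] by (auto intro: continuous_intros)
    have cM: "continuous_on T (\<lambda>s. M *v g s)" if "continuous_on T g" for M :: "real^'n^'n" and g :: "real \<Rightarrow> real^'n" and T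
      by (rule bounded_linear.continuous_on[OF matrix_vector_mul_bounded_linear that])
    have DX: "?D (X (?D' y) t \<omega>) = (H *v q t, P *v p t)" for t
      by (simp add: q_def p_def map_prod_def split_beta)
    have "(H *v q t, P *v p t) = y + integral {0..t} (\<lambda>s. drift ?J \<gamma> \<mu> (H *v q s, P *v p s)) + momentum_noise (sqrt (2 * \<gamma>)) (W t \<omega>)"
      if t: "t \<ge> 0" for t
    proof -
      note c = cq[of "{0..t}"]
      have eq: "q t = P *v fst y + integral {0..t} (\<lambda>s. P *v (P *v p s) - \<mu> *\<^sub>R (J1 *v (H *v (H *v q s))))"
        "p t = H *v snd y + integral {0..t} (\<lambda>s. - (H *v (H *v q s)) - \<mu> *\<^sub>R (H *v (H *v (J1 *v p s))) - \<gamma> *\<^sub>R p s)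
           + sqrt (2 * \<gamma>) *\<^sub>R (H *v W t \<omega>)"
        using elim t by (simp_all add: q_def p_def grad v R scaleR_matrix_vector_assoc[symmetric])
      have push: "M *v integral {0..t} g = integral {0..t} (\<lambda>s. M *v g s)" if "continuous_on {0..t} g" for M :: "real^'n^'n" and g
        using integral_linear[OF integrable_continuous_real[OF that] matrix_vector_mul_bounded_linear[of M]] by (simp add: o_def)
      have 1: "H *v q t = fst y + integral {0..t} (\<lambda>s. P *v p s - \<mu> *\<^sub>R (?J *v (H *v q s)))"
        unfolding eq(1)
        by (subst matrix_vector_right_distrib, subst push)
           (auto intro!: continuous_intros cM c simp: v matrix_vector_mult_diff_distrib matrix_vector_mult_scaleR)
      have 2: "P *v p t = snd y + integral {0..t} (\<lambda>s. - (H *v q s) - \<mu> *\<^sub>R (?J *v (P *v p s)) - \<gamma> *\<^sub>R (P *v p s)) + sqrt (2 * \<gamma>) *\<^sub>R W t \<omega>"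
        unfolding eq(2)
        by (subst matrix_vector_right_distrib, subst matrix_vector_right_distrib, subst push)
           (auto intro!: continuous_intros cM c simp: v matrix_vector_mult_diff_distrib matrix_vector_mult_scaleR linear_neg[OF matrix_vector_mul_linear])
      have int: "(\<lambda>s. drift ?J \<gamma> \<mu> (H *v q s, P *v p s)) integrable_on {0..t}"
        unfolding drift_def by (auto intro!: integrable_continuous_real continuous_intros cM c)
      have fi: "fst (integral {0..t} (\<lambda>s. drift ?J \<gamma> \<mu> (H *v q s, P *v p s))) = integral {0..t} (\<lambda>s. P *v p s - \<mu> *\<^sub>R (?J *v (H *v q s)))"
        using integral_linear[OF int bounded_linear_fst] by (simp add: o_def drift_def)
      have si: "snd (integral {0..t} (\<lambda>s. drift ?J \<gamma> \<mu> (H *v q s, P *v p s))) = integral {0..t} (\<lambda>s. - (H *v q s) - \<mu> *\<^sub>R (?J *v (P *v p s)) - \<gamma> *\<^sub>R (P *v p s))"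
        using integral_linear[OF int bounded_linear_snd] by (simp add: o_def drift_def)
      show ?thesis
        by (rule prod_eqI) (simp_all add: fi si 1 2 momentum_noise_def)
    qed
    moreover have "continuous_on {0..} (\<lambda>t. (H *v q t, P *v p t))"
      by (auto intro!: continuous_intros cM cq)
    ultimately show ?case unfolding DX by blast
  qed
qed

subsection \<open>Expansion of the asymptotic variance\<close>

definition commutator :: "real ^ 'n ^ 'n \<Rightarrow> real ^ 'n ^ 'n \<Rightarrow> real ^ 'n ^ 'n" where
  "commutator A J = A ** J - J ** A"

lemma matrix_mul_add_rdistrib:
  fixes A B C :: "real ^ 'n ^ 'n"
  shows "(A + B) ** C = A ** C + B ** C"
  by (simp add: matrix_matrix_mult_def vec_eq_iff distrib_right sum.distrib)

lemma linear_commutator: "linear (\<lambda>A :: real ^ 'n ^ 'n. commutator A J)"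
  by (rule linearI)
     (simp_all add: commutator_def matrix_add_ldistrib matrix_mul_add_rdistrib matrix_scalar_ac scalar_matrix_assoc[symmetric] algebra_simps)

lemma inner_matrix_mult:
  fixes A B J :: "real ^ 'n ^ 'n"
  shows "(A ** J) \<bullet> B = A \<bullet> (B ** transpose J)" "(J ** A) \<bullet> B = A \<bullet> (transpose J ** B)"
proof -
  have "(A ** J) \<bullet> B = (\<Sum>i\<in>UNIV. \<Sum>k\<in>UNIV. \<Sum>j\<in>UNIV. A $ i $ j * J $ j $ k * B $ i $ k)"
    by (simp add: inner_vec_def matrix_matrix_mult_def sum_distrib_right)
  also have "\<dots> = (\<Sum>i\<in>UNIV. \<Sum>j\<in>UNIV. \<Sum>k\<in>UNIV. A $ i $ j * J $ j $ k * B $ i $ k)"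
    by (intro sum.cong refl sum.swap)
  also have "\<dots> = A \<bullet> (B ** transpose J)"
    by (simp add: inner_vec_def matrix_matrix_mult_def transpose_def sum_distrib_left ac_simps)
  finally show "(A ** J) \<bullet> B = A \<bullet> (B ** transpose J)" .
  have "(J ** A) \<bullet> B = (\<Sum>i\<in>UNIV. \<Sum>k\<in>UNIV. \<Sum>j\<in>UNIV. J $ i $ j * A $ j $ k * B $ i $ k)"
    by (simp add: inner_vec_def matrix_matrix_mult_def sum_distrib_right)
  also have "\<dots> = (\<Sum>i\<in>UNIV. \<Sum>j\<in>UNIV. \<Sum>k\<in>UNIV. J $ i $ j * A $ j $ k * B $ i $ k)"
    by (intro sum.cong refl sum.swap)
  also have "\<dots> = (\<Sum>j\<in>UNIV. \<Sum>i\<in>UNIV. \<Sum>k\<in>UNIV. J $ i $ j * A $ j $ k * B $ i $ k)"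
    by (rule sum.swap)
  also have "\<dots> = (\<Sum>j\<in>UNIV. \<Sum>k\<in>UNIV. \<Sum>i\<in>UNIV. J $ i $ j * A $ j $ k * B $ i $ k)"
    by (intro sum.cong refl sum.swap)
  also have "\<dots> = A \<bullet> (transpose J ** B)"
    by (simp add: inner_vec_def matrix_matrix_mult_def transpose_def sum_distrib_left ac_simps)
  finally show "(J ** A) \<bullet> B = A \<bullet> (transpose J ** B)" .
qed

lemma commutator_skew:
  fixes A B J :: "real ^ 'n ^ 'n"
  assumes "skew_symmetric_matrix J"
  shows "commutator A J \<bullet> B = - (A \<bullet> commutator B J)" "commutator A J \<bullet> A = 0"
proof -
  have *: "commutator A J \<bullet> B = - (A \<bullet> commutator B J)" for A B
    using assms unfolding commutator_def skew_symmetric_matrix_def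
    by (simp add: inner_diff_left inner_diff_right inner_matrix_mult(1)[of A J B] inner_matrix_mult(2)[of J A B] matrix_mul_uminus)
  then show "commutator A J \<bullet> B = - (A \<bullet> commutator B J)" .
  show "commutator A J \<bullet> A = 0" using *[of A A] by (simp add: inner_commute)
qed

text \<open>Ensures that transposing all matrices in a solution of the coefficient equations, with
  \<open>K\<close> symmetric, gives another solution.\<close>

lemma transpose_commutator:
  fixes A J :: "real ^ 'n ^ 'n"
  assumes "skew_symmetric_matrix J"
  shows "transpose (commutator A J) = commutator (transpose A) J"
proof -
  have t: "transpose (X - Y) = transpose X - transpose Y" for X Y :: "real ^ 'n ^ 'n"
    by (simp add: transpose_def vec_eq_iff)
  show ?thesis
    using assms unfolding commutator_def skew_symmetric_matrix_def
    by (simp add: t matrix_transpose_mul matrix_mul_uminus)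
qed

text \<open>Solving the part of the system that is free of \<open>\<mu>\<close> brings it to the form \<open>u = u0 + \<mu> Q u\<close>. As \<open>K\<close> is
  symmetric, the symmetrized coefficients solve the system as well.\<close>

lemma poisson_coefficients:
  fixes J K :: "real ^ 'n ^ 'n" and l :: "real ^ 'n"
  assumes J: "skew_symmetric_matrix J" and K: "symmetric_matrix K" and \<gamma>: "\<gamma> > 0"
  obtains \<delta> E F G a b D where "\<delta> > 0"
    "\<And>\<mu>. \<bar>\<mu>\<bar> < \<delta> \<Longrightarrow> symmetric_matrix (E \<mu>) \<and> symmetric_matrix (F \<mu>) \<and> symmetric_matrix (G \<mu>)"
    "\<And>\<mu>. \<bar>\<mu>\<bar> < \<delta> \<Longrightarrow> 2 *\<^sub>R F \<mu> + \<mu> *\<^sub>R commutator (E \<mu>) J = K"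
    "\<And>\<mu>. \<bar>\<mu>\<bar> < \<delta> \<Longrightarrow> E \<mu> = \<gamma> *\<^sub>R F \<mu> + G \<mu> + \<mu> *\<^sub>R commutator (F \<mu>) J"
    "\<And>\<mu>. \<bar>\<mu>\<bar> < \<delta> \<Longrightarrow> 2 *\<^sub>R F \<mu> = (2 * \<gamma>) *\<^sub>R G \<mu> + \<mu> *\<^sub>R commutator (G \<mu>) J"
    "\<And>\<mu>. \<bar>\<mu>\<bar> < \<delta> \<Longrightarrow> b \<mu> = l + \<mu> *\<^sub>R (J *v a \<mu>)"
    "\<And>\<mu>. \<bar>\<mu>\<bar> < \<delta> \<Longrightarrow> a \<mu> = \<gamma> *\<^sub>R b \<mu> - \<mu> *\<^sub>R (J *v b \<mu>)"
    "\<And>\<mu>. \<bar>\<mu>\<bar> < \<delta> \<Longrightarrow> ((\<lambda>\<mu>. 2 * (E \<mu> \<bullet> K) + a \<mu> \<bullet> l) has_real_derivative D \<mu>) (at \<mu>)"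
    "D 0 = 0"
    "(D has_real_derivative
       - (\<gamma> ^ 6 - \<gamma> ^ 4 + \<gamma>\<^sup>2 + 4) / (2 * \<gamma> ^ 3) * (norm (commutator K J))\<^sup>2 - 2 * \<gamma> * (\<gamma>\<^sup>2 - 2) * (norm (J *v l))\<^sup>2) (at 0)"
proof -
  define T where "T A = commutator A J" for A
  have lT: "linear T" unfolding T_def[abs_def] by (rule linear_commutator)
  note Tsimps = linear_add[OF lT] linear_diff[OF lT] linear_cmul[OF lT] linear_neg[OF lT]
  \<comment> \<open>From \<open>2 F = K - \<mu> T E\<close> and
    \<open>2 \<gamma> G = 2 F - \<mu> T G\<close>. Eliminating \<open>F\<close> from the latter is
    why \<open>QG\<close> contains both \<open>T E\<close> and \<open>T G\<close>.\<close>
  define QF where "QF E = (- 1 / 2) *\<^sub>R T E" for E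
  define QG where "QG E G = (- 1 / (2 * \<gamma>)) *\<^sub>R (T E + T G)" for E G
  define Q where "Q = (\<lambda>(E, F, G, a, b). (T F + \<gamma> *\<^sub>R QF E + QG E G, QF E, QG E G, \<gamma> *\<^sub>R (J *v a) - J *v b, J *v a))"
  define L where "L = (\<lambda>(E, F :: real^'n^'n, G :: real^'n^'n, a, b :: real^'n). 2 * (E \<bullet> K) + a \<bullet> l)"
  have lQ: "bounded_linear Q"
    unfolding linear_conv_bounded_linear[symmetric] Q_def QF_def QG_def
    by (rule linearI) (auto simp: Tsimps matrix_vector_right_distrib matrix_vector_mult_scaleR algebra_simps)
  have lL: "bounded_linear L"
    unfolding linear_conv_bounded_linear[symmetric] L_def
    by (rule linearI) (auto simp: inner_add_left algebra_simps)
  \<comment> \<open>The solution at \<mu> = 0: \<open>F = K / 2\<close>,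
    \<open>G = F / \<gamma>\<close>, \<open>E = \<gamma> F + G\<close>, \<open>b = l\<close> and
    \<open>a = \<gamma> l\<close>.\<close>
  define u0 where "u0 = ((\<gamma> / 2 + 1 / (2 * \<gamma>)) *\<^sub>R K, (1 / 2) *\<^sub>R K, (1 / (2 * \<gamma>)) *\<^sub>R K, \<gamma> *\<^sub>R l, l)"
  obtain \<delta> U D where \<delta>: "\<delta> > 0"
    and U: "\<And>\<mu>. \<bar>\<mu>\<bar> < \<delta> \<Longrightarrow> U \<mu> = u0 + \<mu> *\<^sub>R Q (U \<mu>)"
    and D: "\<And>\<mu>. \<bar>\<mu>\<bar> < \<delta> \<Longrightarrow> ((\<lambda>\<mu>. L (U \<mu>)) has_real_derivative D \<mu>) (at \<mu>)"
    and D0: "D 0 = L (Q u0)" and D2: "(D has_real_derivative 2 * L (Q (Q u0))) (at 0)"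
    using Neumann_series_derivatives[OF lQ lL] by metis
  define E0 F0 G0 a b where "E0 \<mu> = fst (U \<mu>)" and "F0 \<mu> = fst (snd (U \<mu>))" and "G0 \<mu> = fst (snd (snd (U \<mu>)))"
    and "a \<mu> = fst (snd (snd (snd (U \<mu>))))" and "b \<mu> = snd (snd (snd (snd (U \<mu>))))" for \<mu>
  have Ut: "U \<mu> = (E0 \<mu>, F0 \<mu>, G0 \<mu>, a \<mu>, b \<mu>)" for \<mu>
    by (simp add: E0_def F0_def G0_def a_def b_def)
  \<comment> \<open>Symmetrisation commutes with \<open>T\<close> and fixes \<open>K\<close>. It
    also preserves the pairing with \<open>K\<close>, so the derivatives of the original series
    remain valid for the symmetrised coefficients.\<close>
  define S where "S A = (1 / 2) *\<^sub>R (A + transpose A)" for A :: "real ^ 'n ^ 'n"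
  have lin_t: "transpose (A + B) = transpose A + transpose B" "transpose (c *\<^sub>R A) = c *\<^sub>R transpose A"
    for A B :: "real ^ 'n ^ 'n" and c by (simp_all add: transpose_def vec_eq_iff)
  have lS: "S (A + B) = S A + S B" "S (c *\<^sub>R A) = c *\<^sub>R S A" for A B c
    unfolding S_def by (simp_all add: lin_t algebra_simps)
  have ST: "T (S A) = S (T A)" for A
    unfolding S_def by (simp add: Tsimps lin_t) (simp add: T_def transpose_commutator[OF J])
  have SK: "S K = K" using K unfolding S_def symmetric_matrix_def by (simp add: scaleR_2[symmetric])
  have Ssym: "symmetric_matrix (S A)" for A
    unfolding symmetric_matrix_def S_def by (simp add: lin_t add.commute)
  have eqs: "F0 \<mu> = (1 / 2) *\<^sub>R K + \<mu> *\<^sub>R QF (E0 \<mu>)" "G0 \<mu> = (1 / (2 * \<gamma>)) *\<^sub>R K + \<mu> *\<^sub>R QG (E0 \<mu>) (G0 \<mu>)"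
    "E0 \<mu> = (\<gamma> / 2 + 1 / (2 * \<gamma>)) *\<^sub>R K + \<mu> *\<^sub>R (T (F0 \<mu>) + \<gamma> *\<^sub>R QF (E0 \<mu>) + QG (E0 \<mu>) (G0 \<mu>))"
    "a \<mu> = \<gamma> *\<^sub>R l + \<mu> *\<^sub>R (\<gamma> *\<^sub>R (J *v a \<mu>) - J *v b \<mu>)" "b \<mu> = l + \<mu> *\<^sub>R (J *v a \<mu>)"
    if "\<bar>\<mu>\<bar> < \<delta>" for \<mu>
    using U[OF that] unfolding Ut u0_def Q_def split_conv scaleR_Pair add_Pair prod.inject by blast+
  show ?thesis
  proof (rule that[where \<delta>=\<delta> and E="\<lambda>\<mu>. S (E0 \<mu>)" and F="\<lambda>\<mu>. S (F0 \<mu>)" and G="\<lambda>\<mu>. S (G0 \<mu>)" and a=a and b=b and D=D])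
    show "\<delta> > 0" by (rule \<delta>)
    fix \<mu> :: real assume \<mu>: "\<bar>\<mu>\<bar> < \<delta>"
    note e = eqs[OF \<mu>]
    show "symmetric_matrix (S (E0 \<mu>)) \<and> symmetric_matrix (S (F0 \<mu>)) \<and> symmetric_matrix (S (G0 \<mu>))" by (simp add: Ssym)
    have "2 *\<^sub>R F0 \<mu> + \<mu> *\<^sub>R T (E0 \<mu>) = K" by (subst e(1)) (simp add: QF_def algebra_simps)
    from arg_cong[OF this, of S] show "2 *\<^sub>R S (F0 \<mu>) + \<mu> *\<^sub>R commutator (S (E0 \<mu>)) J = K"
      unfolding T_def[symmetric] by (simp add: lS SK ST)
    have "E0 \<mu> = \<gamma> *\<^sub>R ((1 / 2) *\<^sub>R K + \<mu> *\<^sub>R QF (E0 \<mu>)) + ((1 / (2 * \<gamma>)) *\<^sub>R K + \<mu> *\<^sub>R QG (E0 \<mu>) (G0 \<mu>)) + \<mu> *\<^sub>R T (F0 \<mu>)"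
      by (subst e(3)) (simp add: algebra_simps)
    then have "E0 \<mu> = \<gamma> *\<^sub>R F0 \<mu> + G0 \<mu> + \<mu> *\<^sub>R T (F0 \<mu>)"
      unfolding e(1,2)[symmetric] .
    from arg_cong[OF this, of S] show "S (E0 \<mu>) = \<gamma> *\<^sub>R S (F0 \<mu>) + S (G0 \<mu>) + \<mu> *\<^sub>R commutator (S (F0 \<mu>)) J"
      unfolding T_def[symmetric] by (simp add: lS ST)
    have "(2 * \<gamma>) *\<^sub>R G0 \<mu> + \<mu> *\<^sub>R T (G0 \<mu>) = K - \<mu> *\<^sub>R T (E0 \<mu>)"
    proof -
      have "(2 * \<gamma>) *\<^sub>R G0 \<mu> = K - \<mu> *\<^sub>R (T (E0 \<mu>) + T (G0 \<mu>))"
        by (subst e(2)) (use \<gamma> in \<open>simp add: QG_def algebra_simps\<close>)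
      then show ?thesis by (simp add: algebra_simps)
    qed
    also have "\<dots> = 2 *\<^sub>R F0 \<mu>" by (subst e(1)) (simp add: QF_def algebra_simps)
    finally have "2 *\<^sub>R F0 \<mu> = (2 * \<gamma>) *\<^sub>R G0 \<mu> + \<mu> *\<^sub>R T (G0 \<mu>)" ..
    from arg_cong[OF this, of S] show "2 *\<^sub>R S (F0 \<mu>) = (2 * \<gamma>) *\<^sub>R S (G0 \<mu>) + \<mu> *\<^sub>R commutator (S (G0 \<mu>)) J"
      unfolding T_def[symmetric] by (simp add: lS ST)
    show b: "b \<mu> = l + \<mu> *\<^sub>R (J *v a \<mu>)" by (rule e(5))
    have "a \<mu> = \<gamma> *\<^sub>R (l + \<mu> *\<^sub>R (J *v a \<mu>)) - \<mu> *\<^sub>R (J *v b \<mu>)"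
      by (subst e(4)) (simp add: algebra_simps)
    then show "a \<mu> = \<gamma> *\<^sub>R b \<mu> - \<mu> *\<^sub>R (J *v b \<mu>)" unfolding b[symmetric] .
    have "S A \<bullet> K = A \<bullet> K" for A
    proof -
      have "transpose A \<bullet> transpose K = A \<bullet> K"
        unfolding inner_vec_def transpose_def by simp (rule sum.swap)
      then show ?thesis using K unfolding S_def symmetric_matrix_def by (simp add: inner_add_left)
    qed
    then have "(\<lambda>\<mu>. 2 * (S (E0 \<mu>) \<bullet> K) + a \<mu> \<bullet> l) = (\<lambda>\<mu>. L (U \<mu>))"
      by (simp add: L_def Ut)
    then show "((\<lambda>\<mu>. 2 * (S (E0 \<mu>) \<bullet> K) + a \<mu> \<bullet> l) has_real_derivative D \<mu>) (at \<mu>)"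
      using D[OF \<mu>] by simp
  next
    have TK: "T K \<bullet> K = 0" "T (T K) \<bullet> K = - (norm (T K))\<^sup>2"
      using commutator_skew(1)[OF J, of "T K" K] commutator_skew(2)[OF J, of K]
      unfolding T_def[symmetric] by (simp_all add: power2_norm_eq_inner)
    have Jl: "(J *v l) \<bullet> l = 0" "(J *v (J *v l)) \<bullet> l = - (norm (J *v l))\<^sup>2"
      using skew_symmetric_inner(2)[OF J, of l] skew_symmetric_inner(1)[OF J, of "J *v l" l]
      by (simp_all add: power2_norm_eq_inner inner_commute)
    \<comment> \<open>At first order all matrices are multiples of \<open>T K\<close> and all
      vectors multiples of \<open>J *v l\<close>, which reduces the second order to scalar
      arithmetic. The existential quantifiers replace the raw scalars by their simplified
      values.\<close>
    have QQ: "\<exists>e1 f1 g1. Q u0 = (e1 *\<^sub>R T K, f1 *\<^sub>R T K, g1 *\<^sub>R T K, (\<gamma>\<^sup>2 - 1) *\<^sub>R (J *v l), \<gamma> *\<^sub>R (J *v l))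
       \<and> f1 = - (\<gamma>\<^sup>2 + 1) / (4 * \<gamma>) \<and> g1 = - (\<gamma>\<^sup>2 + 2) / (4 * \<gamma>\<^sup>2) \<and> e1 = - (\<gamma> ^ 4 + 2) / (4 * \<gamma>\<^sup>2)"
    proof (intro exI conjI)
      show "Q u0 = ((1 / 2 + \<gamma> * (- 1 / 2 * (\<gamma> / 2 + 1 / (2 * \<gamma>))) + (- 1 / (2 * \<gamma>)) * ((\<gamma> / 2 + 1 / (2 * \<gamma>)) + 1 / (2 * \<gamma>))) *\<^sub>R T K,
         (- 1 / 2 * (\<gamma> / 2 + 1 / (2 * \<gamma>))) *\<^sub>R T K, ((- 1 / (2 * \<gamma>)) * ((\<gamma> / 2 + 1 / (2 * \<gamma>)) + 1 / (2 * \<gamma>))) *\<^sub>R T K,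
         (\<gamma>\<^sup>2 - 1) *\<^sub>R (J *v l), \<gamma> *\<^sub>R (J *v l))"
        unfolding u0_def Q_def QF_def QG_def split_conv Tsimps matrix_vector_mult_scaleR scaleR_scaleR scaleR_add_left[symmetric]
        by (simp add: scaleR_diff_left power2_eq_square)
    qed (use \<gamma> in \<open>simp_all add: field_simps, simp_all add: algebra_simps power_numeral_reduce\<close>)
    then obtain e1 f1 g1 where Qu0: "Q u0 = (e1 *\<^sub>R T K, f1 *\<^sub>R T K, g1 *\<^sub>R T K, (\<gamma>\<^sup>2 - 1) *\<^sub>R (J *v l), \<gamma> *\<^sub>R (J *v l))"
      and c1: "f1 = - (\<gamma>\<^sup>2 + 1) / (4 * \<gamma>)" "g1 = - (\<gamma>\<^sup>2 + 2) / (4 * \<gamma>\<^sup>2)" "e1 = - (\<gamma> ^ 4 + 2) / (4 * \<gamma>\<^sup>2)"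
      by blast
    show "D 0 = 0" unfolding D0 Qu0 L_def by (simp add: TK Jl)
    \<comment> \<open>\<open>L\<close> reads only the components \<open>E\<close> and
      \<open>a\<close> of the tuple produced by \<open>Q\<close>, so a tuple of this shape yields
      just two scalar products.\<close>
    have L: "L (Q (e *\<^sub>R v, f *\<^sub>R v, g *\<^sub>R v, x *\<^sub>R w, y *\<^sub>R w))
      = 2 * ((f - \<gamma> / 2 * e - (e + g) / (2 * \<gamma>)) * (T v \<bullet> K)) + (\<gamma> * x - y) * ((J *v w) \<bullet> l)" for e f g x y v w
      unfolding Q_def QF_def QG_def L_def split_conv Tsimps matrix_vector_mult_scaleR
      by (simp add: inner_add_left inner_diff_left algebra_simps add_divide_distrib)
    have LQQ: "L (Q (Q u0)) = 2 * ((f1 - \<gamma> / 2 * e1 - (e1 + g1) / (2 * \<gamma>)) * (T (T K) \<bullet> K)) + (\<gamma> * (\<gamma>\<^sup>2 - 1) - \<gamma>) * ((J *v (J *v l)) \<bullet> l)"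
      by (simp only: Qu0 L)
    have e2: "f1 - \<gamma> / 2 * e1 - (e1 + g1) / (2 * \<gamma>) = (\<gamma> ^ 6 - \<gamma> ^ 4 + \<gamma>\<^sup>2 + 4) / (8 * \<gamma> ^ 3)"
      unfolding c1 using \<gamma> by (simp add: field_simps) (simp add: algebra_simps power_numeral_reduce)
    \<comment> \<open>\<open>N1\<close> and \<open>N2\<close> are the squared norms; their minus
      signs come from applying \<open>T\<close> and \<open>J\<close> twice. The outer factor 2
      belongs to the second derivative.\<close>
    have collect: "2 * (2 * (P / (8 * c) * (- N1)) + (\<gamma> * (\<gamma>\<^sup>2 - 1) - \<gamma>) * (- N2)) = - P / (2 * c) * N1 - 2 * \<gamma> * (\<gamma>\<^sup>2 - 2) * N2"
      for P c N1 N2 :: real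
      by (simp add: algebra_simps)
    have "2 * L (Q (Q u0)) = - (\<gamma> ^ 6 - \<gamma> ^ 4 + \<gamma>\<^sup>2 + 4) / (2 * \<gamma> ^ 3) * (norm (T K))\<^sup>2 - 2 * \<gamma> * (\<gamma>\<^sup>2 - 2) * (norm (J *v l))\<^sup>2"
      by (simp only: LQQ e2 TK Jl collect)
    then show "(D has_real_derivative
       - (\<gamma> ^ 6 - \<gamma> ^ 4 + \<gamma>\<^sup>2 + 4) / (2 * \<gamma> ^ 3) * (norm (commutator K J))\<^sup>2 - 2 * \<gamma> * (\<gamma>\<^sup>2 - 2) * (norm (J *v l))\<^sup>2) (at 0)"
      using D2 unfolding T_def[symmetric] by simp
  qed
qed

text \<open>\<open>H\<close> is read off from the given noise coefficient, as \<open>R\<close> is a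
  square root of \<open>(2 * \<gamma>) *\<^sub>R S\<close>. Invertibility follows from definiteness:
  \<open>H *v x = 0\<close> forces \<open>x \<bullet> (S *v x) = 0\<close>.\<close>

lemma positive_definite_sqrt:
  fixes S R :: "real ^ 'n ^ 'n"
  assumes S: "positive_definite_matrix S" and R: "is_matrix_sqrt R ((2 * \<gamma>) *\<^sub>R S)" and \<gamma>: "\<gamma> > 0"
  obtains H P where "R = sqrt (2 * \<gamma>) *\<^sub>R H" "symmetric_matrix H" "symmetric_matrix P"
    "H ** H = S" "H ** P = mat 1" "P ** H = mat 1"
proof -
  define H where "H = (1 / sqrt (2 * \<gamma>)) *\<^sub>R R"
  have RH: "R = sqrt (2 * \<gamma>) *\<^sub>R H" using \<gamma> by (simp add: H_def)
  have symH: "symmetric_matrix H"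
    using R unfolding is_matrix_sqrt_def symmetric_matrix_def H_def by (simp add: transpose_scalar)
  have HH: "H ** H = S"
  proof -
    have "H ** H = (1 / (2 * \<gamma>)) *\<^sub>R (R ** R)"
      using \<gamma> unfolding H_def by (simp add: matrix_scalar_ac scalar_matrix_assoc[symmetric])
    then show ?thesis using R \<gamma> by (simp add: is_matrix_sqrt_def)
  qed
  have "x = 0" if "H *v x = 0" for x
  proof (rule ccontr)
    assume "x \<noteq> 0"
    then have "x \<bullet> (S *v x) > 0" using S by (simp add: positive_definite_matrix_def)
    then show False using that by (simp add: HH[symmetric] matrix_vector_mul_assoc[symmetric])
  qed
  then obtain P where PH: "P ** H = mat 1" using matrix_left_invertible_ker[of H] by blast
  then have HP: "H ** P = mat 1" using matrix_left_right_inverse by blast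
  have "transpose P ** H = mat 1"
    using arg_cong[OF HP, of transpose] symH by (simp add: matrix_transpose_mul symmetric_matrix_def)
  then have "transpose P ** (H ** P) = P" by (simp add: matrix_mul_assoc)
  then have "symmetric_matrix P" by (simp add: HP symmetric_matrix_def)
  with that RH symH HH HP PH show ?thesis by blast
qed

theorem corollary4:
  fixes S M \<Gamma> R J1 J2 K :: "real ^ 'n ^ 'n"
    and l :: "real ^ 'n" and C \<gamma> :: real
    and V f :: "real ^ 'n \<Rightarrow> real"
    and \<Omega> :: "'w measure" and W :: "real \<Rightarrow> 'w \<Rightarrow> real ^ 'n"
    and X :: "real \<Rightarrow> (real ^ 'n) \<times> (real ^ 'n) \<Rightarrow> real \<Rightarrow> 'w \<Rightarrow> (real ^ 'n) \<times> (real ^ 'n)"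
    and \<sigma>2 :: "real \<Rightarrow> real"
  assumes "positive_definite_matrix S"
    and "skew_symmetric_matrix J1" and "skew_symmetric_matrix J2"
    and "V = (\<lambda>q. 1 / 2 * (q \<bullet> (S *v q)))"
    and "M = S" and "\<Gamma> = \<gamma> *\<^sub>R S" and "\<gamma> > sqrt 2" and "S ** J1 ** S = J2"
    and "is_matrix_sqrt R (2 *\<^sub>R \<Gamma>)"
    and "standard_brownian_motion \<Omega> W"
    and "\<And>\<mu>. perturbed_langevin_dynamics \<Omega> W V M \<Gamma> R J1 J2 \<mu> (X \<mu>)"
    and "symmetric_matrix K"
    and "f = (\<lambda>q. q \<bullet> (K *v q) + l \<bullet> q + C)"
    and "K ** J1 ** S \<noteq> S ** J1 ** K \<or> J1 *v l \<noteq> 0"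
    and "\<sigma>2 = (\<lambda>\<mu>. asymptotic_variance \<Omega> (X \<mu>)
                (centered_gaussian (matrix_inv S)) (centered_gaussian M) f)"
  shows "\<exists>D1 D2. (\<forall>\<^sub>F \<mu> in nhds 0. (\<sigma>2 has_real_derivative D1 \<mu>) (at \<mu>)) \<and>
                 D1 0 = 0 \<and>
                 (D1 has_real_derivative D2) (at 0) \<and> D2 < 0"
proof -
  have "0 \<le> sqrt 2" by simp
  then have \<gamma>: "\<gamma> > 0" "\<gamma> \<ge> 0" using assms(7) by linarith+
  have "(sqrt 2)\<^sup>2 < \<gamma>\<^sup>2" using assms(7) by (intro power_strict_mono) simp_all
  then have \<gamma>2: "\<gamma>\<^sup>2 > 2" by simp
  have symS: "symmetric_matrix S" using assms(1) by (simp add: positive_definite_matrix_def)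
  have "is_matrix_sqrt R ((2 * \<gamma>) *\<^sub>R S)" using assms(6,9) by simp
  then obtain H P where R: "R = sqrt (2 * \<gamma>) *\<^sub>R H" and symH: "symmetric_matrix H" and symP: "symmetric_matrix P"
    and HH: "H ** H = S" and HP: "H ** P = mat 1" and PH: "P ** H = mat 1"
    using positive_definite_sqrt[OF assms(1) _ \<gamma>(1)] by metis
  have inv: "H *v (P *v x) = x" "P *v (H *v x) = x" for x
    by (simp_all add: matrix_vector_mul_assoc HP PH)
  define J where "J = H ** J1 ** H"
  have J: "skew_symmetric_matrix J"
    using symH assms(2) unfolding J_def skew_symmetric_matrix_def symmetric_matrix_def
    by (simp add: matrix_transpose_mul matrix_mul_assoc matrix_mul_uminus)
  \<comment> \<open>The coefficients of the observable in the variable \<open>H *v q\<close>,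
    obtained by substituting the inverse \<open>P\<close> for both arguments of the quadratic form
    and, in \<open>l'\<close>, for that of the linear form.\<close>
  define K' where "K' = P ** K ** P"
  have K': "symmetric_matrix K'"
    using symP assms(12) unfolding K'_def symmetric_matrix_def by (simp add: matrix_transpose_mul matrix_mul_assoc)
  define l' where "l' = P *v l"
  define Y where "Y \<mu> y t \<omega> = map_prod ((*v) H) ((*v) P) (X \<mu> (map_prod ((*v) P) ((*v) H) y) t \<omega>)" for \<mu> y t \<omega>
  have sde: "linear_sde \<Omega> W (drift J \<gamma> \<mu>) (momentum_noise (sqrt (2 * \<gamma>))) (Y \<mu>)" for \<mu>
    unfolding J_def Y_def
  proof (rule perturbed_langevin_linear_sde[OF assms(10) _ _ HP HH R symH assms(2,8) \<gamma>(2)])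
    show "perturbed_langevin_dynamics \<Omega> W V S (\<gamma> *\<^sub>R S) R J1 J2 \<mu> (X \<mu>)"
      using assms(11)[of \<mu>] unfolding assms(5,6) .
    show "gradient V q = S *v q" for q
      unfolding assms(4) by (rule gradient_quadratic[OF symS])
  qed
  have "S ** (P ** P) = H ** (H ** P) ** P" by (simp add: HH[symmetric] matrix_mul_assoc)
  then have Si: "matrix_inv S = P ** P" by (intro matrix_inv_eqI) (simp add: HP)
  have mHP [measurable]: "(*v) H \<in> borel_measurable borel" "(*v) P \<in> borel_measurable borel" "(*v) K \<in> borel_measurable borel"
    by (intro borel_measurable_continuous_onI continuous_intros)+
  have mf [measurable]: "f \<in> borel_measurable borel" unfolding assms(13) by measurable
  \<comment> \<open>The covariances are \<open>P ** transpose P\<close> and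
    \<open>H ** transpose H\<close>, so \<open>H\<close> on positions and \<open>P\<close> on
    momenta undo both to the standard Gaussian.\<close>
  have cP: "centered_gaussian (matrix_inv S) = distr std_gaussian borel ((*v) P)"
    using centered_gaussian_eq[of P] HP PH symP unfolding Si by (auto simp: symmetric_matrix_def invertible_def)
  have cH: "centered_gaussian M = distr std_gaussian borel ((*v) H)"
    using centered_gaussian_eq[of H] HP PH symH unfolding assms(5) HH[symmetric] by (auto simp: symmetric_matrix_def invertible_def)
  interpret G: prob_space "std_gaussian :: (real ^ 'n) measure" by (rule prob_space_std_gaussian)
  have undo: "distr (distr std_gaussian borel g) borel h = std_gaussian"
    if [measurable]: "g \<in> borel_measurable borel" "h \<in> borel_measurable borel" and hg: "\<And>x. h (g x) = x"
    for g h :: "real ^ 'n \<Rightarrow> real ^ 'n"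
  proof -
    have "distr (distr std_gaussian borel g) borel h = distr std_gaussian borel (h \<circ> g)"
      by (rule distr_distr) measurable
    also have "\<dots> = distr std_gaussian std_gaussian (\<lambda>x. x)"
      by (rule distr_cong) (simp_all add: hg)
    finally show ?thesis by simp
  qed
  have \<sigma>Y: "\<sigma>2 \<mu> = asymptotic_variance \<Omega> (Y \<mu>) std_gaussian std_gaussian (\<lambda>q. q \<bullet> (K' *v q) + l' \<bullet> q + C)" for \<mu>
  proof -
    interpret Y: linear_sde \<Omega> W "drift J \<gamma> \<mu>" "momentum_noise (sqrt (2 * \<gamma>))" "Y \<mu>" by (rule sde)
    have "\<sigma>2 \<mu> = asymptotic_variance \<Omega> (Y \<mu>) (distr (centered_gaussian (matrix_inv S)) borel ((*v) H))
        (distr (centered_gaussian M) borel ((*v) P)) (\<lambda>q. f (P *v q))"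
      unfolding assms(15) Y_def
    proof (rule asymptotic_variance_transfer[where A="(*v) H" and A'="(*v) P" and C="(*v) P" and C'="(*v) H"])
      show "prob_space (centered_gaussian (matrix_inv S))" "prob_space (centered_gaussian M)"
        unfolding cP cH by (intro G.prob_space_distr; simp)+
      show "markov_semigroup \<Omega> (\<lambda>y t \<omega>. map_prod ((*v) H) ((*v) P) (X \<mu> (map_prod ((*v) P) ((*v) H) y) t \<omega>)) t g \<in> borel_measurable borel"
        if "t > 0" "g \<in> borel_measurable borel" for t g
        using Y.markov_semigroup_measurable[of t g] that unfolding Y_def by simp
    qed (simp_all add: cP cH inv mHP mf)
    also have "distr (centered_gaussian (matrix_inv S)) borel ((*v) H) = std_gaussian"
      unfolding cP by (rule undo) (simp_all add: inv)
    also have "distr (centered_gaussian M) borel ((*v) P) = std_gaussian"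
      unfolding cH by (rule undo) (simp_all add: inv)
    also have "(\<lambda>q. f (P *v q)) = (\<lambda>q. q \<bullet> (K' *v q) + l' \<bullet> q + C)"
      unfolding assms(13) K'_def l'_def
      by (simp add: fun_eq_iff matrix_vector_mul_assoc[symmetric] symmetric_inner[OF symP])
    finally show ?thesis by simp
  qed
  obtain \<delta> E F G a b D where \<delta>: "\<delta> > 0"
    and sym: "\<And>\<mu>. \<bar>\<mu>\<bar> < \<delta> \<Longrightarrow> symmetric_matrix (E \<mu>) \<and> symmetric_matrix (F \<mu>) \<and> symmetric_matrix (G \<mu>)"
    and 1: "\<And>\<mu>. \<bar>\<mu>\<bar> < \<delta> \<Longrightarrow> 2 *\<^sub>R F \<mu> + \<mu> *\<^sub>R commutator (E \<mu>) J = K'"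
    and 2: "\<And>\<mu>. \<bar>\<mu>\<bar> < \<delta> \<Longrightarrow> E \<mu> = \<gamma> *\<^sub>R F \<mu> + G \<mu> + \<mu> *\<^sub>R commutator (F \<mu>) J"
    and 3: "\<And>\<mu>. \<bar>\<mu>\<bar> < \<delta> \<Longrightarrow> 2 *\<^sub>R F \<mu> = (2 * \<gamma>) *\<^sub>R G \<mu> + \<mu> *\<^sub>R commutator (G \<mu>) J"
    and 4: "\<And>\<mu>. \<bar>\<mu>\<bar> < \<delta> \<Longrightarrow> b \<mu> = l' + \<mu> *\<^sub>R (J *v a \<mu>)"
    and 5: "\<And>\<mu>. \<bar>\<mu>\<bar> < \<delta> \<Longrightarrow> a \<mu> = \<gamma> *\<^sub>R b \<mu> - \<mu> *\<^sub>R (J *v b \<mu>)"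
    and D: "\<And>\<mu>. \<bar>\<mu>\<bar> < \<delta> \<Longrightarrow> ((\<lambda>\<mu>. 2 * (E \<mu> \<bullet> K') + a \<mu> \<bullet> l') has_real_derivative D \<mu>) (at \<mu>)"
    and D0: "D 0 = 0"
    and D2: "(D has_real_derivative
       - (\<gamma> ^ 6 - \<gamma> ^ 4 + \<gamma>\<^sup>2 + 4) / (2 * \<gamma> ^ 3) * (norm (commutator K' J))\<^sup>2 - 2 * \<gamma> * (\<gamma>\<^sup>2 - 2) * (norm (J *v l'))\<^sup>2) (at 0)"
    by (rule poisson_coefficients[OF J K' \<gamma>(1)]) blast
  \<comment> \<open>The interval of expansion is symmetric about 0, so the coefficients for -\<mu>
    required by the duality are available too.\<close>
  have val: "\<sigma>2 \<mu> = 2 * (E \<mu> \<bullet> K') + a \<mu> \<bullet> l'" if \<mu>: "\<bar>\<mu>\<bar> < \<delta>" for \<mu>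
  proof -
    have small: "\<bar>\<nu>\<bar> < \<delta>" if "\<nu> \<in> {\<mu>, - \<mu>}" for \<nu> using that \<mu> by auto
    show ?thesis
      unfolding \<sigma>Y
      by (rule asymptotic_variance_quadratic[where F=F and G=G and b=b, OF J K' \<gamma>(2) sde])
         (rule sym 1[unfolded commutator_def] 2[unfolded commutator_def] 3[unfolded commutator_def] 4 5, erule small)+
  qed
  have open_ball: "\<forall>\<^sub>F \<mu> in nhds \<nu>. \<bar>\<mu>\<bar> < \<delta>" if "\<bar>\<nu>\<bar> < \<delta>" for \<nu>
  proof -
    have "\<forall>\<^sub>F \<mu> in nhds \<nu>. \<mu> \<in> {- \<delta><..<\<delta>}" using that by (intro eventually_nhds_in_open) auto
    then show ?thesis by eventually_elim auto
  qed
  have "(\<sigma>2 has_real_derivative D \<mu>) (at \<mu>)" if "\<bar>\<mu>\<bar> < \<delta>" for \<mu>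
  proof -
    have "\<forall>\<^sub>F \<nu> in nhds \<mu>. \<sigma>2 \<nu> = 2 * (E \<nu> \<bullet> K') + a \<nu> \<bullet> l'"
      using open_ball[OF that] by eventually_elim (rule val)
    from DERIV_cong_ev[OF refl this refl] show ?thesis using D[OF that] by simp
  qed
  then have ev: "\<forall>\<^sub>F \<mu> in nhds 0. (\<sigma>2 has_real_derivative D \<mu>) (at \<mu>)"
    using open_ball[of 0] \<delta> by (auto elim: eventually_mono)
  let ?c1 = "(\<gamma> ^ 6 - \<gamma> ^ 4 + \<gamma>\<^sup>2 + 4) / (2 * \<gamma> ^ 3)" and ?c2 = "2 * \<gamma> * (\<gamma>\<^sup>2 - 2)"
  have c1: "?c1 > 0"
  proof -
    \<comment> \<open>Splitting off the factor \<gamma>^2 - 2 absorbs the negative power, so the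
      bound on \<gamma> gives positivity.\<close>
    have "\<gamma> ^ 6 - \<gamma> ^ 4 + \<gamma>\<^sup>2 + 4 = \<gamma> ^ 4 * (\<gamma>\<^sup>2 - 2) + \<gamma> ^ 4 + \<gamma>\<^sup>2 + 4"
      by (simp add: algebra_simps flip: power_add)
    moreover have "\<gamma> ^ 4 * (\<gamma>\<^sup>2 - 2) \<ge> 0" "\<gamma> ^ 4 \<ge> 0" using \<gamma>2 by simp_all
    ultimately have "\<gamma> ^ 6 - \<gamma> ^ 4 + \<gamma>\<^sup>2 + 4 > 0" using \<gamma>2 by linarith
    then show ?thesis using \<gamma> by simp
  qed
  have c2: "?c2 > 0" using \<gamma> \<gamma>2 by simp
  have nz: "commutator K' J \<noteq> 0 \<or> J *v l' \<noteq> 0"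
    using assms(14)
  proof
    assume ne: "K ** J1 ** S \<noteq> S ** J1 ** K"
    have "commutator K' J \<noteq> 0"
    proof
      assume "commutator K' J = 0"
      \<comment> \<open>Multiplication by \<open>H\<close> on both sides undoes the normalisation:
        the products become \<open>K ** J1 ** S\<close> and \<open>S ** J1 ** K\<close>.\<close>
      then have "H ** (K' ** J) ** H = H ** (J ** K') ** H" by (simp add: commutator_def)
      moreover have "H ** (K' ** J) ** H = (H ** P) ** K ** (P ** H) ** J1 ** (H ** H)"
        unfolding K'_def J_def by (simp only: matrix_mul_assoc)
      moreover have "H ** (J ** K') ** H = (H ** H) ** J1 ** (H ** P) ** K ** (P ** H)"
        unfolding K'_def J_def by (simp only: matrix_mul_assoc)
      ultimately show False using ne by (simp add: HP PH HH)
    qed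
    then show ?thesis ..
  next
    assume ne: "J1 *v l \<noteq> 0"
    have "J *v l' \<noteq> 0"
    proof
      assume "J *v l' = 0"
      moreover have "P *v (J *v l') = J1 *v l"
        unfolding J_def l'_def by (simp add: matrix_vector_mul_assoc[symmetric] inv)
      ultimately show False using ne by simp
    qed
    then show ?thesis ..
  qed
  have neg: "- x * s\<^sup>2 - y * t\<^sup>2 < 0" if "x > 0" "y > 0" "s \<noteq> 0 \<or> t \<noteq> 0" for x y s t :: real
  proof -
    have "0 \<le> x * s\<^sup>2" "0 \<le> y * t\<^sup>2" "0 < x * s\<^sup>2 \<or> 0 < y * t\<^sup>2" using that by auto
    then show ?thesis by linarith
  qed
  have "- (\<gamma> ^ 6 - \<gamma> ^ 4 + \<gamma>\<^sup>2 + 4) / (2 * \<gamma> ^ 3) * (norm (commutator K' J))\<^sup>2 - ?c2 * (norm (J *v l'))\<^sup>2 < 0"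
    using neg[OF c1 c2, of "norm (commutator K' J)" "norm (J *v l')"] nz unfolding minus_divide_left by simp
  then show ?thesis using ev D0 D2 by blast
qed

end
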